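(* Let $\lambda>0$, $0<q\le 1$ and $\alpha\le p_s^*-1$, and let $u$ be a positive weak solution of $(P_\lambda)$. Then $u\in L^\infty(\Omega)$.
   Context: Let $1<p<\infty$, $s\in(0,1)$, $n>sp$, $p_s^*=\frac{np}{n-sp}$, and let $\Omega\subset\mathbb{R}^n$ be a bounded domain with smooth boundary. Put $Q=\mathbb{R}^{2n}\setminus((\mathbb{R}^n\setminus\Omega)\times(\mathbb{R}^n\setminus\Omega))$. $X_0$ is the space of measurable $u:\mathbb{R}^n\to\mathbb{R}$ with $u|_\Omega\in L^p(\Omega)$, $u=0$ a.e. in $\mathbb{R}^n\setminus\Omega$ and $\|u\|:=\left(\int_Q\frac{|u(x)-u(y)|^p}{|x-y|^{n+sp}}\,dx\,dy\right)^{1/p}<\infty$; $\|\cdot\|$ is the norm on $X_0$. $(P_\lambda)$ is the problem $(-\Delta_p)^su=\lambda u^{-q}+u^\alpha$, $u>0$ in $\Omega$, $u=0$ in $\mathbb{R}^n\setminus\Omega$. A positive weak solution of $(P_\lambda)$ is $u\in X_0$ with $u>0$ in $\Omega$ and, for all $\psi\in C_c^\infty(\Omega)$, $$\int_Q\frac{|u(x)-u(y)|^{p-2}(u(x)-u(y))(\psi(x)-\psi(y))}{|x-y|^{n+sp}}\,dx\,dy-\int_\Omega(\lambda u^{-q}+u^\alpha)\psi\,dx=0.$$ *)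

theory Defs
  imports "HOL-Analysis.Analysis"
begin

definition crit_exp :: "real \<Rightarrow> real \<Rightarrow> real \<Rightarrow> real" where
  "crit_exp n s p = n * p / (n - s * p)"

text \<open>\<open>Ck k f\<close>: all partial derivatives of \<open>f\<close> up to order \<open>k\<close> exist and are continuous on the
  whole space. Differentiability in the successor case is total differentiability; this gives the
  usual class since a function with continuous first partial derivatives is totally differentiable.\<close>

primrec Ck :: "nat \<Rightarrow> (real^'n \<Rightarrow> real) \<Rightarrow> bool" where
  "Ck 0 f \<longleftrightarrow> continuous_on UNIV f"
| "Ck (Suc k) f \<longleftrightarrow> f differentiable_on UNIV \<and>
     (\<forall>i. Ck k (\<lambda>x. frechet_derivative f (at x) (axis i 1)))"

definition smooth_fun :: "(real^'n \<Rightarrow> real) \<Rightarrow> bool" where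
  "smooth_fun f \<longleftrightarrow> (\<forall>k. Ck k f)"

definition test_fun :: "(real^'n) set \<Rightarrow> (real^'n \<Rightarrow> real) \<Rightarrow> bool" where
  "test_fun \<Omega> \<psi> \<longleftrightarrow> smooth_fun \<psi> \<and> compact (closure {x. \<psi> x \<noteq> 0}) \<and> closure {x. \<psi> x \<noteq> 0} \<subseteq> \<Omega>"

text \<open>The boundary is locally the graph of a smooth function, with \<open>\<Omega>\<close> on one side of it, in suitably
  rotated coordinates. The unit vector \<open>e\<close> is the direction of the last rotated coordinate; a function
  of the other \<open>n - 1\<close> coordinates is a function \<open>\<gamma>\<close> on the whole space that is constant along \<open>e\<close>.\<close>

definition smooth_boundary :: "(real^'n) set \<Rightarrow> bool" where
  "smooth_boundary \<Omega> \<longleftrightarrow>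
     (\<forall>x0\<in>frontier \<Omega>. \<exists>r>0. \<exists>e \<gamma>. norm e = 1 \<and> smooth_fun \<gamma> \<and>
        (\<forall>x t. \<gamma> (x + t *\<^sub>R e) = \<gamma> x) \<and>
        \<Omega> \<inter> ball x0 r = {x \<in> ball x0 r. x \<bullet> e > \<gamma> x})"

definition bounded_smooth_domain :: "(real^'n) set \<Rightarrow> bool" where
  "bounded_smooth_domain \<Omega> \<longleftrightarrow>
     open \<Omega> \<and> connected \<Omega> \<and> \<Omega> \<noteq> {} \<and> bounded \<Omega> \<and> smooth_boundary \<Omega>"

definition Qset :: "(real^'n) set \<Rightarrow> ((real^'n) \<times> (real^'n)) set" where
  "Qset \<Omega> = UNIV - (UNIV - \<Omega>) \<times> (UNIV - \<Omega>)"

text \<open>The \<open>p\<close>-th power of the norm of \<open>X0\<close>, with values in \<open>[0, \<infinity>]\<close>.\<close>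

definition X0_energy :: "(real^'n) set \<Rightarrow> real \<Rightarrow> real \<Rightarrow> (real^'n \<Rightarrow> real) \<Rightarrow> ennreal" where
  "X0_energy \<Omega> p s u =
     (\<integral>\<^sup>+z\<in>Qset \<Omega>. (case z of (x, y) \<Rightarrow>
        ennreal (\<bar>u x - u y\<bar> powr p / norm (x - y) powr (real CARD('n) + s * p)))
        \<partial>lebesgue)"

definition X0 :: "(real^'n) set \<Rightarrow> real \<Rightarrow> real \<Rightarrow> (real^'n \<Rightarrow> real) set" where
  "X0 \<Omega> p s = {u. u \<in> borel_measurable lebesgue \<and>
     set_integrable lebesgue \<Omega> (\<lambda>x. \<bar>u x\<bar> powr p) \<and>
     (AE x in lebesgue. x \<notin> \<Omega> \<longrightarrow> u x = 0) \<and>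
     X0_energy \<Omega> p s u < \<infinity>}"

text \<open>Left-hand side of the weak formulation. At \<open>u x = u y\<close> the factor \<open>u x - u y\<close> vanishes, so the
  convention \<open>0 powr a = 0\<close> is harmless for \<open>p \<le> 2\<close>. The integrand is integrable by
  Hoelder's inequality for \<open>u\<close> in \<open>X0\<close> and a test function \<open>\<psi>\<close>.\<close>

definition frac_plap_form ::
    "(real^'n) set \<Rightarrow> real \<Rightarrow> real \<Rightarrow> (real^'n \<Rightarrow> real) \<Rightarrow> (real^'n \<Rightarrow> real) \<Rightarrow> real" where
  "frac_plap_form \<Omega> p s u \<psi> =
     (LINT z:Qset \<Omega>|lebesgue. case z of (x, y) \<Rightarrow>
        \<bar>u x - u y\<bar> powr (p - 2) * (u x - u y) * (\<psi> x - \<psi> y)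
          / norm (x - y) powr (real CARD('n) + s * p))"

text \<open>Integrability of the possibly singular right-hand side against test functions is part of the
  weak formulation; it is stated explicitly because the Bochner integral of a non-integrable
  function is \<open>0\<close> here.\<close>

definition positive_weak_solution ::
    "(real^'n) set \<Rightarrow> real \<Rightarrow> real \<Rightarrow> real \<Rightarrow> real \<Rightarrow> real \<Rightarrow> (real^'n \<Rightarrow> real) \<Rightarrow> bool" where
  "positive_weak_solution \<Omega> p s lam q \<alpha> u \<longleftrightarrow>
     u \<in> X0 \<Omega> p s \<and>
     (AE x in lebesgue. x \<in> \<Omega> \<longrightarrow> u x > 0) \<and>
     (\<forall>\<psi>. test_fun \<Omega> \<psi> \<longrightarrow>
        set_integrable lebesgue \<Omega> (\<lambda>x. (lam * u x powr (- q) + u x powr \<alpha>) * \<psi> x) \<and>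
        frac_plap_form \<Omega> p s u \<psi>
          - (LINT x:\<Omega>|lebesgue. (lam * u x powr (- q) + u x powr \<alpha>) * \<psi> x) = 0)"

definition Linfty :: "(real^'n) set \<Rightarrow> (real^'n \<Rightarrow> real) set" where
  "Linfty \<Omega> = {u. u \<in> borel_measurable (lebesgue_on \<Omega>) \<and>
     (\<exists>C. AE x in lebesgue_on \<Omega>. \<bar>u x\<bar> \<le> C)}"

end

theory Submission
  imports Defs
begin

text \<open>
  On \<open>{u \<ge> 1}\<close> the right-hand side is at most \<open>(\<lambda> + 1) u\<^bsup>p* - 1\<^esup>\<close>, so testing the equation with
  truncations of \<open>(u - k)\<^sub>+\<close>, \<open>k \<ge> 1\<close>, and the fractional Sobolev inequality give
  \<open>\<parallel>(u - k)\<^sub>+\<parallel>\<^bsup>p\<^esup> \<le> C \<integral> u\<^bsup>p* - 1\<^esup> (u - k)\<^sub>+\<close> for the norm of \<open>L\<^bsup>p*\<^esup>\<close>. Along the levels \<open>M (2 - 2\<^sup>-\<^sup>j)\<close>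
  this is a superlinear recursion for \<open>\<integral> (u - k)\<^sub>+\<^bsup>p*\<^esup>\<close>, whose initial value is small for large \<open>M\<close>
  because \<open>u \<in> L\<^bsup>p*\<^esup>\<close>; hence \<open>u \<le> 2 M\<close>.

  The equation is only given for test functions in \<open>C\<^sub>c\<^sup>\<infinity>\<close>. It extends to bounded functions with compact
  support in \<open>\<Omega>\<close> and finite seminorm by mollification. A truncation \<open>w\<close> of \<open>(u - k)\<^sub>+\<close> is reached by
  cutting it into pieces near the boundary, translating each piece into \<open>\<Omega>\<close> along the graph
  direction, and taking the minimum of their sum with \<open>w\<close>. These approximations converge only a.e.
  and with bounded seminorm, but they stay below \<open>w\<close>; the form is lower semicontinuous along
  such sequences, which yields the one-sided inequality that is needed. The singular term is
  harmless since \<open>w\<close> vanishes on \<open>{u \<le> 1}\<close>.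
\<close>

section \<open>Smooth mollifiers\<close>

text \<open>At the critical power the equation alone gives no gain of integrability: the smallness
  that starts the iteration is the tail of one finite integral, so the bound obtained depends on
  \<open>u\<close> itself and comes without a rate. The obstacle is the boundary. Truncations of
  \<open>u\<close> need not have compact support in \<open>\<Omega>\<close>, and the right-hand side
  is known to be integrable only against test functions, possibly not up to the boundary. Cutting
  off at distance \<open>d\<close> from the boundary may cost negative powers of \<open>d\<close> in
  the seminorm, whereas a translation preserves it exactly; this is how the graph direction enters.
  A translated piece could however meet the right-hand side where nothing controls it, and the
  minimum with \<open>w\<close> prevents that. Only an upper bound for the form at \<open>w\<close>
  is wanted, never the equation tested with \<open>w\<close>, so Fatou's lemma can replace strong
  convergence. The kernel exponent is \<open>b = n + s * p\<close>; approximation rests on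
  \<open>n < b < n + p\<close>, the left inequality for the convergence of shifts and
  mollifications, the right one for Lipschitz cutoffs.\<close>

definition flat_exp :: "nat \<Rightarrow> real \<Rightarrow> real" where
  "flat_exp k t = (if t > 0 then exp (- 1 / t) / t ^ k else 0)"

lemma flat_exp_tendsto_0: "(flat_exp k \<longlongrightarrow> 0) (at 0)"
proof -
  have "((\<lambda>t::real. inverse t ^ k / exp (inverse t)) \<longlongrightarrow> 0) (at_right 0)"
    by (rule filterlim_compose[OF tendsto_power_div_exp_0 filterlim_inverse_at_top_right])
  moreover have "eventually (\<lambda>t::real. inverse t ^ k / exp (inverse t) = flat_exp k t) (at_right 0)"
    by (simp add: eventually_at_filter flat_exp_def exp_minus field_simps)
  ultimately have "(flat_exp k \<longlongrightarrow> 0) (at_right 0)"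
    by (rule Lim_transform_eventually)
  moreover have "(flat_exp k \<longlongrightarrow> 0) (at_left 0)"
    by (rule tendsto_eventually) (simp add: eventually_at_filter flat_exp_def)
  ultimately show ?thesis
    by (simp add: filterlim_split_at)
qed

text \<open>Differentiating \<open>exp (- 1 / t) / t ^ k\<close> only raises \<open>k\<close>, so
  the family indexed by \<open>k\<close> is closed under differentiation up to linear combinations.
  At 0 the difference quotient is \<open>flat_exp (k + 1)\<close>, which tends to 0.\<close>

lemma flat_exp_has_derivative:
  "(flat_exp k has_real_derivative flat_exp (k + 2) t - real k * flat_exp (k + 1) t) (at t)"
proof (cases t "0 :: real" rule: linorder_cases)
  case less
  have "((\<lambda>_. 0) has_real_derivative 0) (at t)" by simp
  then have "(flat_exp k has_real_derivative 0) (at t)"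
    by (rule has_field_derivative_transform_within_open[where S = "{..<0}"])
       (use less in \<open>auto simp: flat_exp_def\<close>)
  then show ?thesis using less by (simp add: flat_exp_def)
next
  case equal
  have "((\<lambda>h. (flat_exp k (0 + h) - flat_exp k 0) / h) \<longlongrightarrow> 0) (at 0)"
    using flat_exp_tendsto_0[of "k + 1"]
    by (rule Lim_transform_eventually) (simp add: eventually_at_filter flat_exp_def)
  then show ?thesis using equal by (simp add: DERIV_def flat_exp_def)
next
  case greater
  have "((\<lambda>t. exp (- 1 / t) / t ^ k) has_real_derivative
      (exp (- 1 / t) / t ^ (k + 2) - real k * (exp (- 1 / t) / t ^ (k + 1)))) (at t)"
    using greater
    by (auto intro!: derivative_eq_intros simp: field_simps power2_eq_square)
       (cases k; simp add: algebra_simps power2_eq_square)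
  then have "(flat_exp k has_real_derivative
      (exp (- 1 / t) / t ^ (k + 2) - real k * (exp (- 1 / t) / t ^ (k + 1)))) (at t)"
    by (rule has_field_derivative_transform_within_open[where S = "{0<..}"])
       (use greater in \<open>auto simp: flat_exp_def\<close>)
  then show ?thesis using greater by (simp add: flat_exp_def)
qed

text \<open>An algebra that contains the bump and is stable under partial derivatives: membership
  yields \<open>Ck k\<close> for every \<open>k\<close> by a single induction, without a formula for
  higher derivatives. The parameter \<open>d\<close> is the squared radius of the bump.\<close>

inductive_set bump_algebra :: "real \<Rightarrow> (real^'n::finite \<Rightarrow> real) set" for d where
  const: "(\<lambda>x. c) \<in> bump_algebra d"
| coord: "(\<lambda>x. x $ i) \<in> bump_algebra d"
| flat: "(\<lambda>x. flat_exp k (d - x \<bullet> x)) \<in> bump_algebra d"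
| add: "f \<in> bump_algebra d \<Longrightarrow> g \<in> bump_algebra d \<Longrightarrow> (\<lambda>x. f x + g x) \<in> bump_algebra d"
| mult: "f \<in> bump_algebra d \<Longrightarrow> g \<in> bump_algebra d \<Longrightarrow> (\<lambda>x. f x * g x) \<in> bump_algebra d"

lemma bump_algebra_derivative:
  fixes f :: "real^'n \<Rightarrow> real"
  assumes "f \<in> bump_algebra d"
  shows "\<exists>D. (\<forall>x. (f has_derivative D x) (at x)) \<and> (\<forall>i. (\<lambda>x. D x (axis i 1)) \<in> bump_algebra d)"
  using assms
proof induction
  case (const c)
  show ?case
    by (rule exI[of _ "\<lambda>x h. 0"]) (auto intro: bump_algebra.const)
next
  case (coord i)
  show ?case
  proof (intro exI[of _ "\<lambda>x h. h $ i"] conjI allI)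
    show "(\<lambda>x. axis j 1 $ i) \<in> bump_algebra d" for j
      by (rule bump_algebra.const)
  qed (auto intro!: bounded_linear_imp_has_derivative bounded_linear_vec_nth)
next
  case (flat k)
  define D where "D x h = (flat_exp (k + 2) (d - x \<bullet> x) + (- real k) * flat_exp (k + 1) (d - x \<bullet> x))
    * (- 2 * (x \<bullet> h))" for x h :: "real^'n"
  have "((\<lambda>x. flat_exp k (d - x \<bullet> x)) has_derivative D x) (at x)" for x
    unfolding D_def
    by (rule has_derivative_eq_rhs[OF has_derivative_compose[OF _ flat_exp_has_derivative[unfolded has_field_derivative_def]]])
       (auto intro!: derivative_eq_intros simp: fun_eq_iff inner_commute algebra_simps)
  moreover have "(\<lambda>x. D x (axis i 1)) \<in> bump_algebra d" for i
  proof -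
    have "(\<lambda>x. D x (axis i 1)) = (\<lambda>x. (flat_exp (k + 2) (d - x \<bullet> x) + (- real k) * flat_exp (k + 1) (d - x \<bullet> x))
        * (- 2 * (x $ i)))"
      by (simp add: D_def inner_axis)
    then show ?thesis by (simp only:) (intro bump_algebra.intros)
  qed
  ultimately show ?case by blast
next
  case (add f g)
  then obtain D E where D: "\<And>x. (f has_derivative D x) (at x)" "\<And>i. (\<lambda>x. D x (axis i 1)) \<in> bump_algebra d"
    and E: "\<And>x. (g has_derivative E x) (at x)" "\<And>i. (\<lambda>x. E x (axis i 1)) \<in> bump_algebra d"
    by blast
  show ?case
    by (rule exI[of _ "\<lambda>x h. D x h + E x h"])
       (auto intro!: has_derivative_add D E bump_algebra.add)
next
  case (mult f g)
  then obtain D E where D: "\<And>x. (f has_derivative D x) (at x)" "\<And>i. (\<lambda>x. D x (axis i 1)) \<in> bump_algebra d"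
    and E: "\<And>x. (g has_derivative E x) (at x)" "\<And>i. (\<lambda>x. E x (axis i 1)) \<in> bump_algebra d"
    by blast
  show ?case
    by (rule exI[of _ "\<lambda>x h. f x * E x h + D x h * g x"])
       (auto intro!: has_derivative_mult D E bump_algebra.add bump_algebra.mult mult.hyps)
qed

lemma frechet_derivative_eqI: "(f has_derivative D) (at x) \<Longrightarrow> frechet_derivative f (at x) = D"
  using frechet_derivative_at by metis

lemma smooth_fun_bump_algebra:
  fixes f :: "real^'n \<Rightarrow> real"
  assumes "f \<in> bump_algebra d"
  shows "smooth_fun f"
proof -
  have "\<forall>f::real^'n \<Rightarrow> real\<in>bump_algebra d. Ck k f" for k
  proof (induction k)
    case 0
    show ?case
      using bump_algebra_derivative
      by (metis Ck.simps(1) continuous_at_imp_continuous_on has_derivative_continuous)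
  next
    case (Suc k)
    show ?case
    proof
      fix f :: "real^'n \<Rightarrow> real"
      assume "f \<in> bump_algebra d"
      then obtain D where D: "\<And>x. (f has_derivative D x) (at x)"
          "\<And>i. (\<lambda>x. D x (axis i 1)) \<in> bump_algebra d"
        using bump_algebra_derivative by blast
      then show "Ck (Suc k) f"
        using Suc.IH by (auto simp: frechet_derivative_eqI[OF D(1)] differentiable_on_def differentiable_def)
    qed
  qed
  with assms show ?thesis by (simp add: smooth_fun_def)
qed

lemma smooth_fun_partial:
  "smooth_fun f \<Longrightarrow> smooth_fun (\<lambda>x. frechet_derivative f (at x) (axis i 1))"
  unfolding smooth_fun_def using Ck.simps(2) by metis

lemma smooth_fun_has_derivative:
  assumes "smooth_fun f"
  shows "(f has_derivative frechet_derivative f (at x)) (at x)"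
proof -
  have "Ck (Suc 0) f" using assms by (simp only: smooth_fun_def)
  then have "f differentiable at x"
    by (simp add: differentiable_on_def)
  then show ?thesis using frechet_derivative_works by blast
qed

lemma smooth_fun_continuous: "smooth_fun f \<Longrightarrow> continuous_on UNIV f"
  unfolding smooth_fun_def using Ck.simps(1) by metis

lemma lborel_ball_pos: "0 < d \<Longrightarrow> \<not> (AE y in lborel. y \<notin> ball (x :: 'a::euclidean_space) d)"
proof
  assume d: "0 < d" and "AE y in lborel. y \<notin> ball x d"
  then have "ball x d \<in> null_sets lborel"
    using AE_iff_null_sets[of "ball x d" lborel] by simp
  then have "emeasure lborel (ball x d) = 0" by auto
  then show False using d mult_pos_pos[OF unit_ball_vol_pos[of "DIM('a)"] zero_less_power[OF d, of "DIM('a)"]]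
    by (simp add: emeasure_ball less_imp_le ennreal_eq_0_iff del: mult_pos_pos)
qed

lemma mollifier_exists:
  assumes "0 < d"
  obtains \<rho> :: "real^'n \<Rightarrow> real" where "smooth_fun \<rho>" "\<And>x. 0 \<le> \<rho> x" "\<And>x. d < norm x \<Longrightarrow> \<rho> x = 0"
    "integrable lborel \<rho>" "integral\<^sup>L lborel \<rho> = 1"
proof -
  define f :: "real^'n \<Rightarrow> real" where "f x = flat_exp 0 (d\<^sup>2 - x \<bullet> x)" for x
  have f_alg: "f \<in> bump_algebra (d\<^sup>2)"
    unfolding f_def by (rule bump_algebra.flat)
  have f_cont: "continuous_on UNIV f"
    using f_alg smooth_fun_bump_algebra smooth_fun_continuous by blast
  have f_nonneg: "0 \<le> f x" for x by (simp add: f_def flat_exp_def)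
  have f_supp: "f x = 0" if "d < norm x" for x
  proof -
    have "d\<^sup>2 < x \<bullet> x" using that assms by (simp add: dot_square_norm power_strict_mono)
    then show ?thesis by (simp add: f_def flat_exp_def)
  qed
  have f_pos: "0 < f x" if "norm x < d" for x
  proof -
    have "x \<bullet> x < d\<^sup>2" using that assms by (simp add: dot_square_norm power_strict_mono)
    then show ?thesis by (simp add: f_def flat_exp_def)
  qed
  have "set_integrable lborel (cball 0 d) f"
    unfolding set_integrable_def by (rule borel_integrable_compact) (auto intro: continuous_on_subset[OF f_cont])
  moreover have "(\<lambda>x. indicator (cball 0 d) x *\<^sub>R f x) = f"
    using f_supp by (force simp: indicator_def)
  ultimately have f_int: "integrable lborel f"
    by (simp only: set_integrable_def)
  have "integral\<^sup>L lborel f \<noteq> 0"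
  proof
    assume "integral\<^sup>L lborel f = 0"
    then have "AE x in lborel. f x = 0"
      using integral_nonneg_eq_0_iff_AE[OF f_int] f_nonneg by simp
    then have "AE x in lborel. x \<notin> ball (0::real^'n) d"
      by eventually_elim (metis f_pos less_irrefl mem_ball_0)
    then show False using lborel_ball_pos assms by blast
  qed
  moreover have "0 \<le> integral\<^sup>L lborel f" using f_nonneg by simp
  ultimately have I: "0 < integral\<^sup>L lborel f" by simp
  show ?thesis
  proof
    show "smooth_fun (\<lambda>x. inverse (integral\<^sup>L lborel f) * f x)"
      by (rule smooth_fun_bump_algebra[of _ "d\<^sup>2"]) (intro bump_algebra.mult bump_algebra.const f_alg)
  qed (use I f_int f_nonneg f_supp in auto)
qed

section \<open>Convolution with a smooth kernel\<close>

definition conv :: "('a::euclidean_space \<Rightarrow> real) \<Rightarrow> ('a \<Rightarrow> real) \<Rightarrow> 'a \<Rightarrow> real" where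
  "conv g f x = (\<integral>z. g (x - z) * f z \<partial>lborel)"

lemma continuous_bounded_support_bounded:
  fixes g :: "'a::euclidean_space \<Rightarrow> real"
  assumes "continuous_on UNIV g" "\<And>x. r < norm x \<Longrightarrow> g x = 0"
  obtains B where "0 \<le> B" "\<And>x. \<bar>g x\<bar> \<le> B"
proof -
  have "compact (g ` cball 0 r)"
    by (intro compact_continuous_image continuous_on_subset[OF assms(1)]) auto
  then obtain B where B: "\<And>x. x \<in> cball 0 r \<Longrightarrow> \<bar>g x\<bar> \<le> B"
    using compact_imp_bounded[of "g ` cball 0 r"] by (fastforce simp: bounded_iff)
  show ?thesis
  proof
    show "\<bar>g x\<bar> \<le> max B 0" for x
      using B[of x] assms(2)[of x] by (cases "norm x \<le> r") auto
  qed auto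
qed

lemma partial_zero_outside:
  fixes g :: "real^'n \<Rightarrow> real"
  assumes "\<And>x. r < norm x \<Longrightarrow> g x = 0" "r < norm y"
  shows "frechet_derivative g (at y) h = 0"
proof -
  have "open {y::real^'n. r < norm y}"
    by (intro open_Collect_less continuous_intros)
  then have "(g has_derivative (\<lambda>h. 0)) (at y)"
    using has_derivative_transform_within_open[OF has_derivative_const[of 0 "at y"], of "{y. r < norm y}" g]
      assms by auto
  then show ?thesis by (simp add: frechet_derivative_eqI)
qed

text \<open>The variable of \<open>conv g f\<close> sits in \<open>g\<close>, so the derivative
  falls on the smooth factor. Dominated convergence applies to the difference quotients because a
  smooth \<open>g\<close> with bounded support has bounded gradient and is therefore globally
  Lipschitz.\<close>

lemma conv_has_derivative:
  fixes g f :: "real^'n \<Rightarrow> real"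
  assumes g: "smooth_fun g" "\<And>x. r < norm x \<Longrightarrow> g x = 0" and f: "integrable lborel f"
  shows "(conv g f has_derivative
    (\<lambda>h. \<Sum>i\<in>UNIV. h $ i * conv (\<lambda>y. frechet_derivative g (at y) (axis i 1)) f x)) (at x)"
proof -
  define G where "G i y = frechet_derivative g (at y) (axis i 1)" for i y
  have G_cont: "continuous_on UNIV (G i)" for i
    using smooth_fun_continuous[OF smooth_fun_partial[OF g(1)]] unfolding G_def .
  have g_cont: "continuous_on UNIV g" using smooth_fun_continuous[OF g(1)] .
  have [measurable]: "g \<in> borel_measurable borel" "G i \<in> borel_measurable borel"
    "f \<in> borel_measurable borel" for i
    using g_cont G_cont f by (auto intro: borel_measurable_continuous_onI)
  have der: "(g has_derivative (\<lambda>h. \<Sum>i\<in>UNIV. h $ i * G i y)) (at y)" for y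
  proof -
    have D: "(g has_derivative frechet_derivative g (at y)) (at y)"
      by (rule smooth_fun_has_derivative[OF g(1)])
    have "frechet_derivative g (at y) h = (\<Sum>i\<in>UNIV. h $ i * G i y)" for h
    proof -
      interpret linear "frechet_derivative g (at y)"
        using D by (rule has_derivative_linear)
      have "frechet_derivative g (at y) (\<Sum>i\<in>UNIV. h $ i *s axis i 1) = (\<Sum>i\<in>UNIV. h $ i * G i y)"
        by (simp add: sum scale G_def scalar_mult_eq_scaleR)
      then show ?thesis by (simp add: basis_expansion)
    qed
    then have "frechet_derivative g (at y) = (\<lambda>h. \<Sum>i\<in>UNIV. h $ i * G i y)" by (rule ext)
    with D show ?thesis by simp
  qed
  have G_supp: "G i y = 0" if "r < norm y" for i y
    unfolding G_def using g(2) that by (rule partial_zero_outside)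
  have "\<exists>B. 0 \<le> B \<and> (\<forall>y. \<bar>G i y\<bar> \<le> B)" for i
    using continuous_bounded_support_bounded[OF G_cont G_supp] by metis
  then obtain B where B: "\<And>i. 0 \<le> B i" "\<And>i y. \<bar>G i y\<bar> \<le> B i" by metis
  define L where "L = (\<Sum>i\<in>UNIV. B i)"
  have L: "0 \<le> L" unfolding L_def by (intro sum_nonneg B)
  have L_bound: "\<bar>\<Sum>i\<in>UNIV. h $ i * G i y\<bar> \<le> L * norm h" for h y
  proof -
    have "\<bar>\<Sum>i\<in>UNIV. h $ i * G i y\<bar> \<le> (\<Sum>i\<in>UNIV. \<bar>h $ i\<bar> * \<bar>G i y\<bar>)"
      using sum_abs[of "\<lambda>i. h $ i * G i y" UNIV] by (simp add: abs_mult)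
    also have "\<dots> \<le> (\<Sum>i\<in>UNIV. norm h * B i)"
      by (intro sum_mono mult_mono component_le_norm_cart B) auto
    finally show ?thesis by (simp add: L_def sum_distrib_left mult.commute)
  qed
  have lip: "\<bar>g y - g z\<bar> \<le> L * norm (y - z)" for y z
  proof -
    have "norm (g y - g z) \<le> L * norm (y - z)"
    proof (rule differentiable_bound[of UNIV g "\<lambda>y h. \<Sum>i\<in>UNIV. h $ i * G i y"])
      show "onorm (\<lambda>h. \<Sum>i\<in>UNIV. h $ i * G i y) \<le> L" for y
        using L_bound by (intro onorm_le) (auto simp: mult.commute)
    qed (use der in \<open>auto intro: has_derivative_at_withinI\<close>)
    then show ?thesis by simp
  qed
  obtain Bg where Bg: "0 \<le> Bg" "\<And>y. \<bar>g y\<bar> \<le> Bg"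
    using continuous_bounded_support_bounded[OF g_cont g(2)] by metis
  have int_bdd: "integrable lborel (\<lambda>z. k (y - z) * f z)"
    if "k \<in> borel_measurable borel" "\<And>z. \<bar>k z\<bar> \<le> C" for k C and y :: "real^'n"
  proof (rule Bochner_Integration.integrable_bound)
    show "integrable lborel (\<lambda>z. C * f z)" using f by simp
    show "(\<lambda>z. k (y - z) * f z) \<in> borel_measurable lborel"
      using that(1) by measurable
    show "AE z in lborel. norm (k (y - z) * f z) \<le> norm (C * f z)"
      using that(2) by (intro AE_I2) (auto simp: abs_mult intro!: mult_right_mono order_trans[OF that(2) abs_ge_self])
  qed
  have int_g: "integrable lborel (\<lambda>z. g (y - z) * f z)" for y
    by (rule int_bdd[OF _ Bg(2)]) simp
  have int_G: "integrable lborel (\<lambda>z. G i (y - z) * f z)" for i y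
    by (rule int_bdd[OF _ B(2)]) simp
  have bl: "bounded_linear (\<lambda>h. \<Sum>i\<in>UNIV. h $ i * conv (G i) f x)"
    by (intro bounded_linear_sum bounded_linear_mult_const bounded_linear_vec_nth)
  show ?thesis
    unfolding G_def[symmetric] has_derivative_at_alt
  proof (intro conjI bl)
    \<comment> \<open>First-order Taylor remainder of \<open>g\<close> at \<open>x - z\<close>,
      divided by the length of the increment: it tends to 0 pointwise and is at most
      \<open>2 * L\<close>, one \<open>L\<close> for the increment of \<open>g\<close> and one for
      the linear term.\<close>
    define q where "q y z = (g (y - z) - g (x - z) - (\<Sum>i\<in>UNIV. (y - x) $ i * G i (x - z))) / norm (y - x)"
      for y z
    have q_bound: "\<bar>q y z\<bar> \<le> 2 * L" for y z
    proof (cases "y = x")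
      case False
      have "\<bar>g (y - z) - g (x - z) - (\<Sum>i\<in>UNIV. (y - x) $ i * G i (x - z))\<bar> \<le> 2 * L * norm (y - x)"
        using lip[of "y - z" "x - z"] L_bound[of "y - x" "x - z"] by simp
      then show ?thesis using False by (simp add: q_def field_simps)
    qed (use L in \<open>simp add: q_def\<close>)
    have q_lim: "((\<lambda>y. q y z) \<longlongrightarrow> 0) (at x)" for z
    proof -
      have "((\<lambda>y. y - z) has_derivative (\<lambda>h. h)) (at x)"
        by (auto intro!: derivative_eq_intros)
      from has_derivative_compose[OF this der]
      have "((\<lambda>y. g (y - z)) has_derivative (\<lambda>h. \<Sum>i\<in>UNIV. h $ i * G i (x - z))) (at x)" .
      then have "((\<lambda>y. norm (g (y - z) - g (x - z) - (\<Sum>i\<in>UNIV. (y - x) $ i * G i (x - z))) / norm (y - x))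
          \<longlongrightarrow> 0) (at x)"
        unfolding has_derivative_iff_norm by simp
      then have "((\<lambda>y. norm (q y z)) \<longlongrightarrow> 0) (at x)" by (simp add: q_def abs_divide)
      then show ?thesis by (rule tendsto_norm_zero_cancel)
    qed
    have q_meas[measurable]: "q y \<in> borel_measurable borel" for y
      unfolding q_def by measurable
    have "((\<lambda>y. \<integral>z. q y z * f z \<partial>lborel) \<longlongrightarrow> (\<integral>z. 0 * f z \<partial>lborel)) (at x)"
      unfolding tendsto_at_iff_sequentially comp_def
    proof (intro allI impI)
      fix X assume X: "\<forall>i. X i \<in> UNIV - {x}" "X \<longlonglongrightarrow> x"
      show "(\<lambda>n. \<integral>z. q (X n) z * f z \<partial>lborel) \<longlonglongrightarrow> (\<integral>z. 0 * f z \<partial>lborel)"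
      proof (rule integral_dominated_convergence[where w = "\<lambda>z. 2 * L * \<bar>f z\<bar>"])
        show "AE z in lborel. (\<lambda>n. q (X n) z * f z) \<longlonglongrightarrow> 0 * f z"
          using q_lim X unfolding tendsto_at_iff_sequentially comp_def
          by (intro AE_I2 tendsto_mult tendsto_const) auto
        show "AE z in lborel. norm (q (X n) z * f z) \<le> 2 * L * \<bar>f z\<bar>" for n
          using q_bound by (intro AE_I2) (auto simp: abs_mult intro!: mult_right_mono)
      qed (use f in auto)
    qed
    then have lim: "((\<lambda>y. \<integral>z. q y z * f z \<partial>lborel) \<longlongrightarrow> 0) (at x)" by simp
    have eq: "conv g f y - conv g f x - (\<Sum>i\<in>UNIV. (y - x) $ i * conv (G i) f x)
        = norm (y - x) * (\<integral>z. q y z * f z \<partial>lborel)" for y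
    proof (cases "y = x")
      case False
      have "norm (y - x) * (\<integral>z. q y z * f z \<partial>lborel) =
          (\<integral>z. g (y - z) * f z - g (x - z) * f z - (\<Sum>i\<in>UNIV. (y - x) $ i * (G i (x - z) * f z)) \<partial>lborel)"
        unfolding integral_mult_right_zero[symmetric]
        by (rule Bochner_Integration.integral_cong)
           (use False in \<open>auto simp: q_def field_simps sum_distrib_left sum_distrib_right\<close>)
      also have "\<dots> = conv g f y - conv g f x - (\<Sum>i\<in>UNIV. (y - x) $ i * conv (G i) f x)"
        unfolding conv_def
        by (simp add: int_g int_G)
      finally show ?thesis by simp
    qed simp
    show "\<forall>e>0. \<exists>d>0. \<forall>y. norm (y - x) < d \<longrightarrow>
        norm (conv g f y - conv g f x - (\<Sum>i\<in>UNIV. (y - x) $ i * conv (G i) f x)) \<le> e * norm (y - x)"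
    proof (intro allI impI)
      fix e :: real assume "0 < e"
      then obtain d where d: "0 < d" "\<And>y. y \<noteq> x \<Longrightarrow> dist y x < d \<Longrightarrow> \<bar>\<integral>z. q y z * f z \<partial>lborel\<bar> < e"
        using lim unfolding tendsto_iff eventually_at by auto
      have "\<bar>norm (y - x) * (\<integral>z. q y z * f z \<partial>lborel)\<bar> \<le> e * norm (y - x)" if "norm (y - x) < d" for y
        using d(2)[of y] that by (cases "y = x") (auto simp: abs_mult dist_norm mult.commute intro!: mult_right_mono less_imp_le)
      then show "\<exists>d>0. \<forall>y. norm (y - x) < d \<longrightarrow>
          norm (conv g f y - conv g f x - (\<Sum>i\<in>UNIV. (y - x) $ i * conv (G i) f x)) \<le> e * norm (y - x)"
        using d(1) unfolding eq by auto
    qed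
  qed
qed

lemma smooth_fun_conv:
  fixes g f :: "real^'n \<Rightarrow> real"
  assumes "smooth_fun g" "\<And>x. r < norm x \<Longrightarrow> g x = 0" "integrable lborel f"
  shows "smooth_fun (conv g f)"
proof -
  \<comment> \<open>The kernel varies in the induction, since the step passes to its partial
    derivatives, which vanish outside the same ball.\<close>
  have "Ck k (conv g f)" if "smooth_fun g" "\<And>x. r < norm x \<Longrightarrow> g x = 0" for k and g :: "real^'n \<Rightarrow> real"
    using that
  proof (induction k arbitrary: g)
    case 0
    then show ?case
      by (auto intro!: continuous_at_imp_continuous_on has_derivative_continuous
          conv_has_derivative[OF 0(1) 0(2) assms(3)])
  next
    case (Suc k)
    have D: "(conv g f has_derivative
        (\<lambda>h. \<Sum>i\<in>UNIV. h $ i * conv (\<lambda>y. frechet_derivative g (at y) (axis i 1)) f x)) (at x)" for x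
      using Suc.prems assms(3) by (rule conv_has_derivative)
    have "frechet_derivative (conv g f) (at x) (axis i 1) =
        conv (\<lambda>y. frechet_derivative g (at y) (axis i 1)) f x" for x i
      by (simp add: frechet_derivative_eqI[OF D] axis_def if_distrib[of "\<lambda>c. c * _"] cong: if_cong)
    moreover have "Ck k (conv (\<lambda>y. frechet_derivative g (at y) (axis i 1)) f)" for i
      by (intro Suc.IH smooth_fun_partial Suc.prems partial_zero_outside) auto
    ultimately show ?case
      by (auto simp: differentiable_on_def intro: differentiableI[OF D])
  qed
  with assms show ?thesis by (simp add: smooth_fun_def)
qed


section \<open>The Gagliardo seminorm\<close>

lemma fst_snd_borel_measurable[measurable]:
  "(fst :: 'a::euclidean_space \<times> 'b::euclidean_space \<Rightarrow> 'a) \<in> borel_measurable borel"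
  "(snd :: 'a::euclidean_space \<times> 'b::euclidean_space \<Rightarrow> 'b) \<in> borel_measurable borel"
  by (auto intro!: borel_measurable_continuous_onI continuous_intros)

lemma nn_integral_lborel_prod:
  fixes f :: "'a::euclidean_space \<times> 'b::euclidean_space \<Rightarrow> ennreal"
  assumes "f \<in> borel_measurable borel"
  shows "(\<integral>\<^sup>+z. f z \<partial>lborel) = (\<integral>\<^sup>+x. \<integral>\<^sup>+y. f (x, y) \<partial>lborel \<partial>lborel)"
    and "(\<integral>\<^sup>+z. f z \<partial>lborel) = (\<integral>\<^sup>+y. \<integral>\<^sup>+x. f (x, y) \<partial>lborel \<partial>lborel)"
    and "(\<lambda>x. \<integral>\<^sup>+y. f (x, y) \<partial>lborel) \<in> borel_measurable borel"
    and "(\<lambda>y. \<integral>\<^sup>+x. f (x, y) \<partial>lborel) \<in> borel_measurable borel"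
proof -
  have f: "f \<in> borel_measurable (lborel \<Otimes>\<^sub>M lborel)"
    using assms by (simp add: lborel_prod)
  show 1: "(\<integral>\<^sup>+z. f z \<partial>lborel) = (\<integral>\<^sup>+x. \<integral>\<^sup>+y. f (x, y) \<partial>lborel \<partial>lborel)"
    using lborel.nn_integral_fst[OF f] by (simp add: lborel_prod)
  show "(\<integral>\<^sup>+z. f z \<partial>lborel) = (\<integral>\<^sup>+y. \<integral>\<^sup>+x. f (x, y) \<partial>lborel \<partial>lborel)"
    using lborel_pair.Fubini[OF f] 1 by simp
  have "(\<lambda>x. \<integral>\<^sup>+y. f (x, y) \<partial>lborel) \<in> borel_measurable lborel"
    by (rule lborel.borel_measurable_nn_integral_fst[OF f])
  then show "(\<lambda>x. \<integral>\<^sup>+y. f (x, y) \<partial>lborel) \<in> borel_measurable borel" by simp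
  have "(\<lambda>z. f (snd z, fst z)) \<in> borel_measurable borel" using assms by measurable
  then have "(\<lambda>z. f (snd z, fst z)) \<in> borel_measurable (lborel \<Otimes>\<^sub>M lborel)"
    by (simp add: lborel_prod)
  from lborel.borel_measurable_nn_integral_fst[OF this]
  show "(\<lambda>y. \<integral>\<^sup>+x. f (x, y) \<partial>lborel) \<in> borel_measurable borel" by simp
qed

lemma nn_integral_lborel_shift:
  fixes f :: "'a::euclidean_space \<Rightarrow> ennreal"
  assumes [measurable]: "f \<in> borel_measurable borel"
  shows "(\<integral>\<^sup>+x. f (x + c) \<partial>lborel) = (\<integral>\<^sup>+x. f x \<partial>lborel)"
proof -
  have "(\<integral>\<^sup>+x. f x \<partial>distr lborel borel ((+) c)) = (\<integral>\<^sup>+x. f (c + x) \<partial>lborel)"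
    by (rule nn_integral_distr) auto
  then show ?thesis by (simp add: lborel_distr_plus add.commute)
qed

lemma distr_lborel_reflect: "distr lborel borel (\<lambda>z. x - z) = (lborel :: 'a::euclidean_space measure)"
  using lborel_affine[of "-1" x] by (simp add: density_1)

lemma conv_flip:
  assumes [measurable]: "g \<in> borel_measurable borel" "f \<in> borel_measurable borel"
  shows "conv g f x = (\<integral>z. g z * f (x - z) \<partial>lborel)"
proof -
  have "(\<integral>z. g z * f (x - z) \<partial>distr lborel borel (\<lambda>z. x - z)) = (\<integral>z. g (x - z) * f (x - (x - z)) \<partial>lborel)"
    by (rule integral_distr) auto
  then show ?thesis by (simp add: distr_lborel_reflect conv_def)
qed

lemma AE_lborel_prod:
  assumes "AE x in lborel. P (x :: 'a::euclidean_space)"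
  shows "AE z in (lborel :: ('a \<times> 'a) measure). P (fst z) \<and> P (snd z)"
proof -
  obtain N where N: "N \<in> null_sets lborel" "{x. \<not> P x} \<subseteq> N"
    using assms unfolding eventually_ae_filter by auto
  have "emeasure (lborel :: ('a \<times> 'a) measure) (N \<times> UNIV) = 0"
    "emeasure (lborel :: ('a \<times> 'a) measure) (UNIV \<times> N) = 0"
    unfolding lborel_prod[symmetric] using N(1)
    by (auto simp: lborel.emeasure_pair_measure_Times null_sets_def)
  moreover have "N \<times> UNIV \<in> sets (lborel \<Otimes>\<^sub>M lborel)" "UNIV \<times> N \<in> sets (lborel \<Otimes>\<^sub>M lborel)"
    using N by (auto intro!: pair_measureI)
  ultimately have "N \<times> UNIV \<in> null_sets (lborel :: ('a \<times> 'a) measure)"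
    "UNIV \<times> N \<in> null_sets (lborel :: ('a \<times> 'a) measure)"
    unfolding lborel_prod by (auto simp: null_sets_def)
  then have "N \<times> UNIV \<union> UNIV \<times> N \<in> null_sets (lborel :: ('a \<times> 'a) measure)" by blast
  then show ?thesis
    by (rule AE_I') (use N(2) in auto)
qed

text \<open>The \<open>p\<close>-th power of the Gagliardo seminorm of order \<open>s\<close> corresponds to \<open>b = DIM('a) + s * p\<close>.\<close>

definition gagliardo :: "real \<Rightarrow> real \<Rightarrow> ('a::euclidean_space \<Rightarrow> real) \<Rightarrow> ennreal" where
  "gagliardo p b v = (\<integral>\<^sup>+z. ennreal (\<bar>v (fst z) - v (snd z)\<bar> powr p / norm (fst z - snd z) powr b) \<partial>lborel)"

lemma gagliardo_mono:
  assumes "\<And>x y. \<bar>v x - v y\<bar> \<le> \<bar>u x - u y\<bar>" "0 \<le> p"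
  shows "gagliardo p b v \<le> gagliardo p b u"
  unfolding gagliardo_def
  by (intro nn_integral_mono ennreal_leI divide_right_mono powr_mono2 assms) auto

lemma gagliardo_shift:
  assumes [measurable]: "v \<in> borel_measurable borel"
  shows "gagliardo p b (\<lambda>x. v (x + c)) = gagliardo p b v"
proof -
  let ?F = "\<lambda>z. ennreal (\<bar>v (fst z) - v (snd z)\<bar> powr p / norm (fst z - snd z) powr b)"
  have "gagliardo p b (\<lambda>x. v (x + c)) = (\<integral>\<^sup>+z. ?F (z + (c, c)) \<partial>lborel)"
    by (simp add: gagliardo_def)
  also have "\<dots> = gagliardo p b v"
    unfolding gagliardo_def by (rule nn_integral_lborel_shift) measurable
  finally show ?thesis .
qed

lemma power_powr:
  fixes x t :: real
  assumes "0 < x"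
  shows "(x ^ k) powr t = (x powr t) ^ k"
proof -
  have "(x ^ k) powr t = (x powr real k) powr t" using assms by (subst powr_realpow) auto
  also have "\<dots> = (x powr t) ^ k"
    unfolding powr_powr using assms by (subst powr_power) (auto simp: mult.commute)
  finally show ?thesis .
qed

lemma powr_add_le:
  fixes x y p :: real
  assumes "0 \<le> x" "0 \<le> y" "0 \<le> p"
  shows "(x + y) powr p \<le> 2 powr p * (x powr p + y powr p)"
proof -
  have "(x + y) powr p \<le> (2 * max x y) powr p"
    using assms by (intro powr_mono2) auto
  also have "\<dots> = 2 powr p * max x y powr p" using assms by (simp add: powr_mult)
  also have "max x y powr p \<le> x powr p + y powr p" by (simp add: max_def)
  finally show ?thesis by (simp add: mult_left_mono)
qed

lemma gagliardo_add_le: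
  assumes [measurable]: "v \<in> borel_measurable borel" "w \<in> borel_measurable borel" and "0 \<le> p"
  shows "gagliardo p b (\<lambda>x. v x + w x) \<le> ennreal (2 powr p) * (gagliardo p b v + gagliardo p b w)"
proof -
  have "gagliardo p b (\<lambda>x. v x + w x) \<le> (\<integral>\<^sup>+z. ennreal (2 powr p) *
      (ennreal (\<bar>v (fst z) - v (snd z)\<bar> powr p / norm (fst z - snd z) powr b) +
       ennreal (\<bar>w (fst z) - w (snd z)\<bar> powr p / norm (fst z - snd z) powr b)) \<partial>lborel)"
    unfolding gagliardo_def
  proof (rule nn_integral_mono)
    fix z :: "'a \<times> 'a"
    have "\<bar>v (fst z) + w (fst z) - (v (snd z) + w (snd z))\<bar> powr p
        \<le> (\<bar>v (fst z) - v (snd z)\<bar> + \<bar>w (fst z) - w (snd z)\<bar>) powr p"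
      using \<open>0 \<le> p\<close> by (intro powr_mono2) auto
    also have "\<dots> \<le> 2 powr p * (\<bar>v (fst z) - v (snd z)\<bar> powr p + \<bar>w (fst z) - w (snd z)\<bar> powr p)"
      using \<open>0 \<le> p\<close> by (intro powr_add_le) auto
    finally have "\<bar>v (fst z) + w (fst z) - (v (snd z) + w (snd z))\<bar> powr p / norm (fst z - snd z) powr b
        \<le> 2 powr p * (\<bar>v (fst z) - v (snd z)\<bar> powr p / norm (fst z - snd z) powr b +
          \<bar>w (fst z) - w (snd z)\<bar> powr p / norm (fst z - snd z) powr b)"
      by (simp add: divide_right_mono add_divide_distrib[symmetric])
    then show "ennreal (\<bar>v (fst z) + w (fst z) - (v (snd z) + w (snd z))\<bar> powr p / norm (fst z - snd z) powr b)
        \<le> ennreal (2 powr p) * (ennreal (\<bar>v (fst z) - v (snd z)\<bar> powr p / norm (fst z - snd z) powr b) +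
       ennreal (\<bar>w (fst z) - w (snd z)\<bar> powr p / norm (fst z - snd z) powr b))"
      by (simp add: ennreal_mult'[symmetric] ennreal_plus[symmetric] ennreal_leI del: ennreal_plus)
  qed
  also have "\<dots> = ennreal (2 powr p) * (gagliardo p b v + gagliardo p b w)"
    unfolding gagliardo_def by (subst nn_integral_cmult, measurable) (subst nn_integral_add, auto)
  finally show ?thesis .
qed

text \<open>The increment of a minimum is at most the larger of the two increments, hence no
  constant appears.\<close>

lemma gagliardo_min_le:
  assumes [measurable]: "v \<in> borel_measurable borel" "w \<in> borel_measurable borel" and "0 \<le> p"
  shows "gagliardo p b (\<lambda>x. min (v x) (w x)) \<le> gagliardo p b v + gagliardo p b w"
proof -
  have "gagliardo p b (\<lambda>x. min (v x) (w x)) \<le> (\<integral>\<^sup>+z.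
      (ennreal (\<bar>v (fst z) - v (snd z)\<bar> powr p / norm (fst z - snd z) powr b) +
       ennreal (\<bar>w (fst z) - w (snd z)\<bar> powr p / norm (fst z - snd z) powr b)) \<partial>lborel)"
    unfolding gagliardo_def
  proof (rule nn_integral_mono)
    fix z :: "'a \<times> 'a"
    have "\<bar>min (v (fst z)) (w (fst z)) - min (v (snd z)) (w (snd z))\<bar> powr p
        \<le> (max \<bar>v (fst z) - v (snd z)\<bar> \<bar>w (fst z) - w (snd z)\<bar>) powr p"
      using \<open>0 \<le> p\<close> by (intro powr_mono2) auto
    also have "\<dots> \<le> \<bar>v (fst z) - v (snd z)\<bar> powr p + \<bar>w (fst z) - w (snd z)\<bar> powr p"
      by (simp add: max_def)
    finally show "ennreal (\<bar>min (v (fst z)) (w (fst z)) - min (v (snd z)) (w (snd z))\<bar> powr p / norm (fst z - snd z) powr b)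
        \<le> ennreal (\<bar>v (fst z) - v (snd z)\<bar> powr p / norm (fst z - snd z) powr b) +
       ennreal (\<bar>w (fst z) - w (snd z)\<bar> powr p / norm (fst z - snd z) powr b)"
      by (simp add: ennreal_plus[symmetric] ennreal_leI divide_right_mono add_divide_distrib[symmetric] del: ennreal_plus)
  qed
  also have "\<dots> = gagliardo p b v + gagliardo p b w"
    unfolding gagliardo_def by (subst nn_integral_add, auto)
  finally show ?thesis .
qed

lemma ennreal_mult_le_divide:
  assumes "0 < a" "0 \<le> c" "ennreal a * X \<le> ennreal c * Y"
  shows "X \<le> ennreal (c / a) * Y"
proof -
  have "X = ennreal (1 / a) * (ennreal a * X)"
    using assms by (simp add: mult.assoc[symmetric] ennreal_mult'[symmetric])
  also have "\<dots> \<le> ennreal (1 / a) * (ennreal c * Y)"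
    by (intro mult_left_mono assms) simp
  also have "\<dots> = ennreal (c / a) * Y"
    using assms by (simp add: mult.assoc[symmetric] ennreal_mult'[symmetric])
  finally show ?thesis .
qed

text \<open>Averages the triangle inequality through the points of a ball of radius \<open>norm h\<close>.\<close>

lemma nn_integral_shift_diff_le:
  fixes v :: "'a::euclidean_space \<Rightarrow> real"
  assumes [measurable]: "v \<in> borel_measurable borel" and p: "0 < p" and b: "0 \<le> b" and h: "h \<noteq> 0"
  shows "(\<integral>\<^sup>+x. ennreal (\<bar>v (x + h) - v x\<bar> powr p) \<partial>lborel)
    \<le> ennreal (2 powr (p + 1) * 2 powr b / unit_ball_vol (DIM('a)) * norm h powr (b - DIM('a))) * gagliardo p b v"
proof -
  define k where "k x y = ennreal (\<bar>v x - v y\<bar> powr p / norm (x - y) powr b)" for x y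
  have k_meas[measurable]: "(\<lambda>z. k (fst z) (snd z)) \<in> borel_measurable borel"
    unfolding k_def by measurable
  define D where "D x = (\<integral>\<^sup>+y. k x y \<partial>lborel)" for x
  have D_meas[measurable]: "D \<in> borel_measurable borel"
    using nn_integral_lborel_prod(3)[OF k_meas] by (simp add: D_def[abs_def])
  have gagliardo_D: "gagliardo p b v = (\<integral>\<^sup>+x. D x \<partial>lborel)"
    using nn_integral_lborel_prod(1)[OF k_meas] by (simp add: D_def gagliardo_def k_def)
  have k_meas1[measurable]: "k x \<in> borel_measurable borel" for x
    unfolding k_def by measurable
  define r where "r = norm h"
  have r: "0 < r" using h by (simp add: r_def)
  define K where "K = 2 powr p * (2 * r) powr b"
  have K: "0 \<le> K" by (simp add: K_def)
  have ker: "ennreal (\<bar>v x - v y\<bar> powr p) \<le> ennreal ((2 * r) powr b) * k x y" if "norm (x - y) \<le> 2 * r" for x y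
  proof (cases "x = y")
    case False
    then have "\<bar>v x - v y\<bar> powr p \<le> (2 * r) powr b * (\<bar>v x - v y\<bar> powr p / norm (x - y) powr b)"
      using mult_right_mono[OF powr_mono2[OF b norm_ge_zero that], of "\<bar>v x - v y\<bar> powr p"]
      by (simp add: field_simps)
    then show ?thesis unfolding k_def by (simp add: ennreal_mult'[symmetric] ennreal_leI)
  qed (use p in simp)
  \<comment> \<open>The ball has radius \<open>norm h\<close>, so each \<open>y\<close> in it lies
    within \<open>2 * r\<close> of both \<open>x\<close> and \<open>x + h\<close>, and
    \<open>ker\<close> applies to both halves of the triangle inequality.\<close>
  have point: "ennreal (\<bar>v (x + h) - v x\<bar> powr p) \<le> ennreal K * (k (x + h) y + k x y)"
    if "y \<in> ball x r" for x y
  proof -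
    have "\<bar>v (x + h) - v x\<bar> powr p \<le> (\<bar>v (x + h) - v y\<bar> + \<bar>v x - v y\<bar>) powr p"
      using p by (intro powr_mono2) auto
    also have "\<dots> \<le> 2 powr p * (\<bar>v (x + h) - v y\<bar> powr p + \<bar>v x - v y\<bar> powr p)"
      using p by (intro powr_add_le) auto
    finally have "ennreal (\<bar>v (x + h) - v x\<bar> powr p) \<le>
        ennreal (2 powr p) * (ennreal (\<bar>v (x + h) - v y\<bar> powr p) + ennreal (\<bar>v x - v y\<bar> powr p))"
      by (simp add: ennreal_mult'[symmetric] ennreal_plus[symmetric] ennreal_leI del: ennreal_plus)
    also have "\<dots> \<le> ennreal (2 powr p) * (ennreal ((2 * r) powr b) * k (x + h) y + ennreal ((2 * r) powr b) * k x y)"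
    proof (intro mult_left_mono add_mono ker)
      have xy: "norm (x - y) < r" using that by (simp add: dist_norm)
      show "norm (x - y) \<le> 2 * r" using xy r by simp
      have "norm (x + h - y) \<le> norm h + norm (x - y)"
        using norm_triangle_ineq[of h "x - y"] by (simp add: algebra_simps)
      then show "norm (x + h - y) \<le> 2 * r" using xy by (simp add: r_def)
    qed auto
    also have "\<dots> = ennreal K * (k (x + h) y + k x y)"
      by (simp add: K_def ennreal_mult' distrib_left mult.assoc)
    finally show ?thesis .
  qed
  have "ennreal (unit_ball_vol (DIM('a)) * r ^ DIM('a)) * ennreal (\<bar>v (x + h) - v x\<bar> powr p)
      \<le> ennreal K * (D (x + h) + D x)" for x
  proof -
    have "ennreal (unit_ball_vol (DIM('a)) * r ^ DIM('a)) * ennreal (\<bar>v (x + h) - v x\<bar> powr p)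
        = (\<integral>\<^sup>+y. ennreal (\<bar>v (x + h) - v x\<bar> powr p) * indicator (ball x r) y \<partial>lborel)"
      using r by (subst nn_integral_cmult_indicator) (auto simp: emeasure_ball mult.commute)
    also have "\<dots> \<le> (\<integral>\<^sup>+y. ennreal K * (k (x + h) y + k x y) \<partial>lborel)"
      by (intro nn_integral_mono) (auto simp: indicator_def intro: point)
    also have "\<dots> = ennreal K * (D (x + h) + D x)"
      unfolding D_def by (subst nn_integral_cmult, measurable) (subst nn_integral_add, auto)
    finally show ?thesis .
  qed
  moreover have "(\<integral>\<^sup>+x. ennreal (unit_ball_vol (DIM('a)) * r ^ DIM('a)) * ennreal (\<bar>v (x + h) - v x\<bar> powr p) \<partial>lborel)
      = ennreal (unit_ball_vol (DIM('a)) * r ^ DIM('a)) * (\<integral>\<^sup>+x. ennreal (\<bar>v (x + h) - v x\<bar> powr p) \<partial>lborel)"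
    by (rule nn_integral_cmult) measurable
  ultimately have "ennreal (unit_ball_vol (DIM('a)) * r ^ DIM('a)) *
      (\<integral>\<^sup>+x. ennreal (\<bar>v (x + h) - v x\<bar> powr p) \<partial>lborel) \<le> (\<integral>\<^sup>+x. ennreal K * (D (x + h) + D x) \<partial>lborel)"
    using nn_integral_mono[of lborel "\<lambda>x. ennreal (unit_ball_vol (DIM('a)) * r ^ DIM('a)) * ennreal (\<bar>v (x + h) - v x\<bar> powr p)"
      "\<lambda>x. ennreal K * (D (x + h) + D x)"] by simp
  also have "\<dots> = ennreal K * (gagliardo p b v + gagliardo p b v)"
    unfolding gagliardo_D by (subst nn_integral_cmult, measurable)
      (subst nn_integral_add, auto simp: nn_integral_lborel_shift)
  also have "\<dots> = ennreal (2 * K) * gagliardo p b v"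
  proof -
    have "ennreal (2 * K) = ennreal K + ennreal K"
      unfolding mult_2 using K K by (rule ennreal_plus)
    then show ?thesis by (simp only: distrib_left distrib_right)
  qed
  finally have "ennreal (unit_ball_vol (DIM('a)) * r ^ DIM('a)) *
      (\<integral>\<^sup>+x. ennreal (\<bar>v (x + h) - v x\<bar> powr p) \<partial>lborel) \<le> ennreal (2 * K) * gagliardo p b v"
    .
  then have "(\<integral>\<^sup>+x. ennreal (\<bar>v (x + h) - v x\<bar> powr p) \<partial>lborel) \<le>
      ennreal (2 * K / (unit_ball_vol (DIM('a)) * r ^ DIM('a))) * gagliardo p b v"
    using r K by (intro ennreal_mult_le_divide mult_pos_pos) auto
  also have "2 * K / (unit_ball_vol (DIM('a)) * r ^ DIM('a)) =
      2 powr (p + 1) * 2 powr b / unit_ball_vol (DIM('a)) * norm h powr (b - DIM('a))"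
    using r by (simp add: K_def powr_mult powr_add powr_diff powr_realpow r_def[symmetric])
  finally show ?thesis .
qed


section \<open>Jensen's inequality and mollification in the seminorm\<close>

text \<open>Young's inequality with conjugate exponents \<open>p\<close> and
  \<open>p / (p - 1)\<close>, applied to \<open>t\<close> and \<open>m powr (p - 1)\<close>, becomes
  the tangent inequality at \<open>m\<close> after rearrangement.\<close>

lemma powr_ge_tangent:
  fixes t m p :: real
  assumes "1 < p" "0 \<le> t" "0 \<le> m"
  shows "m powr p + p * m powr (p - 1) * (t - m) \<le> t powr p"
proof (cases "m = 0")
  case False
  define q where "q = p / (p - 1)"
  have "t * m powr (p - 1) \<le> t powr p / p + (m powr (p - 1)) powr q / q"
    using assms by (intro Youngs_inequality) (auto simp: q_def field_simps)
  moreover have "(m powr (p - 1)) powr q = m powr p"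
    using assms by (simp add: powr_powr q_def)
  moreover have "m powr (p - 1) * m = m powr p"
    using False assms by (simp add: powr_mult_base mult.commute)
  ultimately show ?thesis
    using assms by (simp add: q_def field_simps)
qed (use assms in simp)

text \<open>Integrating the tangent inequality at the mean \<open>m\<close> of
  \<open>\<bar>f\<bar>\<close> against the probability density \<open>\<rho>\<close> makes the
  linear term vanish. Boundedness of \<open>f\<close> makes all integrals finite.\<close>

lemma jensen_powr:
  fixes \<rho> f :: "'a::euclidean_space \<Rightarrow> real"
  assumes p: "1 < p" and [measurable]: "\<rho> \<in> borel_measurable borel" "f \<in> borel_measurable borel"
    and \<rho>: "\<And>x. 0 \<le> \<rho> x" "integrable lborel \<rho>" "integral\<^sup>L lborel \<rho> = 1"
    and f: "\<And>x. \<bar>f x\<bar> \<le> T"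
  shows "ennreal (\<bar>\<integral>z. \<rho> z * f z \<partial>lborel\<bar> powr p) \<le> (\<integral>\<^sup>+z. ennreal (\<rho> z * \<bar>f z\<bar> powr p) \<partial>lborel)"
proof -
  have int_bdd: "integrable lborel (\<lambda>z. \<rho> z * k z)"
    if "k \<in> borel_measurable borel" "\<And>z. \<bar>k z\<bar> \<le> C" for k C
  proof (rule Bochner_Integration.integrable_bound)
    show "integrable lborel (\<lambda>z. \<rho> z * C)" using \<rho> by simp
    show "(\<lambda>z. \<rho> z * k z) \<in> borel_measurable lborel" using that(1) by measurable
    show "AE z in lborel. norm (\<rho> z * k z) \<le> norm (\<rho> z * C)"
      using \<rho>(1) that(2) by (intro AE_I2) (auto simp: abs_mult intro!: mult_left_mono order_trans[OF that(2) abs_ge_self])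
  qed
  have i1: "integrable lborel (\<lambda>z. \<rho> z * \<bar>f z\<bar>)"
    by (rule int_bdd[where C = T]) (use f in auto)
  have i2: "integrable lborel (\<lambda>z. \<rho> z * \<bar>f z\<bar> powr p)"
    by (rule int_bdd[where C = "T powr p"]) (use f p in \<open>auto intro!: powr_mono2\<close>)
  define m where "m = (\<integral>z. \<rho> z * \<bar>f z\<bar> \<partial>lborel)"
  have m: "0 \<le> m" unfolding m_def using \<rho>(1) by (intro integral_nonneg_AE) auto
  have "\<bar>\<integral>z. \<rho> z * f z \<partial>lborel\<bar> \<le> m"
    unfolding m_def using \<rho>(1) integral_abs_bound[of lborel "\<lambda>z. \<rho> z * f z"] by (simp add: abs_mult)
  then have "\<bar>\<integral>z. \<rho> z * f z \<partial>lborel\<bar> powr p \<le> m powr p"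
    using p by (intro powr_mono2) auto
  also have "m powr p = (\<integral>z. (m powr p - p * m powr (p - 1) * m) * \<rho> z + p * m powr (p - 1) * (\<rho> z * \<bar>f z\<bar>) \<partial>lborel)"
    using i1 \<rho> by (simp add: m_def[symmetric])
  also have "\<dots> \<le> (\<integral>z. \<rho> z * \<bar>f z\<bar> powr p \<partial>lborel)"
  proof (rule integral_mono)
    fix z
    show "(m powr p - p * m powr (p - 1) * m) * \<rho> z + p * m powr (p - 1) * (\<rho> z * \<bar>f z\<bar>) \<le> \<rho> z * \<bar>f z\<bar> powr p"
      using mult_left_mono[OF powr_ge_tangent[OF p abs_ge_zero[of "f z"] m] \<rho>(1)[of z]]
      by (simp add: algebra_simps)
  qed (use i1 i2 \<rho> in auto)
  finally have "ennreal (\<bar>\<integral>z. \<rho> z * f z \<partial>lborel\<bar> powr p) \<le> ennreal (\<integral>z. \<rho> z * \<bar>f z\<bar> powr p \<partial>lborel)"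
    by (rule ennreal_leI)
  also have "\<dots> = (\<integral>\<^sup>+z. ennreal (\<rho> z * \<bar>f z\<bar> powr p) \<partial>lborel)"
    using \<rho>(1) by (intro nn_integral_eq_integral[symmetric] i2) auto
  finally show ?thesis .
qed

text \<open>Collects what the integral estimates ask of the kernel; smoothness is kept apart because
  \<open>smooth_fun\<close> is defined on \<open>real^'n\<close>.\<close>

locale mollifier =
  fixes \<rho> :: "'a::euclidean_space \<Rightarrow> real" and d :: real
  assumes \<rho>_meas[measurable]: "\<rho> \<in> borel_measurable borel"
    and \<rho>_nonneg: "\<And>x. 0 \<le> \<rho> x" and \<rho>_int: "integrable lborel \<rho>" "integral\<^sup>L lborel \<rho> = 1"
    and \<rho>_supp: "\<And>x. d < norm x \<Longrightarrow> \<rho> x = 0"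
begin

lemma integrable_conv:
  assumes [measurable]: "v \<in> borel_measurable borel" and "\<And>x. \<bar>v x\<bar> \<le> T"
  shows "integrable lborel (\<lambda>z. \<rho> z * v (x - z))"
proof (rule Bochner_Integration.integrable_bound)
  show "integrable lborel (\<lambda>z. \<rho> z * T)" using \<rho>_int by simp
  show "AE z in lborel. norm (\<rho> z * v (x - z)) \<le> norm (\<rho> z * T)"
    using \<rho>_nonneg assms(2)
    by (intro AE_I2) (auto simp: abs_mult intro!: mult_left_mono order_trans[OF assms(2) abs_ge_self])
qed measurable

lemma conv_measurable[measurable]:
  assumes [measurable]: "v \<in> borel_measurable borel"
  shows "conv \<rho> v \<in> borel_measurable borel"
proof -
  have "(\<lambda>z. \<rho> (fst z - snd z) * v (snd z)) \<in> borel_measurable borel" by measurable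
  then have "(\<lambda>z. \<rho> (fst z - snd z) * v (snd z)) \<in> borel_measurable (borel \<Otimes>\<^sub>M lborel)"
    by (simp add: borel_prod cong: measurable_cong_sets)
  then have "(\<lambda>(x, z). \<rho> (x - z) * v z) \<in> borel_measurable (borel \<Otimes>\<^sub>M lborel)"
    by (simp add: case_prod_unfold)
  then show ?thesis unfolding conv_def[abs_def]
    by (rule lborel.borel_measurable_lebesgue_integral)
qed

lemma conv_nonneg: "(\<And>x. 0 \<le> v x) \<Longrightarrow> 0 \<le> conv \<rho> v x"
  unfolding conv_def using \<rho>_nonneg by (intro integral_nonneg_AE) auto

lemma conv_le:
  assumes [measurable]: "v \<in> borel_measurable borel" and v: "\<And>x. \<bar>v x\<bar> \<le> T"
    and "\<And>z. norm z \<le> d \<Longrightarrow> v (x - z) \<le> c"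
  shows "conv \<rho> v x \<le> c"
proof -
  have "conv \<rho> v x = (\<integral>z. \<rho> z * v (x - z) \<partial>lborel)" by (rule conv_flip) auto
  also have "\<dots> \<le> (\<integral>z. \<rho> z * c \<partial>lborel)"
  proof (rule integral_mono)
    show "\<rho> z * v (x - z) \<le> \<rho> z * c" for z
      using \<rho>_nonneg[of z] \<rho>_supp[of z] assms(3)[of z] by (cases "norm z \<le> d") (auto intro: mult_left_mono)
  qed (use integrable_conv[OF assms(1) v] \<rho>_int in auto)
  finally show ?thesis using \<rho>_int by simp
qed

lemma conv_ge:
  assumes [measurable]: "v \<in> borel_measurable borel" and v: "\<And>x. \<bar>v x\<bar> \<le> T"
    and "\<And>z. norm z \<le> d \<Longrightarrow> c \<le> v (x - z)"
  shows "c \<le> conv \<rho> v x"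
proof -
  have "conv \<rho> (\<lambda>x. - v x) x \<le> - c"
    by (rule conv_le[of _ T]) (use assms in auto)
  then show ?thesis by (simp add: conv_def)
qed

text \<open>The increment of a convolution is the \<open>\<rho>\<close>-average of translated
  increments. Jensen's inequality, Tonelli's theorem and translation invariance of the seminorm then
  give the constant 1.\<close>

lemma gagliardo_conv_le:
  assumes p: "1 < p" and [measurable]: "v \<in> borel_measurable borel" and v: "\<And>x. \<bar>v x\<bar> \<le> T"
  shows "gagliardo p b (conv \<rho> v) \<le> gagliardo p b v"
proof -
  let ?k = "\<lambda>z :: 'a \<times> 'a. norm (fst z - snd z) powr b"
  let ?G = "\<lambda>y :: ('a \<times> 'a) \<times> 'a. ennreal (\<rho> (snd y)) *
    ennreal (\<bar>v (fst (fst y) - snd y) - v (snd (fst y) - snd y)\<bar> powr p / ?k (fst y))"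
  have G[measurable]: "?G \<in> borel_measurable borel" by measurable
  have "gagliardo p b (conv \<rho> v) \<le> (\<integral>\<^sup>+z. \<integral>\<^sup>+w. ?G (z, w) \<partial>lborel \<partial>lborel)"
    unfolding gagliardo_def
  proof (rule nn_integral_mono)
    fix z :: "'a \<times> 'a"
    have eq: "conv \<rho> v (fst z) - conv \<rho> v (snd z) = (\<integral>w. \<rho> w * (v (fst z - w) - v (snd z - w)) \<partial>lborel)"
      by (simp add: conv_flip right_diff_distrib integrable_conv[OF assms(2) v])
    have "ennreal (\<bar>\<integral>w. \<rho> w * (v (fst z - w) - v (snd z - w)) \<partial>lborel\<bar> powr p)
        \<le> (\<integral>\<^sup>+w. ennreal (\<rho> w * \<bar>v (fst z - w) - v (snd z - w)\<bar> powr p) \<partial>lborel)"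
    proof (rule jensen_powr[OF p _ _ \<rho>_nonneg \<rho>_int, where T = "2 * T"])
      show "\<bar>v (fst z - w) - v (snd z - w)\<bar> \<le> 2 * T" for w
        using v[of "fst z - w"] v[of "snd z - w"] by linarith
    qed measurable
    then have "ennreal (\<bar>conv \<rho> v (fst z) - conv \<rho> v (snd z)\<bar> powr p) * ennreal (1 / ?k z)
        \<le> (\<integral>\<^sup>+w. ennreal (\<rho> w * \<bar>v (fst z - w) - v (snd z - w)\<bar> powr p) \<partial>lborel) * ennreal (1 / ?k z)"
      unfolding eq by (rule mult_right_mono) simp
    also have "\<dots> = (\<integral>\<^sup>+w. ennreal (\<rho> w * \<bar>v (fst z - w) - v (snd z - w)\<bar> powr p) * ennreal (1 / ?k z) \<partial>lborel)"
      by (rule nn_integral_multc[symmetric]) measurable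
    also have "\<dots> = (\<integral>\<^sup>+w. ?G (z, w) \<partial>lborel)"
      by (intro nn_integral_cong) (simp add: ennreal_mult'[symmetric] ennreal_mult''[symmetric] \<rho>_nonneg)
    finally show "ennreal (\<bar>conv \<rho> v (fst z) - conv \<rho> v (snd z)\<bar> powr p / ?k z) \<le> (\<integral>\<^sup>+w. ?G (z, w) \<partial>lborel)"
      by (simp add: ennreal_mult'[symmetric])
  qed
  also have "\<dots> = (\<integral>\<^sup>+w. \<integral>\<^sup>+z. ?G (z, w) \<partial>lborel \<partial>lborel)"
    using nn_integral_lborel_prod(1,2)[OF G] by simp
  also have "\<dots> = (\<integral>\<^sup>+w. ennreal (\<rho> w) * gagliardo p b v \<partial>lborel)"
  proof (rule nn_integral_cong)
    fix w
    have "(\<integral>\<^sup>+z. ?G (z, w) \<partial>lborel) = ennreal (\<rho> w) * gagliardo p b (\<lambda>x. v (x + - w))"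
      unfolding gagliardo_def by (simp, rule nn_integral_cmult) measurable
    then show "(\<integral>\<^sup>+z. ?G (z, w) \<partial>lborel) = ennreal (\<rho> w) * gagliardo p b v"
      by (subst (asm) gagliardo_shift) auto
  qed
  also have "\<dots> = ennreal (integral\<^sup>L lborel \<rho>) * gagliardo p b v"
    by (subst nn_integral_multc) (auto simp: nn_integral_eq_integral \<rho>_int \<rho>_nonneg)
  finally show ?thesis using \<rho>_int by simp
qed

text \<open>The same averaging, now with \<open>nn_integral_shift_diff_le\<close> for each shift
  \<open>w\<close>; only \<open>norm w \<le> d\<close> contributes, which produces the rate
  \<open>d powr (b - DIM('a))\<close>.\<close>

lemma nn_integral_conv_diff_le:
  fixes p b :: real
  assumes p: "1 < p" and b: "DIM('a) \<le> b" and [measurable]: "v \<in> borel_measurable borel"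
    and v: "\<And>x. \<bar>v x\<bar> \<le> T"
  shows "(\<integral>\<^sup>+x. ennreal (\<bar>conv \<rho> v x - v x\<bar> powr p) \<partial>lborel)
    \<le> ennreal (2 powr (p + 1) * 2 powr b / unit_ball_vol (DIM('a)) * d powr (b - DIM('a))) * gagliardo p b v"
    (is "_ \<le> ?K * _")
proof -
  have b0: "0 \<le> b" using b of_nat_0_le_iff order_trans by blast
  let ?G = "\<lambda>y. ennreal (\<rho> (snd y)) * ennreal (\<bar>v (fst y - snd y) - v (fst y)\<bar> powr p)"
  have G[measurable]: "?G \<in> borel_measurable borel" by measurable
  have "(\<integral>\<^sup>+x. ennreal (\<bar>conv \<rho> v x - v x\<bar> powr p) \<partial>lborel) \<le> (\<integral>\<^sup>+x. \<integral>\<^sup>+w. ?G (x, w) \<partial>lborel \<partial>lborel)"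
  proof (rule nn_integral_mono)
    fix x
    have eq: "conv \<rho> v x - v x = (\<integral>w. \<rho> w * (v (x - w) - v x) \<partial>lborel)"
      by (simp add: conv_flip right_diff_distrib integrable_conv[OF assms(3) v] \<rho>_int)
    have "ennreal (\<bar>\<integral>w. \<rho> w * (v (x - w) - v x) \<partial>lborel\<bar> powr p)
        \<le> (\<integral>\<^sup>+w. ennreal (\<rho> w * \<bar>v (x - w) - v x\<bar> powr p) \<partial>lborel)"
    proof (rule jensen_powr[OF p _ _ \<rho>_nonneg \<rho>_int, where T = "2 * T"])
      show "\<bar>v (x - w) - v x\<bar> \<le> 2 * T" for w
        using v[of "x - w"] v[of x] by linarith
    qed measurable
    then show "ennreal (\<bar>conv \<rho> v x - v x\<bar> powr p) \<le> (\<integral>\<^sup>+w. ?G (x, w) \<partial>lborel)"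
      by (simp add: eq ennreal_mult' \<rho>_nonneg)
  qed
  also have "\<dots> = (\<integral>\<^sup>+w. \<integral>\<^sup>+x. ?G (x, w) \<partial>lborel \<partial>lborel)"
    using nn_integral_lborel_prod(1,2)[OF G] by simp
  also have "\<dots> \<le> (\<integral>\<^sup>+w. ennreal (\<rho> w) * (?K * gagliardo p b v) \<partial>lborel)"
  proof (rule nn_integral_mono)
    fix w
    have "(\<integral>\<^sup>+x. ?G (x, w) \<partial>lborel) = ennreal (\<rho> w) * (\<integral>\<^sup>+x. ennreal (\<bar>v (x + - w) - v x\<bar> powr p) \<partial>lborel)"
      by (simp, rule nn_integral_cmult) measurable
    also have "\<dots> \<le> ennreal (\<rho> w) * (?K * gagliardo p b v)"
    proof (cases "w = 0 \<or> d < norm w")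
      case False
      then have w: "- w \<noteq> 0" "norm w \<le> d" by auto
      have "(\<integral>\<^sup>+x. ennreal (\<bar>v (x + - w) - v x\<bar> powr p) \<partial>lborel) \<le>
          ennreal (2 powr (p + 1) * 2 powr b / unit_ball_vol (DIM('a)) * norm (- w) powr (b - DIM('a))) * gagliardo p b v"
        by (rule nn_integral_shift_diff_le[OF _ _ b0 w(1)]) (use p in simp_all)
      also have "\<dots> \<le> ?K * gagliardo p b v"
        using b w(2) by (intro mult_right_mono ennreal_leI mult_left_mono powr_mono2 divide_nonneg_nonneg
            mult_nonneg_nonneg powr_ge_zero less_imp_le[OF unit_ball_vol_pos]) simp_all
      finally show ?thesis by (rule mult_left_mono) simp
    qed (use \<rho>_supp p in auto)
    finally show "(\<integral>\<^sup>+x. ?G (x, w) \<partial>lborel) \<le> ennreal (\<rho> w) * (?K * gagliardo p b v)" .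
  qed
  also have "\<dots> = ennreal (integral\<^sup>L lborel \<rho>) * (?K * gagliardo p b v)"
    by (subst nn_integral_multc) (auto simp: nn_integral_eq_integral \<rho>_int \<rho>_nonneg)
  finally show ?thesis using \<rho>_int by simp
qed

end

section \<open>Almost everywhere convergence and cutoffs\<close>

text \<open>Geometric decay makes the sum over \<open>n\<close> of the \<open>p\<close>-th powers
  integrable, so the terms tend to 0 almost everywhere along the whole sequence. This is why shifts
  and mollification radii are dyadic below.\<close>

lemma AE_tendsto_of_geometric:
  fixes f :: "nat \<Rightarrow> 'a \<Rightarrow> real"
  assumes [measurable]: "\<And>n. f n \<in> borel_measurable M" "g \<in> borel_measurable M" and p: "0 < p"
    and \<theta>: "0 \<le> \<theta>" "\<theta> < 1" and C: "C < \<infinity>"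
    and le: "\<And>n. (\<integral>\<^sup>+x. ennreal (\<bar>f n x - g x\<bar> powr p) \<partial>M) \<le> ennreal (\<theta> ^ n) * C"
  shows "AE x in M. (\<lambda>n. f n x) \<longlonglongrightarrow> g x"
proof -
  have "(\<integral>\<^sup>+x. (\<Sum>n. ennreal (\<bar>f n x - g x\<bar> powr p)) \<partial>M) = (\<Sum>n. \<integral>\<^sup>+x. ennreal (\<bar>f n x - g x\<bar> powr p) \<partial>M)"
    by (rule nn_integral_suminf) measurable
  also have "\<dots> \<le> (\<Sum>n. ennreal (\<theta> ^ n) * C)"
    by (intro suminf_le le summableI)
  also have "\<dots> = ennreal (1 / (1 - \<theta>)) * C"
    using \<theta> by (simp add: suminf_ennreal2 suminf_geometric summable_geometric)
  also have "\<dots> < \<infinity>" using C by (simp add: ennreal_mult_less_top)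
  finally have "AE x in M. (\<Sum>n. ennreal (\<bar>f n x - g x\<bar> powr p)) \<noteq> \<infinity>"
    by (intro nn_integral_PInf_AE) auto
  then show ?thesis
  proof eventually_elim
    fix x assume "(\<Sum>n. ennreal (\<bar>f n x - g x\<bar> powr p)) \<noteq> \<infinity>"
    then have "summable (\<lambda>n. \<bar>f n x - g x\<bar> powr p)"
      by (intro summable_suminf_not_top) auto
    then have lim: "(\<lambda>n. \<bar>f n x - g x\<bar> powr p) \<longlonglongrightarrow> 0" by (rule summable_LIMSEQ_zero)
    show "(\<lambda>n. f n x) \<longlonglongrightarrow> g x"
    proof (rule tendstoI)
      fix e :: real assume "0 < e"
      then have "eventually (\<lambda>n. \<bar>f n x - g x\<bar> powr p < e powr p) sequentially"
        by (intro order_tendstoD(2)[OF lim]) simp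
      then show "eventually (\<lambda>n. dist (f n x) (g x) < e) sequentially"
      proof eventually_elim
        fix n assume "\<bar>f n x - g x\<bar> powr p < e powr p"
        then have "\<not> e \<le> \<bar>f n x - g x\<bar>"
          using powr_mono2[of p e "\<bar>f n x - g x\<bar>"] p \<open>0 < e\<close> by auto
        then show "dist (f n x) (g x) < e" by (simp add: dist_real_def)
      qed
    qed
  qed
qed

text \<open>On the shell where \<open>norm z\<close> lies between \<open>r k / 2\<close> and
  \<open>r k\<close>, the power is at most \<open>2 powr \<bar>a\<bar> * r k powr a\<close> whatever
  the sign of \<open>a\<close>. Bounding each shell by its ball leaves a geometric series with ratio
  \<open>(1 / 2) powr (a + DIM('a))\<close>, which is below 1 by the hypothesis on
  \<open>a\<close>.\<close>

lemma nn_integral_ball_powr_finite: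
  fixes a R :: real
  assumes a: "- real DIM('a) < a" and R: "0 < R"
  shows "(\<integral>\<^sup>+z. ennreal (norm (z :: 'a::euclidean_space) powr a) * indicator (cball 0 R) z \<partial>lborel) < \<infinity>"
proof -
  define r where "r k = R * (1 / 2) ^ k" for k :: nat
  have r: "0 < r k" for k using R by (simp add: r_def)
  have r_powr: "r k powr t = R powr t * ((1 / 2) powr t) ^ k" for k t
    unfolding r_def using R by (simp add: powr_mult power_powr del: powr_realpow)
  have "(\<integral>\<^sup>+z. ennreal (norm (z :: 'a) powr a) * indicator (cball 0 R) z \<partial>lborel) \<le>
      (\<integral>\<^sup>+z. (\<Sum>k. ennreal (2 powr \<bar>a\<bar> * r k powr a) * indicator (cball 0 (r k)) z) \<partial>(lborel :: 'a measure))"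
  proof (rule nn_integral_mono)
    fix z :: 'a
    show "ennreal (norm z powr a) * indicator (cball 0 R) z \<le>
      (\<Sum>k. ennreal (2 powr \<bar>a\<bar> * r k powr a) * indicator (cball 0 (r k)) z)"
    proof (cases "z = 0 \<or> R < norm z")
      case False
      then have z: "0 < norm z" "norm z \<le> R" by auto
      have "r \<longlonglongrightarrow> 0" unfolding r_def
        by (intro tendsto_mult_right_zero LIMSEQ_power_zero) auto
      then have "\<exists>k. r k < norm z"
        using order_tendstoD(2)[OF _ z(1)] by (metis eventually_sequentially order_refl)
      then obtain k0 where k0: "r k0 < norm z" "\<And>j. j < k0 \<Longrightarrow> norm z \<le> r j"
        using exists_least_iff[of "\<lambda>k. r k < norm z"] by (auto simp: not_less)
      have "k0 \<noteq> 0" using k0(1) z by (auto simp: r_def intro: ccontr)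
      then obtain k where k: "k0 = Suc k" using not0_implies_Suc by blast
      have zk: "norm z \<le> r k" "r k / 2 < norm z" using k0 k by (auto simp: r_def)
      have "norm z powr a \<le> 2 powr \<bar>a\<bar> * r k powr a"
      proof (cases "0 \<le> a")
        case True
        then have "norm z powr a \<le> r k powr a" using zk by (intro powr_mono2) auto
        also have "\<dots> \<le> 2 powr \<bar>a\<bar> * r k powr a"
          using mult_right_mono[OF ge_one_powr_ge_zero[of 2 "\<bar>a\<bar>"], of "r k powr a"] by simp
        finally show ?thesis .
      next
        case False
        then have "norm z powr a \<le> (r k / 2) powr a" using zk r[of k] by (intro powr_mono2') auto
        also have "\<dots> = 2 powr \<bar>a\<bar> * r k powr a"
          using False r[of k] by (simp add: powr_divide powr_minus field_simps)
        finally show ?thesis .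
      qed
      then have "ennreal (norm z powr a) * indicator (cball 0 R) z
          \<le> ennreal (2 powr \<bar>a\<bar> * r k powr a) * indicator (cball 0 (r k)) z"
        using z zk by (simp add: ennreal_leI)
      also have "\<dots> \<le> (\<Sum>k. ennreal (2 powr \<bar>a\<bar> * r k powr a) * indicator (cball 0 (r k)) z)"
        using sum_le_suminf[OF summableI, of "{k}" "\<lambda>k. ennreal (2 powr \<bar>a\<bar> * r k powr a) * indicator (cball 0 (r k)) z"]
        by (simp del: indicator_simps sum_mult_indicator)
      finally show ?thesis .
    qed auto
  qed
  also have "\<dots> = (\<Sum>k. \<integral>\<^sup>+z. ennreal (2 powr \<bar>a\<bar> * r k powr a) * indicator (cball 0 (r k)) (z :: 'a) \<partial>lborel)"
    by (intro nn_integral_suminf borel_measurable_times_ennreal borel_measurable_const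
        borel_measurable_indicator) simp
  also have "\<dots> = (\<Sum>k. ennreal (2 powr \<bar>a\<bar> * unit_ball_vol (DIM('a)) * R powr (a + DIM('a)) * ((1 / 2) powr (a + DIM('a))) ^ k))"
  proof (rule suminf_cong)
    fix k
    have "(\<integral>\<^sup>+z. ennreal (2 powr \<bar>a\<bar> * r k powr a) * indicator (cball 0 (r k)) (z :: 'a) \<partial>lborel)
        = ennreal (2 powr \<bar>a\<bar> * r k powr a) * ennreal (unit_ball_vol (DIM('a)) * r k ^ DIM('a))"
      using r[of k] by (simp add: nn_integral_cmult_indicator emeasure_cball)
    also have "\<dots> = ennreal (2 powr \<bar>a\<bar> * unit_ball_vol (DIM('a)) * r k powr (a + DIM('a)))"
      using r[of k] by (simp add: ennreal_mult'[symmetric] powr_add powr_realpow mult_ac)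
    finally show "(\<integral>\<^sup>+z. ennreal (2 powr \<bar>a\<bar> * r k powr a) * indicator (cball 0 (r k)) (z :: 'a) \<partial>lborel)
      = ennreal (2 powr \<bar>a\<bar> * unit_ball_vol (DIM('a)) * R powr (a + DIM('a)) * ((1 / 2) powr (a + DIM('a))) ^ k)"
      by (simp add: r_powr mult_ac)
  qed
  also have "\<dots> < \<infinity>"
  proof -
    have "(1 / 2 :: real) powr (a + DIM('a)) < 1"
      using a powr_less_mono2[of "a + DIM('a)" "1/2" "1::real"] by simp
    then have "summable (\<lambda>k. ((1 / 2 :: real) powr (a + DIM('a))) ^ k)"
      by (intro summable_geometric) auto
    then show ?thesis
      by (subst suminf_ennreal2) (auto intro!: summable_mult)
  qed
  finally show ?thesis .
qed


text \<open>Write the increment as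
  \<open>\<zeta> x * (v x - v y) + (\<zeta> x - \<zeta> y) * v y\<close>: the Lipschitz bound turns
  the second term into \<open>norm (x - y) powr (p - b)\<close>, locally integrable because
  \<open>b - p\<close> is below the dimension. If one point lies outside the ball of radius
  \<open>R\<close>, the product has no larger an increment than \<open>v\<close>, so no tail
  integral arises.\<close>

lemma gagliardo_cutoff_finite:
  fixes v \<zeta> :: "'a::euclidean_space \<Rightarrow> real" and p b T R L :: real
  assumes [measurable]: "v \<in> borel_measurable borel" "\<zeta> \<in> borel_measurable borel"
    and v: "\<And>x. \<bar>v x\<bar> \<le> T" "\<And>x. R < norm x \<Longrightarrow> v x = 0" and R: "0 < R"
    and \<zeta>: "\<And>x. 0 \<le> \<zeta> x" "\<And>x. \<zeta> x \<le> 1" "\<And>x y. \<bar>\<zeta> x - \<zeta> y\<bar> \<le> L * norm (x - y)"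
    and p: "0 < p" and b: "b - p < DIM('a)" and fin: "gagliardo p b v < \<infinity>"
  shows "gagliardo p b (\<lambda>x. \<zeta> x * v x) < \<infinity>"
proof -
  have T: "0 \<le> T" using v(1)[of 0] abs_ge_zero order_trans by blast
  have L: "0 \<le> L" using \<zeta>(3)[of "SOME i. i \<in> Basis" 0]
    by (metis SOME_Basis abs_ge_zero diff_zero mult.right_neutral norm_Basis order_trans)
  define J where "J = (\<integral>\<^sup>+z. ennreal (norm (z :: 'a) powr (p - b)) * indicator (cball 0 (2 * R)) z \<partial>lborel)"
  have J: "J < \<infinity>" unfolding J_def using b R by (intro nn_integral_ball_powr_finite) auto
  define G where "G z = ennreal ((T * L) powr p) * (indicator (cball 0 R) (fst z) * (ennreal (norm (fst z - snd z) powr (p - b)) * indicator (cball 0 R) (snd z)))"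
    for z :: "'a \<times> 'a"
  have [measurable]: "cball (0::'a) R \<in> sets borel" "cball (0::'a) (2 * R) \<in> sets borel" by auto
  have G_meas[measurable]: "G \<in> borel_measurable borel" unfolding G_def by measurable
  have "gagliardo p b (\<lambda>x. \<zeta> x * v x) \<le> (\<integral>\<^sup>+z. ennreal (2 powr p) *
      (ennreal (\<bar>v (fst z) - v (snd z)\<bar> powr p / norm (fst z - snd z) powr b) + G z) \<partial>lborel)"
    unfolding gagliardo_def
  proof (rule nn_integral_mono)
    fix z :: "'a \<times> 'a"
    obtain x y where z: "z = (x, y)" by (cases z)
    let ?k = "norm (x - y) powr b"
    have one: "\<bar>\<zeta> x * v x - \<zeta> y * v y\<bar> powr p / ?k \<le> 2 powr p * (\<bar>v x - v y\<bar> powr p / ?k)"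
      if "\<bar>\<zeta> x * v x - \<zeta> y * v y\<bar> \<le> \<bar>v x - v y\<bar>"
    proof -
      have "\<bar>\<zeta> x * v x - \<zeta> y * v y\<bar> powr p \<le> 1 * \<bar>v x - v y\<bar> powr p"
        using that p by (simp add: powr_mono2)
      also have "\<dots> \<le> 2 powr p * \<bar>v x - v y\<bar> powr p"
        using p by (intro mult_right_mono ge_one_powr_ge_zero) auto
      finally show ?thesis by (simp add: divide_right_mono)
    qed
    have shrink: "\<bar>\<zeta> w * v w\<bar> \<le> \<bar>v w\<bar>" for w
      using \<zeta>(1,2)[of w] by (simp add: abs_mult mult_left_le_one_le)
    consider "R < norm x" | "R < norm y" | "norm x \<le> R" "norm y \<le> R" by linarith
    then show "ennreal (\<bar>\<zeta> (fst z) * v (fst z) - \<zeta> (snd z) * v (snd z)\<bar> powr p / norm (fst z - snd z) powr b)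
      \<le> ennreal (2 powr p) * (ennreal (\<bar>v (fst z) - v (snd z)\<bar> powr p / norm (fst z - snd z) powr b) + G z)"
    proof cases
      case 3
      have "\<bar>\<zeta> x * v x - \<zeta> y * v y\<bar> = \<bar>\<zeta> x * (v x - v y) + (\<zeta> x - \<zeta> y) * v y\<bar>"
        by (simp add: algebra_simps)
      also have "\<dots> \<le> \<bar>\<zeta> x\<bar> * \<bar>v x - v y\<bar> + \<bar>\<zeta> x - \<zeta> y\<bar> * \<bar>v y\<bar>"
        by (metis abs_mult abs_triangle_ineq)
      also have "\<dots> \<le> 1 * \<bar>v x - v y\<bar> + L * norm (x - y) * T"
        using \<zeta> v L by (intro add_mono mult_mono) auto
      finally have "\<bar>\<zeta> x * v x - \<zeta> y * v y\<bar> \<le> \<bar>v x - v y\<bar> + T * L * norm (x - y)" by (simp add: mult_ac)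
      then have "\<bar>\<zeta> x * v x - \<zeta> y * v y\<bar> powr p \<le> (\<bar>v x - v y\<bar> + T * L * norm (x - y)) powr p"
        using p by (intro powr_mono2) auto
      also have "\<dots> \<le> 2 powr p * (\<bar>v x - v y\<bar> powr p + (T * L * norm (x - y)) powr p)"
        using T L p by (intro powr_add_le) auto
      also have "(T * L * norm (x - y)) powr p = (T * L) powr p * norm (x - y) powr p"
        using T L by (simp add: powr_mult)
      finally have "\<bar>\<zeta> x * v x - \<zeta> y * v y\<bar> powr p / ?k \<le>
          2 powr p * (\<bar>v x - v y\<bar> powr p + (T * L) powr p * norm (x - y) powr p) / ?k"
        by (rule divide_right_mono) simp
      also have "\<dots> = 2 powr p * (\<bar>v x - v y\<bar> powr p / ?k + (T * L) powr p * norm (x - y) powr (p - b))"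
        by (simp add: powr_diff add_divide_distrib distrib_left)
      finally show ?thesis
        using 3 by (simp add: z G_def ennreal_mult'[symmetric] ennreal_plus[symmetric] ennreal_leI del: ennreal_plus)
    next
      case 1
      then have "\<bar>\<zeta> x * v x - \<zeta> y * v y\<bar> \<le> \<bar>v x - v y\<bar>" using v(2) shrink[of y] by simp
      then show ?thesis
        using one by (auto simp: z ennreal_mult'[symmetric] distrib_left intro!: add_increasing2 ennreal_leI)
    next
      case 2
      then have "\<bar>\<zeta> x * v x - \<zeta> y * v y\<bar> \<le> \<bar>v x - v y\<bar>" using v(2) shrink[of x] by simp
      then show ?thesis
        using one by (auto simp: z ennreal_mult'[symmetric] distrib_left intro!: add_increasing2 ennreal_leI)
    qed
  qed
  also have "\<dots> = ennreal (2 powr p) * (gagliardo p b v + (\<integral>\<^sup>+z. G z \<partial>lborel))"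
    unfolding gagliardo_def by (subst nn_integral_cmult, measurable) (subst nn_integral_add, auto)
  also have "\<dots> < \<infinity>"
  proof -
    have "(\<integral>\<^sup>+z. G z \<partial>lborel) = (\<integral>\<^sup>+x. \<integral>\<^sup>+y. G (x, y) \<partial>lborel \<partial>lborel)"
      by (rule nn_integral_lborel_prod) measurable
    also have "\<dots> \<le> (\<integral>\<^sup>+x. ennreal ((T * L) powr p) * J * indicator (cball 0 R) (x :: 'a) \<partial>lborel)"
    proof (rule nn_integral_mono)
      fix x :: 'a
      show "(\<integral>\<^sup>+y. G (x, y) \<partial>lborel) \<le> ennreal ((T * L) powr p) * J * indicator (cball 0 R) x"
      proof (cases "norm x \<le> R")
        case True
        have "(\<integral>\<^sup>+y. G (x, y) \<partial>lborel) = ennreal ((T * L) powr p) * (\<integral>\<^sup>+y. ennreal (norm (x - y) powr (p - b)) * indicator (cball 0 R) y \<partial>lborel)"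
          unfolding G_def using True by simp (rule nn_integral_cmult, measurable)
        also have "(\<integral>\<^sup>+y. ennreal (norm (x - y) powr (p - b)) * indicator (cball 0 R) y \<partial>lborel)
            \<le> (\<integral>\<^sup>+y. ennreal (norm (y + - x) powr (p - b)) * indicator (cball 0 (2 * R)) (y + - x) \<partial>lborel)"
        proof (rule nn_integral_mono)
          fix y
          have "norm y \<le> R \<Longrightarrow> norm (y - x) \<le> 2 * R"
            using True norm_triangle_ineq4[of y x] by linarith
          then show "ennreal (norm (x - y) powr (p - b)) * indicator (cball 0 R) y
              \<le> ennreal (norm (y + - x) powr (p - b)) * indicator (cball 0 (2 * R)) (y + - x)"
            by (auto simp: norm_minus_commute indicator_def)
        qed
        also have "\<dots> = J"
          unfolding J_def by (rule nn_integral_lborel_shift) measurable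
        finally show ?thesis using True by (simp add: mult_left_mono)
      qed (simp add: G_def)
    qed
    also have "\<dots> = ennreal ((T * L) powr p) * J * emeasure lborel (cball (0::'a) R)"
      by (rule nn_integral_cmult_indicator) simp
    also have "\<dots> < \<infinity>"
      using J R by (simp add: ennreal_mult_less_top emeasure_cball)
    finally show ?thesis using fin by (simp add: ennreal_mult_less_top)
  qed
  finally show ?thesis .
qed

lemma fatou_le:
  fixes f :: "nat \<Rightarrow> 'a \<Rightarrow> ennreal"
  assumes [measurable]: "\<And>n. f n \<in> borel_measurable M"
    and lim: "AE x in M. (\<lambda>n. f n x) \<longlonglongrightarrow> g x"
    and le: "\<And>n. (\<integral>\<^sup>+x. f n x \<partial>M) \<le> c n" and c: "c \<longlonglongrightarrow> C"
  shows "(\<integral>\<^sup>+x. g x \<partial>M) \<le> C"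
proof -
  have "(\<integral>\<^sup>+x. g x \<partial>M) = (\<integral>\<^sup>+x. liminf (\<lambda>n. f n x) \<partial>M)"
    using lim by (intro nn_integral_cong_AE) (auto elim!: eventually_mono simp: lim_imp_Liminf)
  also have "\<dots> \<le> liminf (\<lambda>n. \<integral>\<^sup>+x. f n x \<partial>M)"
    by (rule nn_integral_liminf) measurable
  also have "\<dots> \<le> liminf c" by (intro Liminf_mono always_eventually allI le)
  also have "\<dots> = C" using c by (intro lim_imp_Liminf) auto
  finally show ?thesis .
qed

section \<open>The fractional Sobolev inequality\<close>

text \<open>The factors come, in this order, from the increment being at least half the value, from
  the radius of the comparison ball raised to the kernel exponent, and from the factor
  \<open>2 powr q\<close> in the Chebyshev bound.\<close>

definition sobolev_const :: "real \<Rightarrow> real \<Rightarrow> real \<Rightarrow> real" where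
  "sobolev_const n s p = 2 powr p * (2 / unit_ball_vol n) powr (1 + s * p / n)
     * 2 powr (crit_exp n s p * (s * p / n))"

text \<open>If \<open>v x = a\<close>, then \<open>v \<le> a / 2\<close> on at least half of a ball around \<open>x\<close> whose volume is twice
  the Chebyshev bound for the measure of \<open>{v > a / 2}\<close>; this bounds the inner integral of the
  seminorm at \<open>x\<close> from below.\<close>

lemma sobolev_pointwise:
  fixes v :: "'a::euclidean_space \<Rightarrow> real" and s p I :: real
  defines "n \<equiv> real DIM('a)" and "q \<equiv> crit_exp (real DIM('a)) s p"
  assumes p: "1 < p" and s: "0 < s" and sp: "s * p < n"
    and [measurable]: "v \<in> borel_measurable borel"
    and I: "(\<integral>\<^sup>+x. ennreal (v x powr q) \<partial>lborel) = ennreal I" "0 < I" and a: "0 < v x"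
  shows "ennreal (v x powr q) \<le> ennreal (sobolev_const n s p * I powr (s * p / n)) *
    (\<integral>\<^sup>+y. ennreal (\<bar>v x - v y\<bar> powr p / norm (x - y) powr (n + s * p)) \<partial>lborel)"
proof -
  define a where "a = v x"
  define \<sigma> where "\<sigma> = s * p / n"
  define c where "c = unit_ball_vol n"
  have n: "0 < n" by (simp add: n_def)
  have \<sigma>: "0 < \<sigma>" "\<sigma> < 1" using p s sp n by (auto simp: \<sigma>_def)
  have q: "q = p / (1 - \<sigma>)" using n sp by (simp add: q_def crit_exp_def \<sigma>_def n_def[symmetric] field_simps)
  have q_pos: "0 < q" using p \<sigma> by (simp add: q)
  \<comment> \<open>Criticality of the exponent: \<open>a powr p\<close> from the increment and
    \<open>a powr (q * \<sigma>)\<close> from the radius combine to exactly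
    \<open>a powr q\<close>.\<close>
  have pq: "p + q * \<sigma> = q" using \<sigma> by (simp add: q field_simps)
  have c: "0 < c" unfolding c_def using n by simp
  have a_pos: "0 < a" using a by (simp add: a_def)
  define m where "m = 2 powr q * I / a powr q"
  have m: "0 < m" using I a_pos by (simp add: m_def)
  define r where "r = (2 * m / c) powr (1 / n)"
  have r: "0 < r" using m c by (simp add: r_def)
  have r_n: "r ^ DIM('a) = 2 * m / c"
    using m c n r by (simp add: r_def n_def powr_power)
  define H where "H = {y. a / 2 < v y}"
  have H[measurable]: "H \<in> sets borel" unfolding H_def by measurable
  have B[measurable]: "ball x r \<in> sets borel" by simp
  have H_le: "emeasure lborel H \<le> ennreal m"
  proof -
    have "ennreal ((a / 2) powr q) * emeasure lborel H = (\<integral>\<^sup>+y. ennreal ((a / 2) powr q) * indicator H y \<partial>lborel)"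
      by (rule nn_integral_cmult_indicator[symmetric]) simp
    also have "\<dots> \<le> (\<integral>\<^sup>+y. ennreal (v y powr q) \<partial>lborel)"
      using a_pos q_pos
      by (intro nn_integral_mono) (auto simp: indicator_def H_def intro!: ennreal_leI powr_mono2)
    finally have "ennreal ((a / 2) powr q) * emeasure lborel H \<le> ennreal I * 1" using I by simp
    then have "emeasure lborel H \<le> ennreal (I / (a / 2) powr q) * 1"
      using a_pos I by (intro ennreal_mult_le_divide) auto
    then show ?thesis using a_pos by (simp add: m_def powr_divide field_simps)
  qed
  have "ennreal (2 * m) = emeasure lborel (ball x r)"
    using r r_n c by (simp add: emeasure_ball c_def[symmetric] n_def[symmetric])
  also have "\<dots> \<le> emeasure lborel (ball x r - H) + emeasure lborel H"
    by (rule order_trans[OF emeasure_mono emeasure_subadditive]) auto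
  also have "\<dots> \<le> emeasure lborel (ball x r - H) + ennreal m"
    by (intro add_left_mono H_le)
  finally have le: "ennreal (2 * m) \<le> emeasure lborel (ball x r - H) + ennreal m" .
  have "ennreal (2 * m) = ennreal m + ennreal m"
    unfolding mult_2 by (rule ennreal_plus) (use m in simp_all)
  with le have "ennreal m + ennreal m \<le> ennreal m + emeasure lborel (ball x r - H)"
    by (simp only: add.commute)
  then have good: "ennreal m \<le> emeasure lborel (ball x r - H)"
    by (simp add: ennreal_add_left_cancel_le)
  have "ennreal ((a / 2) powr p / r powr (n + s * p)) * ennreal m
      \<le> ennreal ((a / 2) powr p / r powr (n + s * p)) * emeasure lborel (ball x r - H)"
    by (intro mult_left_mono good) simp
  also have "\<dots> = (\<integral>\<^sup>+y. ennreal ((a / 2) powr p / r powr (n + s * p)) * indicator (ball x r - H) y \<partial>lborel)"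
    by (rule nn_integral_cmult_indicator[symmetric]) simp
  also have "\<dots> \<le> (\<integral>\<^sup>+y. ennreal (\<bar>v x - v y\<bar> powr p / norm (x - y) powr (n + s * p)) \<partial>lborel)"
  proof (rule nn_integral_mono)
    fix y
    show "ennreal ((a / 2) powr p / r powr (n + s * p)) * indicator (ball x r - H) y
        \<le> ennreal (\<bar>v x - v y\<bar> powr p / norm (x - y) powr (n + s * p))"
    proof (cases "y \<in> ball x r - H")
      case True
      then have y: "norm (x - y) < r" "v y \<le> a / 2" by (auto simp: H_def dist_norm)
      then have "x \<noteq> y" using a_pos by (auto simp: a_def)
      then have "(a / 2) powr p / r powr (n + s * p) \<le> \<bar>v x - v y\<bar> powr p / norm (x - y) powr (n + s * p)"
        using y a_pos p s n by (intro frac_le powr_mono2) (auto simp: a_def)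
      then show ?thesis using True by (simp add: ennreal_leI)
    qed simp
  qed
  finally have D: "ennreal ((a / 2) powr p / r powr (n + s * p) * m) \<le>
      (\<integral>\<^sup>+y. ennreal (\<bar>v x - v y\<bar> powr p / norm (x - y) powr (n + s * p)) \<partial>lborel)"
    by (subst ennreal_mult'') (use m in simp_all)
  have "r powr (n + s * p) = (2 * m / c) powr (1 + \<sigma>)"
    unfolding r_def powr_powr using n by (simp add: \<sigma>_def field_simps)
  also have "\<dots> = (2 / c) powr (1 + \<sigma>) * m * m powr \<sigma>"
    using m c by (simp add: powr_mult powr_divide powr_add)
  finally have rb: "r powr (n + s * p) = (2 / c) powr (1 + \<sigma>) * m * m powr \<sigma>" .
  have m\<sigma>: "m powr \<sigma> = 2 powr (q * \<sigma>) * I powr \<sigma> / a powr (q * \<sigma>)"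
    using I a_pos by (simp add: m_def powr_mult powr_divide powr_powr)
  have apq: "a powr p * a powr (q * \<sigma>) = a powr q"
    by (simp add: powr_add[symmetric] pq)
  have "sobolev_const n s p * I powr \<sigma> * ((a / 2) powr p / r powr (n + s * p) * m)
      = a powr p * a powr (q * \<sigma>)"
    unfolding rb m\<sigma> sobolev_const_def \<sigma>_def[symmetric] q_def[symmetric] n_def[symmetric] c_def[symmetric]
    using m I a_pos c q_def n_def by (simp add: powr_divide field_simps)
  then have "ennreal (a powr q) = ennreal (sobolev_const n s p * I powr \<sigma>) *
      ennreal ((a / 2) powr p / r powr (n + s * p) * m)"
    by (simp add: apq ennreal_mult''[symmetric] m less_imp_le)
  also have "\<dots> \<le> ennreal (sobolev_const n s p * I powr \<sigma>) *
      (\<integral>\<^sup>+y. ennreal (\<bar>v x - v y\<bar> powr p / norm (x - y) powr (n + s * p)) \<partial>lborel)"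
    by (intro mult_left_mono D) simp
  finally show ?thesis by (simp add: a_def \<sigma>_def)
qed

lemma sobolev_const_nonneg: "0 \<le> sobolev_const n s p"
  by (simp add: sobolev_const_def)

text \<open>Integrating the pointwise bound gives \<open>I \<le> S * I powr \<sigma> * G\<close> for
  the integral \<open>I\<close> on the left and the constant \<open>S\<close>, and
  \<open>I powr \<sigma>\<close> is absorbed; \<open>q / p\<close> is
  \<open>1 / (1 - \<sigma>)\<close>. Absorption requires \<open>I\<close> finite, hence the
  truncation at height \<open>k\<close>, bounded with bounded support, which Fatou's lemma removes
  at the end.\<close>

theorem fractional_sobolev:
  fixes v :: "'a::euclidean_space \<Rightarrow> real" and s p R G :: real
  defines "n \<equiv> real DIM('a)" and "q \<equiv> crit_exp (real DIM('a)) s p"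
  assumes p: "1 < p" and s: "0 < s" and sp: "s * p < n"
    and [measurable]: "v \<in> borel_measurable borel"
    and v: "\<And>x. 0 \<le> v x" "\<And>x. R < norm x \<Longrightarrow> v x = 0"
    and G: "gagliardo p (n + s * p) v \<le> ennreal G" "0 \<le> G"
  shows "(\<integral>\<^sup>+x. ennreal (v x powr q) \<partial>lborel) \<le> ennreal ((sobolev_const n s p * G) powr (q / p))"
proof -
  define \<sigma> where "\<sigma> = s * p / n"
  have n: "0 < n" by (simp add: n_def)
  have \<sigma>: "0 < \<sigma>" "\<sigma> < 1" using p s sp n by (auto simp: \<sigma>_def)
  have q: "q = p / (1 - \<sigma>)" using n sp by (simp add: q_def crit_exp_def \<sigma>_def n_def[symmetric] field_simps)
  have q_pos: "0 < q" using p \<sigma> by (simp add: q)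
  define R' where "R' = max R 1"
  have R': "0 < R'" "\<And>x. R' < norm x \<Longrightarrow> v x = 0" using v(2) by (auto simp: R'_def)
  have bound: "(\<integral>\<^sup>+x. ennreal (min (v x) (real k) powr q) \<partial>lborel) \<le> ennreal ((sobolev_const n s p * G) powr (q / p))" for k
  proof -
    define w where "w x = min (v x) (real k)" for x
    have w[measurable]: "w \<in> borel_measurable borel" unfolding w_def by measurable
    have w_nonneg: "0 \<le> w x" for x using v(1)[of x] by (simp add: w_def)
    have "gagliardo p (n + s * p) w \<le> gagliardo p (n + s * p) v"
      using p by (intro gagliardo_mono) (auto simp: w_def)
    then have Gw: "gagliardo p (n + s * p) w \<le> ennreal G" using G(1) order_trans by blast
    have "(\<integral>\<^sup>+x. ennreal (w x powr q) \<partial>lborel) \<le> (\<integral>\<^sup>+x. ennreal (real k powr q) * indicator (cball 0 R') (x::'a) \<partial>lborel)"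
    proof (rule nn_integral_mono)
      fix x :: 'a
      show "ennreal (w x powr q) \<le> ennreal (real k powr q) * indicator (cball 0 R') x"
        using R'(2)[of x] v(1)[of x] q_pos
        by (cases "norm x \<le> R'") (auto simp: w_def intro!: ennreal_leI powr_mono2)
    qed
    also have "\<dots> = ennreal (real k powr q) * emeasure lborel (cball (0::'a) R')"
      by (rule nn_integral_cmult_indicator) simp
    also have "\<dots> < \<infinity>" using R' by (simp add: emeasure_cball ennreal_mult_less_top)
    finally have "(\<integral>\<^sup>+x. ennreal (w x powr q) \<partial>lborel) < \<infinity>" .
    then obtain I where I: "0 \<le> I" "(\<integral>\<^sup>+x. ennreal (w x powr q) \<partial>lborel) = ennreal I"
      by (metis ennreal_cases infinity_ennreal_def less_irrefl)
    have "I \<le> (sobolev_const n s p * G) powr (q / p)"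
    proof (cases "I = 0")
      case False
      with I have I_pos: "0 < I" by simp
      let ?K = "ennreal (sobolev_const n s p * I powr \<sigma>)"
      let ?k = "\<lambda>z. ennreal (\<bar>w (fst z) - w (snd z)\<bar> powr p / norm (fst z - snd z) powr (n + s * p))"
      have k_meas[measurable]: "?k \<in> borel_measurable borel" by measurable
      have "ennreal I \<le> (\<integral>\<^sup>+x. ?K * (\<integral>\<^sup>+y. ?k (x, y) \<partial>lborel) \<partial>lborel)"
        unfolding I(2)[symmetric]
      proof (rule nn_integral_mono)
        fix x
        show "ennreal (w x powr q) \<le> ?K * (\<integral>\<^sup>+y. ?k (x, y) \<partial>lborel)"
        proof (cases "w x = 0")
          case False
          then have "0 < w x" using w_nonneg[of x] by simp
          from sobolev_pointwise[OF p s sp[unfolded n_def] w I(2)[unfolded q_def] I_pos this]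
          show ?thesis by (simp add: q_def n_def \<sigma>_def)
        qed simp
      qed
      also have "\<dots> = ?K * gagliardo p (n + s * p) w"
        using nn_integral_lborel_prod(3)[OF k_meas]
        by (subst nn_integral_cmult) (auto simp: gagliardo_def nn_integral_lborel_prod(1)[OF k_meas])
      also have "\<dots> \<le> ?K * ennreal G" by (intro mult_left_mono Gw) simp
      finally have "I \<le> sobolev_const n s p * I powr \<sigma> * G"
        using G(2) by (simp add: ennreal_mult''[symmetric] sobolev_const_nonneg)
      moreover have "I = I powr (1 - \<sigma>) * I powr \<sigma>" using I_pos by (simp add: powr_add[symmetric])
      ultimately have "I powr (1 - \<sigma>) * I powr \<sigma> \<le> (sobolev_const n s p * G) * I powr \<sigma>"
        by (simp add: mult_ac)
      then have "I powr (1 - \<sigma>) \<le> sobolev_const n s p * G"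
        using I_pos by (simp add: mult_le_cancel_right)
      then have "(I powr (1 - \<sigma>)) powr (q / p) \<le> (sobolev_const n s p * G) powr (q / p)"
        using p q_pos by (intro powr_mono2) auto
      then show ?thesis using I_pos p \<sigma> by (simp add: powr_powr q)
    qed simp
    then show ?thesis using I(2) by (simp add: w_def ennreal_leI)
  qed
  show ?thesis
  proof (rule fatou_le[OF _ _ bound tendsto_const])
    show "AE x in lborel. (\<lambda>k. ennreal (min (v x) (real k) powr q)) \<longlonglongrightarrow> ennreal (v x powr q)"
    proof (intro AE_I2 tendsto_eventually)
      fix x
      obtain k0 where "v x \<le> real k0" using real_arch_simple by blast
      then show "eventually (\<lambda>k. ennreal (min (v x) (real k) powr q) = ennreal (v x powr q)) sequentially"
        by (intro eventually_sequentiallyI[of k0]) (simp add: min_def)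
    qed
  qed measurable
qed


section \<open>Lower semicontinuity of the form\<close>

text \<open>Taken over the whole product space: it agrees with the integral over
  \<open>Qset \<Omega>\<close> when both functions vanish outside \<open>\<Omega>\<close>, so the
  estimates need no reference to the domain.\<close>

definition pform :: "real \<Rightarrow> real \<Rightarrow> ('a::euclidean_space \<Rightarrow> real) \<Rightarrow> ('a \<Rightarrow> real) \<Rightarrow> real" where
  "pform p b u v = (\<integral>z. \<bar>u (fst z) - u (snd z)\<bar> powr (p - 2) * (u (fst z) - u (snd z)) * (v (fst z) - v (snd z))
     / norm (fst z - snd z) powr b \<partial>lborel)"

text \<open>Split according to \<open>\<bar>c\<bar> \<le> M * \<bar>a\<bar>\<close>. The weight is
  free so that \<open>M powr (1 - p)\<close>, the price paid on the varying factor \<open>c\<close>,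
  can be made small by taking \<open>M\<close> large.\<close>

lemma young_split:
  fixes a c M p :: real
  assumes "1 < p" "0 < M"
  shows "\<bar>\<bar>a\<bar> powr (p - 2) * a * c\<bar> \<le> M * \<bar>a\<bar> powr p + M powr (1 - p) * \<bar>c\<bar> powr p"
proof (cases "a = 0")
  case False
  have eq: "\<bar>\<bar>a\<bar> powr (p - 2) * a * c\<bar> = \<bar>a\<bar> powr (p - 1) * \<bar>c\<bar>"
    using False powr_mult_base[of "\<bar>a\<bar>" "p - 2"] by (simp add: abs_mult mult.commute)
  show ?thesis
  proof (cases "\<bar>c\<bar> \<le> M * \<bar>a\<bar>")
    case True
    then have "\<bar>a\<bar> powr (p - 1) * \<bar>c\<bar> \<le> \<bar>a\<bar> powr (p - 1) * (M * \<bar>a\<bar>)"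
      by (intro mult_left_mono) auto
    also have "\<dots> = M * \<bar>a\<bar> powr p"
      using False powr_mult_base[of "\<bar>a\<bar>" "p - 1"] by (simp add: mult_ac)
    finally show ?thesis unfolding eq by (simp add: add_increasing2)
  next
    case c: False
    then have "\<bar>a\<bar> \<le> \<bar>c\<bar> / M" using assms by (simp add: field_simps)
    then have "\<bar>a\<bar> powr (p - 1) * \<bar>c\<bar> \<le> (\<bar>c\<bar> / M) powr (p - 1) * \<bar>c\<bar>"
      using assms by (intro mult_right_mono powr_mono2) auto
    also have "\<dots> = M powr (1 - p) * \<bar>c\<bar> powr p"
      using c False assms powr_mult_base[of "\<bar>c\<bar>" "p - 1"] powr_minus_divide[of M "p - 1"]
      by (simp add: powr_divide mult_ac)
    finally show ?thesis unfolding eq using assms by (simp add: add_increasing)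
  qed
qed (use assms in simp)

context
  fixes p b :: real and u :: "'a::euclidean_space \<Rightarrow> real"
  assumes p: "1 < p" and u_meas[measurable]: "u \<in> borel_measurable borel" and u_fin: "gagliardo p b u < \<infinity>"
begin

lemma gagliardo_integrable:
  assumes [measurable]: "v \<in> borel_measurable borel" and fin: "gagliardo p b v < \<infinity>"
  shows "integrable lborel (\<lambda>z. \<bar>v (fst z) - v (snd z)\<bar> powr p / norm (fst z - snd z) powr b)"
    and "gagliardo p b v = ennreal (\<integral>z. \<bar>v (fst z) - v (snd z)\<bar> powr p / norm (fst z - snd z) powr b \<partial>lborel)"
proof -
  show 1: "integrable lborel (\<lambda>z. \<bar>v (fst z) - v (snd z)\<bar> powr p / norm (fst z - snd z) powr b)"
    using fin by (intro integrableI_nonneg) (auto simp: gagliardo_def)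
  show "gagliardo p b v = ennreal (\<integral>z. \<bar>v (fst z) - v (snd z)\<bar> powr p / norm (fst z - snd z) powr b \<partial>lborel)"
    unfolding gagliardo_def by (rule nn_integral_eq_integral[OF 1]) simp
qed

lemma pform_integrable:
  assumes [measurable]: "v \<in> borel_measurable borel" and fin: "gagliardo p b v < \<infinity>"
  shows "integrable lborel (\<lambda>z. \<bar>u (fst z) - u (snd z)\<bar> powr (p - 2) * (u (fst z) - u (snd z))
    * (v (fst z) - v (snd z)) / norm (fst z - snd z) powr b)"
proof (rule Bochner_Integration.integrable_bound)
  show "integrable lborel (\<lambda>z. \<bar>u (fst z) - u (snd z)\<bar> powr p / norm (fst z - snd z) powr b +
      \<bar>v (fst z) - v (snd z)\<bar> powr p / norm (fst z - snd z) powr b)"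
    by (intro Bochner_Integration.integrable_add gagliardo_integrable assms u_fin u_meas)
  show "AE z in lborel. norm (\<bar>u (fst z) - u (snd z)\<bar> powr (p - 2) * (u (fst z) - u (snd z))
    * (v (fst z) - v (snd z)) / norm (fst z - snd z) powr b) \<le>
    norm (\<bar>u (fst z) - u (snd z)\<bar> powr p / norm (fst z - snd z) powr b +
      \<bar>v (fst z) - v (snd z)\<bar> powr p / norm (fst z - snd z) powr b)"
  proof (intro AE_I2)
    fix z
    show "norm (\<bar>u (fst z) - u (snd z)\<bar> powr (p - 2) * (u (fst z) - u (snd z))
    * (v (fst z) - v (snd z)) / norm (fst z - snd z) powr b) \<le>
    norm (\<bar>u (fst z) - u (snd z)\<bar> powr p / norm (fst z - snd z) powr b +
      \<bar>v (fst z) - v (snd z)\<bar> powr p / norm (fst z - snd z) powr b)"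
      using divide_right_mono[OF young_split[OF p zero_less_one, of "u (fst z) - u (snd z)" "v (fst z) - v (snd z)"],
          of "norm (fst z - snd z) powr b"]
      by (simp add: add_divide_distrib)
  qed
qed measurable

text \<open>Weak lower semicontinuity, from Fatou's lemma for the integrand of the form made nonnegative
  by \<open>young_split\<close>.\<close>

lemma pform_le_of_AE_tendsto:
  assumes v_meas[measurable]: "\<And>k. v k \<in> borel_measurable borel" "w \<in> borel_measurable borel"
    and K: "\<And>k. gagliardo p b (v k) \<le> ennreal K" "0 \<le> K"
    and lim: "AE x in lborel. (\<lambda>k. v k x) \<longlonglongrightarrow> w x"
    and c: "\<And>k. pform p b u (v k) \<le> c k" "c \<longlonglongrightarrow> C"
  shows "gagliardo p b w \<le> ennreal K" and "pform p b u w \<le> C"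
proof -
  have lim2: "AE z in (lborel :: ('a \<times> 'a) measure). (\<lambda>k. v k (fst z)) \<longlonglongrightarrow> w (fst z) \<and> (\<lambda>k. v k (snd z)) \<longlonglongrightarrow> w (snd z)"
    using AE_lborel_prod[OF lim] .
  have pow_lim: "(\<lambda>k. \<bar>v k x - v k y\<bar> powr p) \<longlonglongrightarrow> \<bar>w x - w y\<bar> powr p"
    if "(\<lambda>k. v k x) \<longlonglongrightarrow> w x" "(\<lambda>k. v k y) \<longlonglongrightarrow> w y" for x y
    using p by (intro tendsto_powr' tendsto_intros that) auto
  show gagliardo_w: "gagliardo p b w \<le> ennreal K"
    unfolding gagliardo_def
  proof (rule fatou_le[OF _ _ _ tendsto_const])
    show "AE z in lborel. (\<lambda>k. ennreal (\<bar>v k (fst z) - v k (snd z)\<bar> powr p / norm (fst z - snd z) powr b))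
        \<longlonglongrightarrow> ennreal (\<bar>w (fst z) - w (snd z)\<bar> powr p / norm (fst z - snd z) powr b)"
      using lim2
      by eventually_elim (simp only: divide_inverse, intro tendsto_ennrealI tendsto_mult tendsto_const pow_lim; blast)
    show "(\<integral>\<^sup>+z. ennreal (\<bar>v k (fst z) - v k (snd z)\<bar> powr p / norm (fst z - snd z) powr b) \<partial>lborel) \<le> ennreal K" for k
      using K(1)[of k] by (simp add: gagliardo_def)
  qed measurable
  have fin: "gagliardo p b (v k) < \<infinity>" "gagliardo p b w < \<infinity>" for k
    using K(1)[of k] gagliardo_w by (auto simp: ennreal_less_top intro: le_less_trans)
  define P where "P w = (\<integral>z. \<bar>w (fst z) - w (snd z)\<bar> powr p / norm (fst z - snd z) powr b \<partial>lborel)" for w :: "'a \<Rightarrow> real"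
  have P_nonneg: "0 \<le> P w" for w by (simp add: P_def)
  have P_le: "P (v k) \<le> K" for k
    using K(1)[of k] K(2) unfolding gagliardo_integrable(2)[OF v_meas(1) fin(1)] P_def[symmetric] by simp
  \<comment> \<open>The seminorm of \<open>u\<close> appears on both sides of Fatou's inequality and
    cancels; only the varying term leaves an error, \<open>M powr (1 - p) * K\<close>.\<close>
  have main: "pform p b u w \<le> C + M powr (1 - p) * K" if M: "0 < M" for M
  proof -
    define g where "g w z = (M * \<bar>u (fst z) - u (snd z)\<bar> powr p + M powr (1 - p) * \<bar>w (fst z) - w (snd z)\<bar> powr p
      + \<bar>u (fst z) - u (snd z)\<bar> powr (p - 2) * (u (fst z) - u (snd z)) * (w (fst z) - w (snd z))) / norm (fst z - snd z) powr b"
      for w :: "'a \<Rightarrow> real" and z :: "'a \<times> 'a"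
    have g_nonneg: "0 \<le> g w z" for w z
      unfolding g_def using young_split[OF p M, of "u (fst z) - u (snd z)" "w (fst z) - w (snd z)"]
      by (intro divide_nonneg_nonneg powr_ge_zero) linarith
    have g_split: "g w = (\<lambda>z. M * (\<bar>u (fst z) - u (snd z)\<bar> powr p / norm (fst z - snd z) powr b)
        + M powr (1 - p) * (\<bar>w (fst z) - w (snd z)\<bar> powr p / norm (fst z - snd z) powr b)
        + \<bar>u (fst z) - u (snd z)\<bar> powr (p - 2) * (u (fst z) - u (snd z)) * (w (fst z) - w (snd z)) / norm (fst z - snd z) powr b)"
      for w by (simp add: g_def fun_eq_iff add_divide_distrib)
    have g_int: "integrable lborel (g w)" "integral\<^sup>L lborel (g w) = M * P u + M powr (1 - p) * P w + pform p b u w"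
      if "w \<in> borel_measurable borel" "gagliardo p b w < \<infinity>" for w
    proof -
      have lin: "integrable lborel (\<lambda>z. a * F1 z + c * F2 z + F3 z) \<and>
          (\<integral>z. a * F1 z + c * F2 z + F3 z \<partial>lborel) = a * integral\<^sup>L lborel F1 + c * integral\<^sup>L lborel F2 + integral\<^sup>L lborel F3"
        if "integrable lborel F1" "integrable lborel F2" "integrable lborel F3" for F1 F2 F3 :: "'a \<times> 'a \<Rightarrow> real" and a c
        using that by simp
      note lin = lin[OF gagliardo_integrable(1)[OF u_meas u_fin] gagliardo_integrable(1)[OF that] pform_integrable[OF that], of M "M powr (1 - p)"]
      show "integrable lborel (g w)" "integral\<^sup>L lborel (g w) = M * P u + M powr (1 - p) * P w + pform p b u w"
        unfolding g_split P_def pform_def using lin by blast+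
    qed
    have g_nn: "(\<integral>\<^sup>+z. ennreal (g w z) \<partial>lborel) = ennreal (M * P u + M powr (1 - p) * P w + pform p b u w)"
      if "w \<in> borel_measurable borel" "gagliardo p b w < \<infinity>" for w
      using nn_integral_eq_integral[OF g_int(1)[OF that]] g_nonneg g_int(2)[OF that] by simp
    have g_int_nonneg: "0 \<le> M * P u + M powr (1 - p) * P w + pform p b u w"
      if "w \<in> borel_measurable borel" "gagliardo p b w < \<infinity>" for w
      using integral_nonneg_AE[of "g w" lborel] g_nonneg g_int(2)[OF that] by simp
    have le: "M * P u + M powr (1 - p) * P (v k) + pform p b u (v k) \<le> M * P u + M powr (1 - p) * K + c k" for k
      using M by (intro add_mono mult_left_mono P_le c) auto
    have tends: "(\<lambda>k. M * P u + M powr (1 - p) * K + c k) \<longlonglongrightarrow> M * P u + M powr (1 - p) * K + C"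
      by (intro tendsto_intros c)
    \<comment> \<open>\<open>ennreal\<close> sends negative reals to 0, so the limit bound must be
      nonnegative before the inequality can be read in the reals.\<close>
    have nonneg: "0 \<le> M * P u + M powr (1 - p) * K + C"
      using g_int_nonneg[OF v_meas(1) fin(1)] le
      by (intro LIMSEQ_le_const[OF tends]) (meson order_trans)
    have "(\<integral>\<^sup>+z. ennreal (g w z) \<partial>lborel) \<le> ennreal (M * P u + M powr (1 - p) * K + C)"
    proof (rule fatou_le)
      show "(\<lambda>z. ennreal (g (v k) z)) \<in> borel_measurable lborel" for k unfolding g_def by measurable
      show "AE z in lborel. (\<lambda>k. ennreal (g (v k) z)) \<longlonglongrightarrow> ennreal (g w z)"
        using lim2
        by eventually_elim
          (simp only: g_def divide_inverse, intro tendsto_ennrealI tendsto_mult tendsto_add tendsto_diff tendsto_const pow_lim; blast)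
      show "(\<integral>\<^sup>+z. ennreal (g (v k) z) \<partial>lborel) \<le> ennreal (M * P u + M powr (1 - p) * K + c k)" for k
        unfolding g_nn[OF v_meas(1) fin(1)] by (rule ennreal_leI[OF le])
      show "(\<lambda>k. ennreal (M * P u + M powr (1 - p) * K + c k)) \<longlonglongrightarrow> ennreal (M * P u + M powr (1 - p) * K + C)"
        by (intro tendsto_ennrealI tends)
    qed
    then have "M * P u + M powr (1 - p) * P w + pform p b u w \<le> M * P u + M powr (1 - p) * K + C"
      unfolding g_nn[OF v_meas(2) fin(2)] using nonneg by simp
    then show ?thesis using P_nonneg[of w] by (simp add: add_increasing) (smt (verit) mult_nonneg_nonneg powr_ge_zero)
  qed
  show "pform p b u w \<le> C"
  proof (rule field_le_epsilon)
    fix e :: real assume e: "0 < e"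
    \<comment> \<open>Solves \<open>M powr (1 - p) = e / (K + 1)\<close>; the summand 1 covers
      \<open>K = 0\<close>.\<close>
    define M where "M = (e / (K + 1)) powr (1 / (1 - p))"
    have "0 < M" using e K by (simp add: M_def)
    have "M powr (1 - p) = e / (K + 1)" using e K p by (simp add: M_def powr_powr)
    moreover have "e / (K + 1) * K \<le> e" using e K by (simp add: field_simps)
    ultimately show "pform p b u w \<le> C + e" using main[OF \<open>0 < M\<close>] by simp
  qed
qed

text \<open>Monotonicity gives \<open>F s - F t\<close> the sign of \<open>s - t\<close>, and the
  Lipschitz bound lets \<open>\<bar>s - t\<bar> powr (p - 1)\<close> be replaced by the smaller
  \<open>\<bar>F s - F t\<bar> powr (p - 1)\<close>. This turns testing with a truncation of
  \<open>u\<close> into control of its seminorm.\<close>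

lemma gagliardo_le_pform:
  assumes [measurable]: "F \<in> borel_measurable borel"
    and mono: "\<And>s t. s \<le> t \<Longrightarrow> F s \<le> F t" and lip: "\<And>s t. s \<le> t \<Longrightarrow> F t - F s \<le> t - s"
  shows "gagliardo p b (\<lambda>x. F (u x)) \<le> ennreal (pform p b u (\<lambda>x. F (u x)))"
proof -
  have abs_lip: "\<bar>F s - F t\<bar> \<le> \<bar>s - t\<bar>" for s t
    using mono[of s t] mono[of t s] lip[of s t] lip[of t s] by linarith
  have fin: "gagliardo p b (\<lambda>x. F (u x)) < \<infinity>"
    using gagliardo_mono[of "\<lambda>x. F (u x)" u p b] abs_lip p u_fin by (auto intro: le_less_trans)
  have Fu[measurable]: "(\<lambda>x. F (u x)) \<in> borel_measurable borel" by measurable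
  have pt: "\<bar>F s - F t\<bar> powr p \<le> \<bar>s - t\<bar> powr (p - 2) * (s - t) * (F s - F t)" for s t
  proof (cases "F s = F t")
    case False
    then have ne: "s \<noteq> t" by auto
    have "(s - t) * (F s - F t) = \<bar>s - t\<bar> * \<bar>F s - F t\<bar>"
      using mono[of s t] mono[of t s] by (cases "s \<le> t") (auto simp: abs_if algebra_simps)
    then have "\<bar>s - t\<bar> powr (p - 2) * (s - t) * (F s - F t) = \<bar>s - t\<bar> * \<bar>s - t\<bar> powr (p - 2) * \<bar>F s - F t\<bar>"
      by (simp add: mult_ac)
    also have "\<dots> = \<bar>s - t\<bar> powr (p - 1) * \<bar>F s - F t\<bar>"
      using ne powr_mult_base[of "\<bar>s - t\<bar>" "p - 2"] by simp
    also have "\<dots> \<ge> \<bar>F s - F t\<bar> powr (p - 1) * \<bar>F s - F t\<bar>"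
      using p abs_lip by (intro mult_right_mono powr_mono2) auto
    finally show ?thesis using powr_mult_base[of "\<bar>F s - F t\<bar>" "p - 1"] by (simp add: mult.commute)
  qed (use p in simp)
  show ?thesis
    unfolding gagliardo_integrable(2)[OF Fu fin] pform_def
    by (intro ennreal_leI integral_mono gagliardo_integrable(1) pform_integrable fin divide_right_mono pt Fu) simp
qed

end


section \<open>Admissible test functions\<close>

text \<open>The constant grows exponentially with the number of summands, which is harmless for the
  one fixed finite cover to which it is applied.\<close>

lemma gagliardo_sum_le:
  assumes "finite X" and meas: "\<And>i. i \<in> X \<Longrightarrow> v i \<in> borel_measurable borel" and p: "0 < p"
  shows "gagliardo p b (\<lambda>y. \<Sum>i\<in>X. v i y) \<le> ennreal ((2 powr p) ^ card X) * (\<Sum>i\<in>X. gagliardo p b (v i))"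
  using assms(1) meas
proof induction
  case empty
  then show ?case using p by (simp add: gagliardo_def)
next
  case (insert a X)
  have [measurable]: "v a \<in> borel_measurable borel" "\<And>i. i \<in> X \<Longrightarrow> v i \<in> borel_measurable borel"
    using insert.prems by auto
  have one: "1 \<le> ((2::real) powr p) ^ card X"
    using p by (intro one_le_power ge_one_powr_ge_zero) auto
  have "gagliardo p b (\<lambda>y. v a y + (\<Sum>i\<in>X. v i y)) \<le> ennreal (2 powr p) * (gagliardo p b (v a) + gagliardo p b (\<lambda>y. \<Sum>i\<in>X. v i y))"
    using p by (intro gagliardo_add_le) auto
  also have "\<dots> \<le> ennreal (2 powr p) * (ennreal ((2 powr p) ^ card X) * gagliardo p b (v a) +
      ennreal ((2 powr p) ^ card X) * (\<Sum>i\<in>X. gagliardo p b (v i)))"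
  proof (intro mult_left_mono add_mono)
    show "gagliardo p b (v a) \<le> ennreal ((2 powr p) ^ card X) * gagliardo p b (v a)"
      using mult_right_mono[of 1 "ennreal ((2 powr p) ^ card X)" "gagliardo p b (v a)"] one by simp
    show "gagliardo p b (\<lambda>y. \<Sum>i\<in>X. v i y) \<le> ennreal ((2 powr p) ^ card X) * (\<Sum>i\<in>X. gagliardo p b (v i))"
      using insert.prems by (intro insert.IH) auto
  qed auto
  also have "\<dots> = ennreal ((2 powr p) ^ card (insert a X)) * (\<Sum>i\<in>insert a X. gagliardo p b (v i))"
    using insert.hyps by (simp add: ennreal_mult' distrib_left mult.assoc)
  finally show ?case using insert.hyps by simp
qed

text \<open>By \<open>nn_integral_shift_diff_le\<close> the integral of the \<open>p\<close>-th
  power of the difference is of order \<open>(\<tau> / 2 ^ k) powr (b - DIM('a))\<close>, geometric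
  in \<open>k\<close> because \<open>b\<close> exceeds the dimension.\<close>

lemma AE_shift_tendsto:
  fixes v :: "'a::euclidean_space \<Rightarrow> real" and p b \<tau> :: real
  assumes [measurable]: "v \<in> borel_measurable borel" and p: "0 < p" and b: "DIM('a) < b" and \<tau>: "0 < \<tau>"
    and fin: "gagliardo p b v < \<infinity>" and e: "norm e \<le> 1"
  shows "AE x in lborel. (\<lambda>k. v (x + (\<tau> / 2 ^ k) *\<^sub>R e)) \<longlonglongrightarrow> v x"
proof (cases "e = 0")
  case False
  define A where "A = 2 powr (p + 1) * 2 powr b / unit_ball_vol (DIM('a))"
  define \<theta> where "\<theta> = (1 / 2 :: real) powr (b - DIM('a))"
  have A: "0 \<le> A" by (simp add: A_def)
  have b0: "0 \<le> b" using b of_nat_0_le_iff less_imp_le order_trans by blast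
  show ?thesis
  proof (rule AE_tendsto_of_geometric[where p = p and \<theta> = \<theta> and C = "ennreal (A * \<tau> powr (b - DIM('a))) * gagliardo p b v"])
    show "\<theta> < 1" unfolding \<theta>_def using b powr_less_mono2[of "b - DIM('a)" "1/2" "1::real"] by simp
    show "0 \<le> \<theta>" by (simp add: \<theta>_def)
    show "ennreal (A * \<tau> powr (b - DIM('a))) * gagliardo p b v < \<infinity>"
      using fin by (simp add: ennreal_mult_less_top)
    fix k :: nat
    let ?h = "(\<tau> / 2 ^ k) *\<^sub>R e"
    have "(\<integral>\<^sup>+x. ennreal (\<bar>v (x + ?h) - v x\<bar> powr p) \<partial>lborel) \<le> ennreal (A * norm ?h powr (b - DIM('a))) * gagliardo p b v"
      unfolding A_def using False \<tau> by (intro nn_integral_shift_diff_le p b0) auto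
    also have "\<dots> \<le> ennreal (A * (\<tau> / 2 ^ k) powr (b - DIM('a))) * gagliardo p b v"
      using b e \<tau> A
      by (intro mult_right_mono ennreal_leI mult_left_mono powr_mono2) (auto simp: divide_right_mono mult_left_le)
    also have "(\<tau> / 2 ^ k) powr (b - DIM('a)) = \<tau> powr (b - DIM('a)) * \<theta> ^ k"
      using \<tau> by (simp add: \<theta>_def powr_divide power_divide power_powr)
    finally show "(\<integral>\<^sup>+x. ennreal (\<bar>v (x + ?h) - v x\<bar> powr p) \<partial>lborel) \<le>
        ennreal (\<theta> ^ k) * (ennreal (A * \<tau> powr (b - DIM('a))) * gagliardo p b v)"
      using A by (simp add: ennreal_mult'[symmetric] mult.assoc[symmetric] \<theta>_def) (simp add: mult_ac)
  qed (use p in \<open>auto intro: measurable_compose\<close>)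
qed simp

lemma AE_conv_tendsto:
  fixes v :: "'a::euclidean_space \<Rightarrow> real" and p b d :: real
  assumes [measurable]: "v \<in> borel_measurable borel" and v: "\<And>x. \<bar>v x\<bar> \<le> T"
    and p: "1 < p" and b: "DIM('a) < b" and d: "0 < d"
    and fin: "gagliardo p b v < \<infinity>" and \<rho>: "\<And>k. mollifier (\<rho> k) (d / 2 ^ k)"
  shows "AE x in lborel. (\<lambda>k. conv (\<rho> k) v x) \<longlonglongrightarrow> v x"
proof -
  define A where "A = 2 powr (p + 1) * 2 powr b / unit_ball_vol (DIM('a))"
  define \<theta> where "\<theta> = (1 / 2 :: real) powr (b - DIM('a))"
  have A: "0 \<le> A" by (simp add: A_def)
  show ?thesis
  proof (rule AE_tendsto_of_geometric[where p = p and \<theta> = \<theta> and C = "ennreal (A * d powr (b - DIM('a))) * gagliardo p b v"])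
    show "\<theta> < 1" unfolding \<theta>_def using b powr_less_mono2[of "b - DIM('a)" "1/2" "1::real"] by simp
    show "0 \<le> \<theta>" by (simp add: \<theta>_def)
    show "ennreal (A * d powr (b - DIM('a))) * gagliardo p b v < \<infinity>"
      using fin by (simp add: ennreal_mult_less_top)
    fix k :: nat
    have "(\<integral>\<^sup>+x. ennreal (\<bar>conv (\<rho> k) v x - v x\<bar> powr p) \<partial>lborel) \<le> ennreal (A * (d / 2 ^ k) powr (b - DIM('a))) * gagliardo p b v"
      unfolding A_def by (rule mollifier.nn_integral_conv_diff_le[OF \<rho> p _ assms(1) v]) (use b in simp)
    also have "(d / 2 ^ k) powr (b - DIM('a)) = d powr (b - DIM('a)) * \<theta> ^ k"
      using d by (simp add: \<theta>_def powr_divide power_divide power_powr)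
    finally show "(\<integral>\<^sup>+x. ennreal (\<bar>conv (\<rho> k) v x - v x\<bar> powr p) \<partial>lborel) \<le>
        ennreal (\<theta> ^ k) * (ennreal (A * d powr (b - DIM('a))) * gagliardo p b v)"
      using A by (simp add: ennreal_mult'[symmetric] mult.assoc[symmetric] \<theta>_def) (simp add: mult_ac)
    show "conv (\<rho> k) v \<in> borel_measurable lborel"
      using mollifier.conv_measurable[OF \<rho> assms(1)] by simp
  qed (use p in auto)
qed

lemma integrable_bounded_compact_support:
  fixes v :: "'a::euclidean_space \<Rightarrow> real"
  assumes [measurable]: "v \<in> borel_measurable borel" and "\<And>x. \<bar>v x\<bar> \<le> T" and "\<And>x. x \<notin> K \<Longrightarrow> v x = 0" and "compact K"
  shows "integrable lborel v"
proof (rule Bochner_Integration.integrable_bound)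
  show "integrable lborel (\<lambda>x. indicator K x *\<^sub>R T)"
    using assms(4) by (intro borel_integrable_compact) auto
  show "AE x in lborel. norm (v x) \<le> norm (indicator K x *\<^sub>R T)"
    using assms(2,3) by (intro AE_I2) (auto simp: indicator_def intro: order_trans[OF _ abs_ge_self])
qed simp

lemma smooth_mollifier_exists:
  assumes "0 < d"
  obtains \<rho> :: "real^'n \<Rightarrow> real" where "smooth_fun \<rho>" "mollifier \<rho> d"
proof -
  obtain \<rho> :: "real^'n \<Rightarrow> real" where \<rho>: "smooth_fun \<rho>" "\<And>x. 0 \<le> \<rho> x" "\<And>x. d < norm x \<Longrightarrow> \<rho> x = 0"
    "integrable lborel \<rho>" "integral\<^sup>L lborel \<rho> = 1"
    using mollifier_exists[OF assms] by metis
  then have "mollifier \<rho> d"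
    using smooth_fun_continuous[OF \<rho>(1)] by unfold_locales (auto intro: borel_measurable_continuous_onI)
  with \<rho>(1) show ?thesis by (rule that)
qed

section \<open>Compact neighbourhoods, test functions and the boundary\<close>

text \<open>Written as a Minkowski sum with a closed ball, so that compactness is that of a sum of
  compact sets.\<close>

definition thicken :: "'a::euclidean_space set \<Rightarrow> real \<Rightarrow> 'a set" where
  "thicken K d = {x + y |x y. x \<in> K \<and> y \<in> cball 0 d}"

lemma compact_thicken: "compact K \<Longrightarrow> compact (thicken K d)"
  unfolding thicken_def by (intro compact_sums) auto

lemma in_thicken: "x \<in> thicken K d" if "x - z \<in> K" "norm z \<le> d"
  unfolding thicken_def using that by (force intro: exI[of _ "x - z"] exI[of _ z])

lemma thicken_thicken: "thicken (thicken K c) d \<subseteq> thicken K (c + d)"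
proof
  fix x assume "x \<in> thicken (thicken K c) d"
  then obtain a y z where "x = (a + y) + z" "a \<in> K" "norm y \<le> c" "norm z \<le> d"
    unfolding thicken_def by auto
  then show "x \<in> thicken K (c + d)"
    using norm_triangle_le[of y z "c + d"] by (intro in_thicken[of _ "y + z"]) auto
qed

lemma thicken_mono: "c \<le> d \<Longrightarrow> thicken K c \<subseteq> thicken K d"
  unfolding thicken_def by force

lemma thicken_subset_open:
  fixes K :: "'a::euclidean_space set"
  assumes "compact K" "open S" "K \<subseteq> S"
  obtains d where "0 < d" "thicken K d \<subseteq> S"
proof -
  obtain d where d: "0 < d" "(\<Union>x\<in>K. cball x d) \<subseteq> S"
    using compact_subset_open_imp_cball_epsilon_subset[OF assms] by blast
  have "thicken K d \<subseteq> S"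
  proof
    fix z assume "z \<in> thicken K d"
    then obtain x y where "z = x + y" "x \<in> K" "norm y \<le> d" unfolding thicken_def by auto
    then have "z \<in> cball x d" by (simp add: dist_norm)
    with d(2) \<open>x \<in> K\<close> show "z \<in> S" by blast
  qed
  with d(1) show ?thesis by (rule that)
qed

lemma test_fun_conv:
  fixes v \<rho> :: "real^'n \<Rightarrow> real"
  assumes \<rho>: "smooth_fun \<rho>" "mollifier \<rho> d" and [measurable]: "v \<in> borel_measurable borel"
    and v: "\<And>x. \<bar>v x\<bar> \<le> T" "\<And>x. x \<notin> K \<Longrightarrow> v x = 0" and K: "compact K" "thicken K d \<subseteq> \<Omega>"
  shows "test_fun \<Omega> (conv \<rho> v)" and "\<And>x. x \<notin> thicken K d \<Longrightarrow> conv \<rho> v x = 0"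
proof -
  interpret mollifier \<rho> d by fact
  show zero: "conv \<rho> v x = 0" if "x \<notin> thicken K d" for x
  proof -
    have "v (x - z) = 0" if "norm z \<le> d" for z
      using in_thicken[of x z K d] that v(2) \<open>x \<notin> thicken K d\<close> by blast
    then have "conv \<rho> v x \<le> 0" "0 \<le> conv \<rho> v x"
      by (intro conv_le[OF _ v(1)] conv_ge[OF _ v(1)]; simp)+
    then show ?thesis by simp
  qed
  have "closure {x. conv \<rho> v x \<noteq> 0} \<subseteq> thicken K d"
    using zero by (intro closure_minimal compact_imp_closed compact_thicken K) auto
  moreover from this have "bounded {x. conv \<rho> v x \<noteq> 0}"
    using compact_imp_bounded[OF compact_thicken[OF K(1), of d]] bounded_subset closure_subset by metis
  moreover have "smooth_fun (conv \<rho> v)"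
    by (rule smooth_fun_conv[OF \<rho>(1) \<rho>_supp integrable_bounded_compact_support[OF _ v K(1)]]) auto
  ultimately show "test_fun \<Omega> (conv \<rho> v)" using K(2) by (auto simp: test_fun_def compact_closure)
qed

text \<open>Near a boundary point the closure satisfies
  \<open>\<gamma> x \<le> x \<bullet> e\<close> by continuity; moving by \<open>t\<close> along
  \<open>e\<close> raises the right side by \<open>t\<close> and leaves \<open>\<gamma>\<close>
  unchanged, so the inequality becomes strict. At interior points the zero vector serves as
  direction, hence \<open>norm e \<le> 1\<close>.\<close>

lemma smooth_domain_inward_shift:
  fixes \<Omega> :: "(real^'n) set"
  assumes \<Omega>: "bounded_smooth_domain \<Omega>" and x0: "x0 \<in> closure \<Omega>"
  obtains r e where "0 < r" "norm e \<le> 1" "\<And>t x. 0 < t \<Longrightarrow> t < r \<Longrightarrow> x \<in> closure \<Omega> \<inter> cball x0 r \<Longrightarrow> x + t *\<^sub>R e \<in> \<Omega>"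
proof (cases "x0 \<in> \<Omega>")
  case True
  moreover have "open \<Omega>" using \<Omega> by (simp add: bounded_smooth_domain_def)
  ultimately obtain r where "0 < r" "cball x0 r \<subseteq> \<Omega>" using open_contains_cball by blast
  then show ?thesis by (intro that[of r 0]) auto
next
  case False
  then have "x0 \<in> frontier \<Omega>"
    using x0 \<Omega> by (auto simp: frontier_def bounded_smooth_domain_def interior_open)
  then obtain r e \<gamma> where r: "0 < r" and e: "norm e = 1" and \<gamma>: "smooth_fun \<gamma>" "\<And>x t. \<gamma> (x + t *\<^sub>R e) = \<gamma> x"
    and graph: "\<Omega> \<inter> ball x0 r = {x \<in> ball x0 r. x \<bullet> e > \<gamma> x}"
  proof -
    have "\<exists>r>0. \<exists>e \<gamma>. norm e = 1 \<and> smooth_fun \<gamma> \<and> (\<forall>x t. \<gamma> (x + t *\<^sub>R e) = \<gamma> x) \<and>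
        \<Omega> \<inter> ball x0 r = {x \<in> ball x0 r. x \<bullet> e > \<gamma> x}"
      using \<Omega> \<open>x0 \<in> frontier \<Omega>\<close> unfolding bounded_smooth_domain_def smooth_boundary_def by blast
    then show ?thesis by (elim exE conjE) (rule that; simp)
  qed
  show ?thesis
  \<comment> \<open>With \<open>r / 3\<close>, a point of the small ball and its shift by less than
    \<open>r / 3\<close> both stay in \<open>ball x0 r\<close>, where the graph describes
    \<open>\<Omega>\<close>.\<close>
  proof (rule that[of "r / 3" e])
    fix t x assume t: "0 < t" "t < r / 3" and x: "x \<in> closure \<Omega> \<inter> cball x0 (r / 3)"
    have "x \<in> closure (\<Omega> \<inter> ball x0 r)"
      using x r open_Int_closure_subset[OF open_ball, of x0 r \<Omega>] by (auto simp: Int_commute)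
    also have "\<dots> \<subseteq> {x. \<gamma> x \<le> x \<bullet> e}"
      unfolding graph
      by (intro closure_minimal closed_Collect_le continuous_intros smooth_fun_continuous \<gamma>) auto
    finally have "\<gamma> x \<le> x \<bullet> e" by simp
    moreover have "(x + t *\<^sub>R e) \<bullet> e = x \<bullet> e + t"
      using e by (simp add: inner_add_left dot_square_norm)
    ultimately have "\<gamma> (x + t *\<^sub>R e) < (x + t *\<^sub>R e) \<bullet> e" using t by (simp add: \<gamma>)
    moreover have "x + t *\<^sub>R e \<in> ball x0 r"
    proof -
      have "dist x0 (x + t *\<^sub>R e) \<le> dist x0 x + dist x (x + t *\<^sub>R e)" by (rule dist_triangle)
      also have "\<dots> < r" using x t e r by (simp add: dist_norm)
      finally show ?thesis by simp
    qed
    ultimately show "x + t *\<^sub>R e \<in> \<Omega>" using graph by blast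
  qed (use r e in auto)
qed


section \<open>From smooth test functions to truncations of the solution\<close>

text \<open>\<open>f\<close> stands for the right-hand side extended by 0. Its integrability is
  assumed only against test functions, so it may fail up to the boundary.\<close>

locale weak_equation =
  fixes \<Omega> :: "(real^'n) set" and p b :: real and u f :: "real^'n \<Rightarrow> real"
  assumes open_domain: "open \<Omega>" and p: "1 < p" and b: "CARD('n) < b" "b - p < CARD('n)"
    and u_meas[measurable]: "u \<in> borel_measurable borel" and u_fin: "gagliardo p b u < \<infinity>"
    and f_meas[measurable]: "f \<in> borel_measurable borel" and f_nonneg: "\<And>x. 0 \<le> f x"
    and f_integrable_test: "\<And>\<psi>. test_fun \<Omega> \<psi> \<Longrightarrow> integrable lborel (\<lambda>x. f x * \<psi> x)"
    and weak_test: "\<And>\<psi>. test_fun \<Omega> \<psi> \<Longrightarrow> pform p b u \<psi> = (\<integral>x. f x * \<psi> x \<partial>lborel)"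
begin

text \<open>Mollification keeps the seminorm bounded and converges almost everywhere, so
  semicontinuity handles the form. For the right-hand side, a test function \<open>\<eta>\<close>
  that is at least 1 near \<open>K\<close> supplies the integrable majorant
  \<open>T * (f x * \<eta> x)\<close>.\<close>

lemma pform_le_compact_support:
  assumes v_meas[measurable]: "v \<in> borel_measurable borel" and v: "\<And>x. 0 \<le> v x" "\<And>x. v x \<le> T"
    and K: "\<And>x. x \<notin> K \<Longrightarrow> v x = 0" "compact K" "K \<subseteq> \<Omega>" and fin: "gagliardo p b v < \<infinity>"
  shows "integrable lborel (\<lambda>x. f x * v x)" and "pform p b u v \<le> (\<integral>x. f x * v x \<partial>lborel)"
proof -
  have v_abs: "\<bar>v x\<bar> \<le> T" for x using v[of x] by simp
  have T: "0 \<le> T" using v[of 0] by linarith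
  obtain e where e: "0 < e" "thicken K e \<subseteq> \<Omega>"
    using thicken_subset_open[OF K(2) open_domain K(3)] .
  \<comment> \<open>Room for three layers: the mollified \<open>v\<close> lives within
    \<open>d\<close> of \<open>K\<close>, the indicator under \<open>\<eta>\<close> within
    \<open>2 * d\<close>, and its mollification within \<open>3 * d\<close>.\<close>
  define d where "d = e / 3"
  have d: "0 < d" using e by (simp add: d_def)
  have th: "thicken K d \<subseteq> \<Omega>" "thicken (thicken K (2 * d)) d \<subseteq> \<Omega>"
    using e thicken_mono[of d e K] thicken_thicken[of K "2 * d" d] by (auto simp: d_def)
  obtain \<rho>0 :: "real^'n \<Rightarrow> real" where \<rho>0: "smooth_fun \<rho>0" "mollifier \<rho>0 d"
    using smooth_mollifier_exists[OF d] .
  define J where "J = (indicator (thicken K (2 * d)) :: real^'n \<Rightarrow> real)"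
  have J_meas[measurable]: "J \<in> borel_measurable borel"
    unfolding J_def using compact_thicken[OF K(2)] by (intro borel_measurable_indicator borel_compact)
  have J_abs: "\<bar>J x\<bar> \<le> 1" for x by (simp add: J_def indicator_def)
  have J_zero: "J x = 0" if "x \<notin> thicken K (2 * d)" for x using that by (simp add: J_def)
  have J_nonneg: "0 \<le> J x" for x by (simp add: J_def)
  have K2: "compact (thicken K (2 * d))" by (rule compact_thicken[OF K(2)])
  define \<eta> where "\<eta> = conv \<rho>0 J"
  have \<eta>_test: "test_fun \<Omega> \<eta>"
    unfolding \<eta>_def
    by (rule test_fun_conv(1)[OF \<rho>0 J_meas J_abs J_zero K2 th(2)])
  have \<eta>_nonneg: "0 \<le> \<eta> x" for x
    unfolding \<eta>_def by (rule mollifier.conv_nonneg[OF \<rho>0(2) J_nonneg])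
  have \<eta>_one: "1 \<le> \<eta> x" if x: "x \<in> thicken K d" for x
    unfolding \<eta>_def
  proof (rule mollifier.conv_ge[OF \<rho>0(2) J_meas J_abs])
    fix z :: "real^'n" assume z: "norm z \<le> d"
    have "x - z \<in> thicken (thicken K d) d"
      by (rule in_thicken[of _ "- z"]) (use x z in auto)
    then have "x - z \<in> thicken K (2 * d)" using thicken_thicken[of K d d] by auto
    then show "1 \<le> J (x - z)" by (simp add: J_def)
  qed
  have dom_int: "integrable lborel (\<lambda>x. T * (f x * \<eta> x))"
    using f_integrable_test[OF \<eta>_test] by simp
  have K_sub: "K \<subseteq> thicken K d"
  proof
    show "x \<in> thicken K d" if "x \<in> K" for x
      by (rule in_thicken[of _ 0]) (use d that in auto)
  qed
  have dom: "\<bar>f x * g x\<bar> \<le> T * (f x * \<eta> x)" if "0 \<le> g x" "g x \<le> T" "x \<notin> thicken K d \<Longrightarrow> g x = 0" for g x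
  proof (cases "x \<in> thicken K d")
    case True
    then have "f x * g x \<le> f x * (T * \<eta> x)"
      using that T \<eta>_one[OF True] f_nonneg[of x] mult_left_mono[of 1 "\<eta> x" T]
      by (intro mult_left_mono) auto
    then show ?thesis using that f_nonneg[of x] by (simp add: mult_ac)
  qed (use that T f_nonneg[of x] \<eta>_nonneg[of x] in auto)
  show "integrable lborel (\<lambda>x. f x * v x)"
  proof (rule Bochner_Integration.integrable_bound[OF dom_int])
    show "AE x in lborel. norm (f x * v x) \<le> norm (T * (f x * \<eta> x))"
    proof (intro AE_I2)
      fix x
      have "x \<notin> thicken K d \<Longrightarrow> v x = 0" using K(1) K_sub by blast
      from dom[of v, OF v this] show "norm (f x * v x) \<le> norm (T * (f x * \<eta> x))" by simp
    qed
  qed measurable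
  have "\<exists>\<rho> :: real^'n \<Rightarrow> real. smooth_fun \<rho> \<and> mollifier \<rho> (d / 2 ^ k)" for k :: nat
  proof -
    have "0 < d / 2 ^ k" using d by simp
    from smooth_mollifier_exists[OF this] show ?thesis by blast
  qed
  then obtain \<rho> :: "nat \<Rightarrow> real^'n \<Rightarrow> real" where \<rho>: "\<And>k. smooth_fun (\<rho> k)" "\<And>k. mollifier (\<rho> k) (d / 2 ^ k)"
    by metis
  define \<psi> where "\<psi> k = conv (\<rho> k) v" for k
  have dk: "d / 2 ^ k \<le> d" for k :: nat using d by (simp add: field_simps)
  have th_k: "thicken K (d / 2 ^ k) \<subseteq> thicken K d" for k :: nat by (rule thicken_mono[OF dk])
  have \<psi>_test: "test_fun \<Omega> (\<psi> k)" for k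
    unfolding \<psi>_def by (rule test_fun_conv(1)[OF \<rho>(1) \<rho>(2) v_meas v_abs K(1) K(2)]) (use th(1) th_k in auto)
  have \<psi>_supp: "\<psi> k x = 0" if "x \<notin> thicken K d" for k x
    unfolding \<psi>_def
    by (rule test_fun_conv(2)[OF \<rho>(1) \<rho>(2) v_meas v_abs K(1) K(2)]) (use th(1) th_k that in auto)
  have \<psi>_meas[measurable]: "\<psi> k \<in> borel_measurable borel" for k
    unfolding \<psi>_def by (rule mollifier.conv_measurable[OF \<rho>(2) v_meas])
  have \<psi>_bounds: "0 \<le> \<psi> k x" "\<psi> k x \<le> T" for k x
    unfolding \<psi>_def
    by (rule mollifier.conv_nonneg[OF \<rho>(2) v(1)], rule mollifier.conv_le[OF \<rho>(2) v_meas v_abs v(2)])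
  have lim: "AE x in lborel. (\<lambda>k. \<psi> k x) \<longlonglongrightarrow> v x"
    unfolding \<psi>_def by (rule AE_conv_tendsto[OF v_meas v_abs p _ d fin \<rho>(2)]) (use b in simp)
  show "pform p b u v \<le> (\<integral>x. f x * v x \<partial>lborel)"
  proof (rule pform_le_of_AE_tendsto(2)[OF p u_meas u_fin \<psi>_meas v_meas _ _ lim])
    show "gagliardo p b (\<psi> k) \<le> ennreal (enn2real (gagliardo p b v))" for k
      unfolding \<psi>_def using mollifier.gagliardo_conv_le[OF \<rho>(2) p v_meas v_abs] fin by simp
    show "pform p b u (\<psi> k) \<le> (\<integral>x. f x * \<psi> k x \<partial>lborel)" for k
      using weak_test[OF \<psi>_test] by simp
    show "(\<lambda>k. \<integral>x. f x * \<psi> k x \<partial>lborel) \<longlonglongrightarrow> (\<integral>x. f x * v x \<partial>lborel)"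
    proof (rule integral_dominated_convergence[OF _ _ dom_int])
      show "AE x in lborel. (\<lambda>k. f x * \<psi> k x) \<longlonglongrightarrow> f x * v x"
        using lim by eventually_elim (intro tendsto_intros)
      show "AE x in lborel. norm (f x * \<psi> k x) \<le> T * (f x * \<eta> x)" for k
        using dom[of "\<psi> k"] \<psi>_bounds \<psi>_supp by (intro AE_I2) auto
    qed measurable
  qed simp
qed

text \<open>Approximates \<open>w\<close> from below by the minimum of \<open>w\<close> and finitely many localised pieces of
  \<open>w\<close>, each pushed into \<open>\<Omega>\<close>; the cutoffs only have to add up to at least \<open>1\<close> because of the minimum.\<close>

lemma pform_le_of_inward_shift:
  assumes bdd: "bounded \<Omega>"
    and shift: "\<And>x0. x0 \<in> closure \<Omega> \<Longrightarrow> \<exists>r e. 0 < r \<and> norm e \<le> 1 \<and>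
      (\<forall>t x. 0 < t \<longrightarrow> t < r \<longrightarrow> x \<in> closure \<Omega> \<inter> cball x0 r \<longrightarrow> x + t *\<^sub>R e \<in> \<Omega>)"
    and w_meas[measurable]: "w \<in> borel_measurable borel" and w: "\<And>x. 0 \<le> w x" "\<And>x. w x \<le> T" "\<And>x. x \<notin> \<Omega> \<Longrightarrow> w x = 0"
    and fin: "gagliardo p b w < \<infinity>" and int: "integrable lborel (\<lambda>x. f x * w x)"
  shows "pform p b u w \<le> (\<integral>x. f x * w x \<partial>lborel)"
proof -
  obtain r :: "real^'n \<Rightarrow> real" and e :: "real^'n \<Rightarrow> real^'n" where r: "\<And>x. x \<in> closure \<Omega> \<Longrightarrow> 0 < r x"
    and e: "\<And>x. x \<in> closure \<Omega> \<Longrightarrow> norm (e x) \<le> 1"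
    and inward: "\<And>x t y. x \<in> closure \<Omega> \<Longrightarrow> 0 < t \<Longrightarrow> t < r x \<Longrightarrow> y \<in> closure \<Omega> \<inter> cball x (r x) \<Longrightarrow> y + t *\<^sub>R e x \<in> \<Omega>"
    using shift by metis
  have cpt: "compact (closure \<Omega>)" using bdd by (simp add: compact_closure)
  obtain X where X: "finite X" "X \<subseteq> closure \<Omega>" "closure \<Omega> \<subseteq> (\<Union>x\<in>X. ball x (r x / 2))"
  proof (rule compactE_image[OF cpt, of "closure \<Omega>" "\<lambda>x. ball x (r x / 2)"])
    show "closure \<Omega> \<subseteq> (\<Union>x\<in>closure \<Omega>. ball x (r x / 2))" using r by force
  qed auto
  \<comment> \<open>Half the smallest radius, so that every shift \<open>\<tau> / 2 ^ k\<close> is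
    admissible for all pieces at once; the inserted 1 keeps \<open>Min\<close> meaningful for an
    empty \<open>X\<close>.\<close>
  define \<tau> where "\<tau> = Min (insert 1 (r ` X)) / 2"
  have "0 < Min (insert 1 (r ` X))" using X r by (subst Min_gr_iff) auto
  then have \<tau>: "0 < \<tau>" by (simp add: \<tau>_def)
  have \<tau>_less: "\<tau> / 2 ^ k < r x" if "x \<in> X" for x and k :: nat
  proof -
    have "\<tau> / 2 ^ k \<le> \<tau>" using \<tau> by (simp add: field_simps)
    also have "\<tau> < Min (insert 1 (r ` X))" using \<tau> by (simp add: \<tau>_def)
    also have "\<dots> \<le> r x" using X that by (intro Min_le) auto
    finally show ?thesis .
  qed
  \<comment> \<open>A plateau of slope \<open>2 / r x\<close>: 1 on the half-radius ball, 0 outside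
    the full one. The half-radius balls are the ones that cover the closure.\<close>
  define \<zeta> where "\<zeta> x y = max 0 (min 1 (2 - 2 * dist x y / r x))" for x y
  have \<zeta>_meas[measurable]: "\<zeta> x \<in> borel_measurable borel" for x
    unfolding \<zeta>_def by measurable
  have \<zeta>_one: "\<zeta> x y = 1" if "x \<in> X" "y \<in> ball x (r x / 2)" for x y
    using that r[of x] X(2) by (auto simp: \<zeta>_def field_simps max_def min_def)
  have \<zeta>_zero: "\<zeta> x y = 0" if "x \<in> X" "y \<notin> cball x (r x)" for x y
    using that r[of x] X(2) by (auto simp: \<zeta>_def field_simps max_def min_def)
  have \<zeta>_nonneg: "0 \<le> \<zeta> x y" and \<zeta>_le: "\<zeta> x y \<le> 1" for x y by (auto simp: \<zeta>_def)
  have \<zeta>_lip: "\<bar>\<zeta> x y - \<zeta> x z\<bar> \<le> 2 / r x * norm (y - z)" if "x \<in> X" for x y z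
  proof -
    have "\<bar>\<zeta> x y - \<zeta> x z\<bar> \<le> \<bar>2 * dist x y / r x - 2 * dist x z / r x\<bar>"
      unfolding \<zeta>_def by linarith
    also have "\<dots> = 2 / r x * \<bar>dist x y - dist x z\<bar>"
    proof -
      have "2 * dist x y / r x - 2 * dist x z / r x = 2 / r x * (dist x y - dist x z)"
        by (simp add: diff_divide_distrib right_diff_distrib)
      moreover have "0 < r x" using r[of x] that X(2) by auto
      ultimately show ?thesis by (simp only: abs_mult) simp
    qed
    also have "\<dots> \<le> 2 / r x * norm (y - z)"
    proof (rule mult_left_mono)
      show "\<bar>dist x y - dist x z\<bar> \<le> norm (y - z)"
        unfolding dist_norm[of y z, symmetric]
        using dist_triangle[of x z y] dist_triangle[of x y z] dist_commute[of z y] by linarith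
      show "0 \<le> 2 / r x" using r[of x] that X(2) by auto
    qed
    finally show ?thesis .
  qed
  obtain R where R: "0 < R" "\<And>x. x \<in> \<Omega> \<Longrightarrow> norm x \<le> R"
    using bdd by (auto simp: bounded_pos)
  define g where "g x y = \<zeta> x y * w y" for x y
  have g_meas[measurable]: "g x \<in> borel_measurable borel" for x unfolding g_def by measurable
  have g_fin: "gagliardo p b (g x) < \<infinity>" if "x \<in> X" for x
    unfolding g_def
  proof (rule gagliardo_cutoff_finite[OF w_meas \<zeta>_meas, where T = T and R = R and L = "2 / r x"])
    show "\<bar>w y\<bar> \<le> T" for y using w(1,2)[of y] by simp
    show "w y = 0" if "R < norm y" for y using w(3) R(2) that by force
  qed (use R \<zeta>_nonneg \<zeta>_le \<zeta>_lip[OF that] p b fin in auto)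
  \<comment> \<open>The argument moves against \<open>e x\<close>, so the support moves along it,
    into \<open>\<Omega>\<close>.\<close>
  define gs where "gs k x y = g x (y + (\<tau> / 2 ^ k) *\<^sub>R (- e x))" for k x y
  have gs_meas[measurable]: "gs k x \<in> borel_measurable borel" for k x unfolding gs_def by measurable
  have gs_nonneg: "0 \<le> gs k x y" for k x y unfolding gs_def g_def by (intro mult_nonneg_nonneg \<zeta>_nonneg w)
  have gs_gagliardo: "gagliardo p b (gs k x) = gagliardo p b (g x)" for k x
    unfolding gs_def by (rule gagliardo_shift) measurable
  define Ks where "Ks k x = (\<lambda>y. y + (\<tau> / 2 ^ k) *\<^sub>R e x) ` (closure \<Omega> \<inter> cball x (r x))" for k x
  have Ks_compact: "compact (Ks k x)" for k x
    unfolding Ks_def using cpt by (intro compact_continuous_image continuous_intros) auto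
  have Ks_sub: "Ks k x \<subseteq> \<Omega>" if "x \<in> X" for k x
    unfolding Ks_def using inward[of x "\<tau> / 2 ^ k"] that X(2) \<tau> \<tau>_less by auto
  have gs_supp: "gs k x y = 0" if "x \<in> X" "y \<notin> Ks k x" for k x y
  proof (rule ccontr)
    let ?y = "y - (\<tau> / 2 ^ k) *\<^sub>R e x"
    assume "gs k x y \<noteq> 0"
    then have "\<zeta> x ?y \<noteq> 0" "w ?y \<noteq> 0" by (auto simp: gs_def g_def)
    then have "?y \<in> closure \<Omega> \<inter> cball x (r x)"
      using \<zeta>_zero[of x ?y] that(1) w(3)[of ?y] closure_subset[of \<Omega>] by blast
    then have "y \<in> Ks k x" unfolding Ks_def by (rule rev_image_eqI) simp
    with that(2) show False ..
  qed
  \<comment> \<open>The bound by \<open>w\<close> puts \<open>f * \<phi> k\<close> below the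
    integrable \<open>f * w\<close>; the shifted pieces alone have no such bound uniform in
    \<open>k\<close>.\<close>
  define \<phi> where "\<phi> k y = min (\<Sum>x\<in>X. gs k x y) (w y)" for k y
  have \<phi>_meas[measurable]: "\<phi> k \<in> borel_measurable borel" for k unfolding \<phi>_def by measurable
  have \<phi>_nonneg: "0 \<le> \<phi> k y" and \<phi>_le: "\<phi> k y \<le> w y" for k y
    using w(1)[of y] by (auto simp: \<phi>_def intro!: sum_nonneg gs_nonneg)
  define M where "M = ennreal ((2 powr p) ^ card X) * (\<Sum>x\<in>X. gagliardo p b (g x)) + gagliardo p b w"
  have M_fin: "M < \<infinity>"
  proof -
    have "(\<Sum>x\<in>X. gagliardo p b (g x)) < \<infinity>" using g_fin X(1) by simp
    then show ?thesis unfolding M_def using fin by (simp add: ennreal_mult_less_top)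
  qed
  have \<phi>_gagliardo: "gagliardo p b (\<phi> k) \<le> M" for k
  proof -
    have "gagliardo p b (\<phi> k) \<le> gagliardo p b (\<lambda>y. \<Sum>x\<in>X. gs k x y) + gagliardo p b w"
      unfolding \<phi>_def using p by (intro gagliardo_min_le) auto
    also have "\<dots> \<le> ennreal ((2 powr p) ^ card X) * (\<Sum>x\<in>X. gagliardo p b (gs k x)) + gagliardo p b w"
      using p by (intro add_right_mono gagliardo_sum_le X(1)) auto
    finally show ?thesis by (simp add: M_def gs_gagliardo)
  qed
  have bound: "pform p b u (\<phi> k) \<le> (\<integral>x. f x * w x \<partial>lborel)" for k
  proof -
    have \<phi>_supp: "\<phi> k y = 0" if "y \<notin> (\<Union>x\<in>X. Ks k x)" for y
      using that gs_supp w(1)[of y] by (simp add: \<phi>_def min_def)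
    have "compact (\<Union>x\<in>X. Ks k x)" "(\<Union>x\<in>X. Ks k x) \<subseteq> \<Omega>" "gagliardo p b (\<phi> k) < \<infinity>"
      using X(1) Ks_compact Ks_sub le_less_trans[OF \<phi>_gagliardo M_fin] by blast+
    note 1 = pform_le_compact_support[OF \<phi>_meas \<phi>_nonneg order_trans[OF \<phi>_le w(2)] \<phi>_supp this]
    note 1(2)
    also have "(\<integral>x. f x * \<phi> k x \<partial>lborel) \<le> (\<integral>x. f x * w x \<partial>lborel)"
      by (intro integral_mono 1 int mult_left_mono \<phi>_le f_nonneg)
    finally show ?thesis .
  qed
  have lim: "AE y in lborel. (\<lambda>k. \<phi> k y) \<longlonglongrightarrow> w y"
  proof -
    have "AE y in lborel. (\<lambda>k. gs k x y) \<longlonglongrightarrow> g x y" if "x \<in> X" for x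
      unfolding gs_def
      by (rule AE_shift_tendsto[of _ p b]) (use p b \<tau> e[of x] X(2) that g_fin[OF that] in auto)
    then have "AE y in lborel. \<forall>x\<in>X. (\<lambda>k. gs k x y) \<longlonglongrightarrow> g x y"
      using X(1) by (intro AE_finite_allI)
    then show ?thesis
    proof eventually_elim
      fix y assume gsy: "\<forall>x\<in>X. (\<lambda>k. gs k x y) \<longlonglongrightarrow> g x y"
      have "(\<lambda>k. \<phi> k y) \<longlonglongrightarrow> min (\<Sum>x\<in>X. g x y) (w y)"
        unfolding \<phi>_def using gsy by (intro tendsto_min tendsto_sum tendsto_const) auto
      moreover have "w y \<le> (\<Sum>x\<in>X. g x y)"
      proof (cases "y \<in> \<Omega>")
        case True
        then obtain x where x: "x \<in> X" "y \<in> ball x (r x / 2)"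
          using X(3) closure_subset[of \<Omega>] by blast
        then have "w y = g x y" by (simp add: g_def \<zeta>_one)
        also have "\<dots> \<le> (\<Sum>x\<in>X. g x y)"
          using x X(1) w(1) \<zeta>_nonneg by (intro member_le_sum) (auto simp: g_def)
        finally show ?thesis .
      qed (simp add: w(3) g_def)
      ultimately show "(\<lambda>k. \<phi> k y) \<longlonglongrightarrow> w y" by (simp add: min.absorb2)
    qed
  qed
  show ?thesis
  proof (rule pform_le_of_AE_tendsto(2)[OF p u_meas u_fin \<phi>_meas w_meas _ _ lim bound tendsto_const])
    show "gagliardo p b (\<phi> k) \<le> ennreal (enn2real M)" for k using \<phi>_gagliardo M_fin by simp
  qed simp
qed

end


section \<open>De Giorgi iteration\<close>

text \<open>The invariant is \<open>Z j \<le> \<delta> * \<tau> ^ j\<close>. The ratio solves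
  \<open>(B * \<tau>) powr \<theta> = \<tau>\<close>, so the growth \<open>B ^ j\<close> is beaten
  at every step, and \<open>\<delta>\<close> solves
  \<open>(C * \<delta>) powr \<theta> = \<tau> * \<delta>\<close>, which closes the
  induction.\<close>

lemma superlinear_decay:
  fixes C B \<theta> :: real
  assumes C: "0 < C" and B: "1 < B" and \<theta>: "1 < \<theta>"
  obtains \<delta> where "0 < \<delta>"
    "\<And>Z. (\<And>j. 0 \<le> Z j) \<Longrightarrow> (\<And>j. Z (Suc j) \<le> (C * B ^ j * Z j) powr \<theta>) \<Longrightarrow> Z 0 \<le> \<delta> \<Longrightarrow> Z \<longlonglongrightarrow> 0"
proof -
  define \<tau> where "\<tau> = B powr (- \<theta> / (\<theta> - 1))"
  define \<delta> where "\<delta> = (\<tau> / C powr \<theta>) powr (1 / (\<theta> - 1))"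
  have \<tau>: "0 < \<tau>" "\<tau> < 1"
    using B \<theta> powr_less_mono[of "- \<theta> / (\<theta> - 1)" 0 B] by (auto simp: \<tau>_def divide_neg_pos)
  have \<delta>: "0 < \<delta>" using \<tau> C by (simp add: \<delta>_def)
  have B\<tau>: "(B * \<tau>) powr \<theta> = \<tau>"
  proof -
    have "B * \<tau> = B powr (1 + - \<theta> / (\<theta> - 1))"
      using B by (simp add: \<tau>_def powr_add del: add_uminus_conv_diff)
    then have "(B * \<tau>) powr \<theta> = B powr ((1 + - \<theta> / (\<theta> - 1)) * \<theta>)" by (simp add: powr_powr)
    also have "(1 + - \<theta> / (\<theta> - 1)) * \<theta> = - \<theta> / (\<theta> - 1)" using \<theta> by (simp add: field_simps)
    finally show ?thesis by (simp add: \<tau>_def)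
  qed
  have C\<delta>: "(C * \<delta>) powr \<theta> = \<tau> * \<delta>"
  proof -
    have "\<delta> powr (\<theta> - 1) = \<tau> / C powr \<theta>" using \<theta> \<tau> C by (simp add: \<delta>_def powr_powr)
    moreover have "\<delta> powr \<theta> = \<delta> powr (\<theta> - 1) * \<delta>"
      using \<delta> powr_mult_base[of \<delta> "\<theta> - 1"] by (simp add: mult.commute)
    ultimately show ?thesis using C \<delta> by (simp add: powr_mult)
  qed
  show ?thesis
  proof (rule that[OF \<delta>])
    fix Z :: "nat \<Rightarrow> real"
    assume Z: "\<And>j. 0 \<le> Z j" "\<And>j. Z (Suc j) \<le> (C * B ^ j * Z j) powr \<theta>" "Z 0 \<le> \<delta>"
    have le: "Z j \<le> \<delta> * \<tau> ^ j" for j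
    proof (induction j)
      case (Suc j)
      have "Z (Suc j) \<le> (C * B ^ j * Z j) powr \<theta>" by (rule Z)
      also have "\<dots> \<le> (C * B ^ j * (\<delta> * \<tau> ^ j)) powr \<theta>"
        using \<theta> C B Z(1) Suc.IH by (intro powr_mono2 mult_left_mono mult_nonneg_nonneg) auto
      also have "C * B ^ j * (\<delta> * \<tau> ^ j) = (C * \<delta>) * (B * \<tau>) ^ j" by (simp add: power_mult_distrib)
      also have "\<dots> powr \<theta> = (C * \<delta>) powr \<theta> * ((B * \<tau>) powr \<theta>) ^ j"
        using C \<delta> B \<tau> by (simp only: power_powr mult_pos_pos zero_less_power powr_mult)
      also have "\<dots> = \<delta> * \<tau> ^ Suc j" by (simp only: B\<tau> C\<delta>) simp
      finally show ?case .
    qed (use Z in simp)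
    show "Z \<longlonglongrightarrow> 0"
    proof (rule real_tendsto_sandwich[OF _ _ tendsto_const])
      show "(\<lambda>j. \<delta> * \<tau> ^ j) \<longlonglongrightarrow> 0"
        using \<tau> by (intro tendsto_mult_right_zero LIMSEQ_power_zero) auto
    qed (use Z le in auto)
  qed
qed

text \<open>De Giorgi iteration along the levels \<open>M (2 - 2\<^sup>-\<^sup>j)\<close>: above level \<open>j + 1\<close> the function \<open>u\<close> is
  at most \<open>2\<^sup>j\<^sup>+\<^sup>3\<close> times its excess over level \<open>j\<close>, so even the critical growth of the right-hand
  side gives a superlinear recursion.\<close>

lemma de_giorgi_bounded:
  fixes u :: "'a::euclidean_space \<Rightarrow> real" and s p R A :: real
  defines "n \<equiv> real DIM('a)" and "q \<equiv> crit_exp (real DIM('a)) s p"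
  assumes p: "1 < p" and s: "0 < s" and sp: "s * p < n"
    and u_meas[measurable]: "u \<in> borel_measurable borel"
    and u: "\<And>x. 0 \<le> u x" "\<And>x. R < norm x \<Longrightarrow> u x = 0"
    and uq: "(\<integral>\<^sup>+x. ennreal (u x powr q) \<partial>lborel) < \<infinity>" and A: "0 < A"
    and cacc: "\<And>k T. 1 \<le> k \<Longrightarrow> 0 \<le> T \<Longrightarrow> gagliardo p (n + s * p) (\<lambda>x. min (max (u x - k) 0) T)
      \<le> ennreal A * (\<integral>\<^sup>+x. ennreal (u x powr (q - 1) * max (u x - k) 0) \<partial>lborel)"
  shows "\<exists>M. AE x in lborel. u x \<le> M"
proof -
  have n: "0 < n" by (simp add: n_def)
  have q: "p < q"
  proof -
    have "p * (n - s * p) < p * n" using p s sp by (intro mult_strict_left_mono) auto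
    then show ?thesis using sp by (simp add: q_def crit_exp_def n_def[symmetric] field_simps)
  qed
  have q1: "1 < q" using p q by simp
  define S where "S = sobolev_const n s p"
  have "0 < unit_ball_vol n" using n by simp
  then have S: "0 < S" unfolding S_def sobolev_const_def by (intro mult_pos_pos) auto
  define Z where "Z k = (\<integral>\<^sup>+x. ennreal (max (u x - k) 0 powr q) \<partial>lborel)" for k
  define W where "W k = (\<integral>\<^sup>+x. ennreal (u x powr (q - 1) * max (u x - k) 0) \<partial>lborel)" for k
  have Z_fin: "Z k < \<infinity>" if "0 \<le> k" for k
  proof -
    have "Z k \<le> (\<integral>\<^sup>+x. ennreal (u x powr q) \<partial>lborel)"
      unfolding Z_def using u(1) that q1 by (intro nn_integral_mono ennreal_leI powr_mono2) auto
    then show ?thesis using uq by (rule le_less_trans)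
  qed
  \<comment> \<open>Sobolev's inequality is applied to the bounded truncations supplied by
    \<open>cacc\<close>; the resulting bound does not depend on the height \<open>m\<close>, so
    Fatou's lemma removes the truncation.\<close>
  have W_Z: "Z k \<le> ennreal ((S * (A * w)) powr (q / p))" if k: "1 \<le> k" and w: "W k \<le> ennreal w" "0 \<le> w" for k w
    unfolding Z_def
  proof (rule fatou_le[OF _ _ _ tendsto_const])
    show "AE x in lborel. (\<lambda>m. ennreal (min (max (u x - k) 0) (real m) powr q)) \<longlonglongrightarrow> ennreal (max (u x - k) 0 powr q)"
    proof (intro AE_I2 tendsto_eventually)
      fix x
      obtain m0 where "max (u x - k) 0 \<le> real m0" using real_arch_simple by blast
      then show "eventually (\<lambda>m. ennreal (min (max (u x - k) 0) (real m) powr q) = ennreal (max (u x - k) 0 powr q)) sequentially"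
        by (intro eventually_sequentiallyI[of m0]) (simp add: min_def)
    qed
    show "(\<integral>\<^sup>+x. ennreal (min (max (u x - k) 0) (real m) powr q) \<partial>lborel) \<le> ennreal ((S * (A * w)) powr (q / p))" for m
      unfolding S_def n_def q_def
    proof (rule fractional_sobolev[OF p s sp[unfolded n_def], where R = R])
      show "min (max (u x - k) 0) (real m) = 0" if "R < norm x" for x using u(2)[OF that] k by simp
      have "gagliardo p (n + s * p) (\<lambda>x. min (max (u x - k) 0) (real m)) \<le> ennreal A * W k"
        unfolding W_def using k by (intro cacc) auto
      also have "\<dots> \<le> ennreal A * ennreal w" by (intro mult_left_mono w) simp
      also have "\<dots> = ennreal (A * w)" using A w by (simp add: ennreal_mult)
      finally show "gagliardo p (real DIM('a) + s * p) (\<lambda>x. min (max (u x - k) 0) (real m)) \<le> ennreal (A * w)"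
        by (simp add: n_def)
    qed (use A w in auto)
  qed measurable
  have level: "W (M * (2 - (1 / 2) ^ Suc j)) \<le> ennreal ((2 powr (q - 1)) ^ (j + 3)) * Z (M * (2 - (1 / 2) ^ j))"
    if M: "1 \<le> M" for M :: real and j :: nat
  proof -
    define k where "k = M * (2 - (1 / 2) ^ j)"
    define k' where "k' = M * (2 - (1 / 2) ^ Suc j)"
    have k_le: "0 \<le> k" "k \<le> 2 * M"
    proof -
      have "(1 / 2 :: real) ^ j \<le> 1" by (rule power_le_one) auto
      then show "0 \<le> k" "k \<le> 2 * M" using M by (auto simp: k_def)
    qed
    have gap: "k' - k = M * (1 / 2) ^ Suc j" by (simp add: k_def k'_def algebra_simps)
    have gap_pos: "0 < k' - k" unfolding gap using M by simp
    have pw: "(2 ^ (j + 3)) powr (q - 1) = (2 powr (q - 1)) ^ (j + 3)"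
      by (rule power_powr) simp
    have pt: "u x powr (q - 1) * max (u x - k') 0 \<le> (2 powr (q - 1)) ^ (j + 3) * max (u x - k) 0 powr q" for x
    proof (cases "u x \<le> k'")
      case False
      define w where "w = u x - k"
      have w: "k' - k \<le> w" "0 < w" "u x - k' \<le> w" using False gap_pos by (auto simp: w_def)
      \<comment> \<open>All levels lie below \<open>2 * M\<close> and the gap is
        \<open>M / 2 ^ (j + 1)\<close>, so above \<open>k'\<close> the lower level \<open>k\<close>
        is at most \<open>2 ^ (j + 2)\<close> times the excess \<open>w\<close>; adding
        \<open>w\<close> itself gives the exponent \<open>j + 3\<close>.\<close>
      have "2 * M = 2 ^ (j + 2) * (k' - k)" unfolding gap by (simp add: power_divide)
      also have "\<dots> \<le> 2 ^ (j + 2) * w" using w by (intro mult_left_mono) auto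
      finally have "2 * M \<le> 2 ^ (j + 2) * w" .
      moreover have "u x = w + k" by (simp add: w_def)
      ultimately have "u x \<le> w + 2 ^ (j + 2) * w" using k_le(2) by linarith
      also have "\<dots> \<le> 2 ^ (j + 2) * w + 2 ^ (j + 2) * w"
        using w mult_right_mono[OF one_le_power[of "2::real" "j + 2"], of w] by simp
      also have "\<dots> = 2 ^ (j + 3) * w" by (simp add: power_add)
      finally have "u x powr (q - 1) \<le> (2 ^ (j + 3) * w) powr (q - 1)"
        using u(1) q1 by (intro powr_mono2) auto
      also have "\<dots> = (2 powr (q - 1)) ^ (j + 3) * w powr (q - 1)"
        using w by (simp add: powr_mult pw)
      finally have "u x powr (q - 1) * (u x - k') \<le> (2 powr (q - 1)) ^ (j + 3) * w powr (q - 1) * w"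
        using w False by (intro mult_mono) auto
      also have "\<dots> = (2 powr (q - 1)) ^ (j + 3) * w powr q"
        using w powr_mult_base[of w "q - 1"] by (simp add: mult_ac)
      finally show ?thesis using False w by (simp add: w_def max_def)
    qed simp
    have "W k' \<le> (\<integral>\<^sup>+x. ennreal ((2 powr (q - 1)) ^ (j + 3)) * ennreal (max (u x - k) 0 powr q) \<partial>lborel)"
      unfolding W_def
      by (intro nn_integral_mono) (simp only: ennreal_mult'[symmetric] zero_le_power powr_ge_zero, rule ennreal_leI[OF pt])
    also have "\<dots> = ennreal ((2 powr (q - 1)) ^ (j + 3)) * Z k"
      unfolding Z_def by (rule nn_integral_cmult) measurable
    finally show ?thesis by (simp add: k_def k'_def)
  qed
  define B where "B = 2 powr (q - 1)"
  have B: "1 < B" unfolding B_def using q1 by simp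
  \<comment> \<open>The factor \<open>B ^ (j + 3)\<close> from \<open>level\<close> is split into
    the constant \<open>B ^ 3\<close> and the growth \<open>B ^ j\<close>; the exponent
    \<open>q / p\<close>, larger than 1, is the Sobolev gain.\<close>
  obtain \<delta> where \<delta>: "0 < \<delta>"
    "\<And>Z. (\<And>j. 0 \<le> Z j) \<Longrightarrow> (\<And>j. Z (Suc j) \<le> (S * A * B ^ 3 * B ^ j * Z j) powr (q / p)) \<Longrightarrow> Z 0 \<le> \<delta> \<Longrightarrow> Z \<longlonglongrightarrow> 0"
    using superlinear_decay[of "S * A * B ^ 3" B "q / p"] S A B p q by auto
  \<comment> \<open>Dominated convergence with majorant \<open>u powr q\<close>.\<close>
  have Z_lim: "(\<lambda>m. Z (real m)) \<longlonglongrightarrow> 0"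
  proof -
    have "(\<lambda>m. Z (real m)) \<longlonglongrightarrow> (\<integral>\<^sup>+x. (0::ennreal) \<partial>(lborel :: 'a measure))"
      unfolding Z_def
    proof (rule nn_integral_dominated_convergence[where w = "\<lambda>x. ennreal (u x powr q)"])
      show "AE x in lborel. ennreal (max (u x - real m) 0 powr q) \<le> ennreal (u x powr q)" for m
        using u(1) q1 by (intro AE_I2 ennreal_leI powr_mono2) auto
      show "AE x in lborel. (\<lambda>m. ennreal (max (u x - real m) 0 powr q)) \<longlonglongrightarrow> 0"
      proof (intro AE_I2 tendsto_eventually)
        fix x
        obtain m0 where "u x \<le> real m0" using real_arch_simple by blast
        then show "eventually (\<lambda>m. ennreal (max (u x - real m) 0 powr q) = 0) sequentially"
          by (intro eventually_sequentiallyI[of m0]) (simp add: max_def)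
      qed
    qed (use uq in auto)
    then show ?thesis by simp
  qed
  \<comment> \<open>\<open>1 \<le> m\<close> keeps every level in the range where
    \<open>cacc\<close> holds; the level with index 0 is \<open>M\<close> itself, so this
    \<open>m\<close> makes the initial value small.\<close>
  have "eventually (\<lambda>m. Z (real m) < ennreal \<delta> \<and> 1 \<le> m) sequentially"
    using order_tendstoD(2)[OF Z_lim, of "ennreal \<delta>"] \<delta>(1) eventually_ge_at_top[of 1] by (simp add: eventually_conj)
  then obtain m where m: "Z (real m) < ennreal \<delta>" "1 \<le> m"
    by (metis (no_types, lifting) eventually_sequentially order_refl)
  define M where "M = real m"
  have M: "1 \<le> M" using m by (simp add: M_def)
  define k where "k j = M * (2 - (1 / 2) ^ j)" for j :: nat
  have k: "1 \<le> k j" "k j \<le> 2 * M" for j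
  proof -
    have "(1 / 2 :: real) ^ j \<le> 1" by (rule power_le_one) auto
    then have "M * 1 \<le> k j" unfolding k_def using M by (intro mult_left_mono) auto
    then show "1 \<le> k j" using M by simp
    show "k j \<le> 2 * M" using M by (simp add: k_def)
  qed
  define z where "z j = enn2real (Z (k j))" for j
  have Zz: "Z (k j) = ennreal (z j)" for j
    using Z_fin[of "k j"] k(1)[of j] by (simp add: z_def)
  have "z \<longlonglongrightarrow> 0"
  proof (rule \<delta>(2))
    show "0 \<le> z j" for j by (simp add: z_def)
    show "z (Suc j) \<le> (S * A * B ^ 3 * B ^ j * z j) powr (q / p)" for j
    proof -
      have "W (k (Suc j)) \<le> ennreal (B ^ (j + 3)) * ennreal (z j)"
        using level[OF M, of j] unfolding k_def[symmetric] Zz B_def[symmetric] .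
      also have "\<dots> = ennreal (B ^ (j + 3) * z j)" using B by (simp add: ennreal_mult z_def)
      finally have "Z (k (Suc j)) \<le> ennreal ((S * (A * (B ^ (j + 3) * z j))) powr (q / p))"
        using B by (intro W_Z k) (auto simp: z_def)
      then show ?thesis by (simp add: Zz power_add mult_ac)
    qed
    have "Z (k 0) < ennreal \<delta>" using m(1) by (simp add: k_def M_def)
    then show "z 0 \<le> \<delta>" unfolding Zz using ennreal_leI[of \<delta> "z 0"] by (meson leD linear)
  qed
  then have "(\<lambda>j. ennreal (z j)) \<longlonglongrightarrow> ennreal 0" by (rule tendsto_ennrealI)
  moreover have "Z (2 * M) \<le> ennreal (z j)" for j
    unfolding Zz[symmetric] Z_def using k(2)[of j] q1
    by (intro nn_integral_mono ennreal_leI powr_mono2) (auto simp: max_def)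
  ultimately have "Z (2 * M) \<le> ennreal 0" by (intro LIMSEQ_le_const) auto
  then have "AE x in lborel. ennreal (max (u x - 2 * M) 0 powr q) = 0"
    unfolding Z_def by (subst (asm) ennreal_0, subst (asm) le_zero_eq, subst (asm) nn_integral_0_iff_AE) auto
  then have "AE x in lborel. u x \<le> 2 * M"
    by eventually_elim (auto simp: max_def split: if_splits)
  then show ?thesis ..
qed


section \<open>Boundedness of weak solutions\<close>

text \<open>Completeness of Lebesgue measure makes a function measurable once it equals a Borel one
  almost everywhere. This moves the weak formulation, stated with \<open>lebesgue\<close>, to
  \<open>lborel\<close>, where the product and translation arguments take place.\<close>

lemma lebesgue_cong_borel:
  fixes F g :: "'a::euclidean_space \<Rightarrow> real"
  assumes g: "g \<in> borel_measurable borel" and eq: "AE x in lborel. F x = g x"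
  shows "integrable lebesgue F \<longleftrightarrow> integrable lborel g" and "integral\<^sup>L lebesgue F = integral\<^sup>L lborel g"
proof -
  have g': "g \<in> borel_measurable lborel" "g \<in> borel_measurable lebesgue"
    using g by (auto intro: measurable_completion)
  have eq': "AE x in lebesgue. g x = F x" using AE_completion[OF eq] by (simp add: eq_commute)
  have F: "F \<in> borel_measurable lebesgue" by (rule borel_measurable_AE[OF g'(2) eq'])
  show "integrable lebesgue F \<longleftrightarrow> integrable lborel g"
    using integrable_cong_AE[OF g'(2) F eq'] integrable_completion[OF g'(1)] by simp
  show "integral\<^sup>L lebesgue F = integral\<^sup>L lborel g"
    using integral_cong_AE[OF g'(2) F eq'] integral_completion[OF g'(1)] by simp
qed

theorem theorem6p4:
  fixes \<Omega> :: "(real^'n) set" and u :: "real^'n \<Rightarrow> real" and p s lam q \<alpha> :: real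
  assumes "1 < p" and "0 < s" and "s < 1" and "s * p < real CARD('n)"
    and "bounded_smooth_domain \<Omega>"
    and "lam > 0" and "0 < q" and "q \<le> 1"
    and "\<alpha> \<le> crit_exp (real CARD('n)) s p - 1"
    and "positive_weak_solution \<Omega> p s lam q \<alpha> u"
  shows "u \<in> Linfty \<Omega>"
proof -
  note p = assms(1) and s = assms(2,3) and sp = assms(4) and dom = assms(5) and lam = assms(6) and q = assms(7)
  define b where "b = real CARD('n) + s * p"
  define pc where "pc = crit_exp (real CARD('n)) s p"
  have b: "real CARD('n) < b" "b - p < real CARD('n)"
  proof -
    show "real CARD('n) < b" using p s by (simp add: b_def)
    have "s * p < 1 * p" using p s by (intro mult_strict_right_mono) auto
    then show "b - p < real CARD('n)" by (simp add: b_def)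
  qed
  have pc: "p < pc"
  proof -
    have "p * (real CARD('n) - s * p) < p * real CARD('n)" using p s by (intro mult_strict_left_mono) auto
    then show ?thesis using sp by (simp add: pc_def crit_exp_def field_simps)
  qed
  have \<Omega>: "open \<Omega>" "bounded \<Omega>" using dom by (auto simp: bounded_smooth_domain_def)
  have \<Omega>_borel[measurable]: "\<Omega> \<in> sets borel" using \<Omega> by simp
  obtain R where R: "\<And>x. x \<in> \<Omega> \<Longrightarrow> norm x \<le> R" using \<Omega>(2) by (auto simp: bounded_iff)
  have u_X0: "u \<in> X0 \<Omega> p s" and u_pos: "AE x in lebesgue. x \<in> \<Omega> \<longrightarrow> u x > 0"
    and u_test: "\<And>\<psi>. test_fun \<Omega> \<psi> \<Longrightarrow>
        set_integrable lebesgue \<Omega> (\<lambda>x. (lam * u x powr (- q) + u x powr \<alpha>) * \<psi> x) \<and>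
        frac_plap_form \<Omega> p s u \<psi> - (LINT x:\<Omega>|lebesgue. (lam * u x powr (- q) + u x powr \<alpha>) * \<psi> x) = 0"
    using assms(10) unfolding positive_weak_solution_def by auto
  have u_leb: "u \<in> borel_measurable lebesgue" and u_off: "AE x in lebesgue. x \<notin> \<Omega> \<longrightarrow> u x = 0"
    and u_energy: "X0_energy \<Omega> p s u < \<infinity>"
    using u_X0 unfolding X0_def by auto
  obtain u0 where u0: "u0 \<in> borel_measurable lborel" "AE x in lborel. u x = u0 x"
    using completion_ex_borel_measurable_real[OF u_leb] by blast
  have u0_meas[measurable]: "u0 \<in> borel_measurable borel" using u0(1) by simp
  \<comment> \<open>A Borel representative that is nonnegative and vanishes off
    \<open>\<Omega>\<close> at every point, not merely almost everywhere.\<close>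
  define v where "v x = (if x \<in> \<Omega> then max (u0 x) 0 else 0)" for x
  have v_meas[measurable]: "v \<in> borel_measurable borel" unfolding v_def by measurable
  have v_nonneg: "0 \<le> v x" for x by (simp add: v_def)
  have v_off: "v x = 0" if "x \<notin> \<Omega>" for x using that by (simp add: v_def)
  have v_supp: "v x = 0" if "R < norm x" for x using R[of x] that v_off[of x] by force
  have uv: "AE x in lborel. u x = v x"
    using u0(2) u_pos[unfolded AE_completion_iff] u_off[unfolded AE_completion_iff]
    by eventually_elim (auto simp: v_def)
  have uv2: "AE z in (lborel :: ((real^'n) \<times> (real^'n)) measure). u (fst z) = v (fst z) \<and> u (snd z) = v (snd z)"
    by (rule AE_lborel_prod[OF uv])
  \<comment> \<open>Since \<open>0 powr\<close> any exponent is 0, \<open>f\<close> is finite and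
    nonnegative also where \<open>v\<close> vanishes.\<close>
  define f where "f x = indicator \<Omega> x * (lam * v x powr (- q) + v x powr \<alpha>)" for x
  have f_meas[measurable]: "f \<in> borel_measurable borel" unfolding f_def by measurable
  have f_nonneg: "0 \<le> f x" for x using lam by (simp add: f_def)
  have v_fin: "gagliardo p b v < \<infinity>"
  proof -
    \<comment> \<open>Off \<open>Qset \<Omega>\<close> both points lie outside
      \<open>\<Omega>\<close>, so the increment of \<open>v\<close> is 0 and the whole-space
      integral adds nothing.\<close>
    have "X0_energy \<Omega> p s u = gagliardo p b v"
      unfolding X0_energy_def gagliardo_def nn_integral_completion
    proof (rule nn_integral_cong_AE, use uv2 in eventually_elim)
      case (elim z)
      then show ?case
        using v_off[of "fst z"] v_off[of "snd z"] p
        by (cases z) (auto simp: Qset_def indicator_def b_def)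
    qed
    then show ?thesis using u_energy by simp
  qed
  have test: "integrable lborel (\<lambda>x. f x * \<psi> x) \<and> pform p b v \<psi> = (\<integral>x. f x * \<psi> x \<partial>lborel)"
    if \<psi>: "test_fun \<Omega> \<psi>" for \<psi>
  proof -
    have \<psi>_meas[measurable]: "\<psi> \<in> borel_measurable borel"
      using \<psi> smooth_fun_continuous by (auto simp: test_fun_def intro: borel_measurable_continuous_onI)
    have \<psi>_off: "\<psi> x = 0" if "x \<notin> \<Omega>" for x
    proof (rule ccontr)
      assume "\<psi> x \<noteq> 0"
      then have "x \<in> closure {x. \<psi> x \<noteq> 0}" using closure_subset[of "{x. \<psi> x \<noteq> 0}"] by auto
      then show False using \<psi> that by (auto simp: test_fun_def)
    qed
    have f_meas': "(\<lambda>x. f x * \<psi> x) \<in> borel_measurable borel" by measurable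
    have eq_f: "AE x in lborel. indicator \<Omega> x *\<^sub>R ((lam * u x powr (- q) + u x powr \<alpha>) * \<psi> x) = f x * \<psi> x"
      using uv by eventually_elim (simp add: f_def)
    have eq_form: "AE z in lborel. indicator (Qset \<Omega>) z *\<^sub>R (case z of (x, y) \<Rightarrow>
        \<bar>u x - u y\<bar> powr (p - 2) * (u x - u y) * (\<psi> x - \<psi> y) / norm (x - y) powr (real CARD('n) + s * p)) =
        \<bar>v (fst z) - v (snd z)\<bar> powr (p - 2) * (v (fst z) - v (snd z)) * (\<psi> (fst z) - \<psi> (snd z)) / norm (fst z - snd z) powr b"
    proof (use uv2 in eventually_elim)
      case (elim z)
      then show ?case
        using \<psi>_off[of "fst z"] \<psi>_off[of "snd z"]
        by (cases z) (auto simp: Qset_def indicator_def b_def)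
    qed
    have "(\<lambda>z. \<bar>v (fst z) - v (snd z)\<bar> powr (p - 2) * (v (fst z) - v (snd z)) * (\<psi> (fst z) - \<psi> (snd z))
        / norm (fst z - snd z) powr b) \<in> borel_measurable borel" by measurable
    from lebesgue_cong_borel(2)[OF this eq_form] have "frac_plap_form \<Omega> p s u \<psi> = pform p b v \<psi>"
      unfolding frac_plap_form_def pform_def set_lebesgue_integral_def .
    with u_test[OF \<psi>] lebesgue_cong_borel[OF f_meas' eq_f] show ?thesis
      unfolding set_integrable_def set_lebesgue_integral_def by simp
  qed
  interpret weak_equation \<Omega> p b v f
    by unfold_locales (use \<Omega> p b v_meas v_fin f_meas f_nonneg test in auto)
  \<comment> \<open>Sobolev's inequality for the solution itself starts the iteration and makes
    \<open>f x * F (v x)\<close> integrable below.\<close>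
  have v_pc: "(\<integral>\<^sup>+x. ennreal (v x powr pc) \<partial>lborel) < \<infinity>"
  proof -
    have "(\<integral>\<^sup>+x. ennreal (v x powr crit_exp (real DIM(real^'n)) s p) \<partial>lborel) \<le>
        ennreal ((sobolev_const (real DIM(real^'n)) s p * enn2real (gagliardo p b v)) powr (crit_exp (real DIM(real^'n)) s p / p))"
      using p s sp v_nonneg v_supp v_fin by (intro fractional_sobolev[where R = R]) (auto simp: b_def)
    then show ?thesis by (simp add: pc_def) (metis ennreal_less_top le_less_trans)
  qed
  have cacc: "gagliardo p b (\<lambda>x. min (max (v x - k) 0) T) \<le>
      ennreal (lam + 1) * (\<integral>\<^sup>+x. ennreal (v x powr (pc - 1) * max (v x - k) 0) \<partial>lborel)"
    if k: "1 \<le> k" and T: "0 \<le> T" for k T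
  proof -
    define F where "F t = min (max (t - k) 0) T" for t
    have F_meas[measurable]: "F \<in> borel_measurable borel" unfolding F_def by measurable
    have Fv_fin: "gagliardo p b (\<lambda>x. F (v x)) < \<infinity>"
    proof (rule le_less_trans[OF gagliardo_mono v_fin])
      show "\<bar>F (v x) - F (v y)\<bar> \<le> \<bar>v x - v y\<bar>" for x y unfolding F_def by linarith
    qed (use p in simp)
    have F_bounds: "0 \<le> F t" "F t \<le> T" "F t \<le> max (t - k) 0" for t using T by (auto simp: F_def)
    have pt: "f x * F (v x) \<le> (lam + 1) * (v x powr (pc - 1) * max (v x - k) 0)" for x
    proof (cases "v x \<le> k")
      case True
      then show ?thesis using T by (simp add: F_def)
    next
      case False
      then have v1: "1 \<le> v x" using k by simp
      \<comment> \<open>Above 1 a larger exponent gives a larger power, and both \<open>- q\<close>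
        and \<open>\<alpha>\<close> are at most \<open>pc - 1\<close>; a negative
        \<open>\<alpha>\<close> is covered too.\<close>
      have "v x powr (- q) \<le> v x powr (pc - 1)" "v x powr \<alpha> \<le> v x powr (pc - 1)"
        using v1 q p pc assms(9) by (intro powr_mono; simp add: pc_def)+
      then have "lam * v x powr (- q) + v x powr \<alpha> \<le> (lam + 1) * v x powr (pc - 1)"
        unfolding distrib_right mult_1 using lam by (intro add_mono mult_left_mono) auto
      then have "f x \<le> (lam + 1) * v x powr (pc - 1)" using lam by (auto simp: f_def indicator_def)
      then have "f x * F (v x) \<le> (lam + 1) * v x powr (pc - 1) * max (v x - k) 0"
        using F_bounds lam by (intro mult_mono) auto
      then show ?thesis by (simp add: mult.assoc)
    qed
    have pt2: "v x powr (pc - 1) * max (v x - k) 0 \<le> v x powr pc" for x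
    proof -
      have "v x powr (pc - 1) * max (v x - k) 0 \<le> v x powr (pc - 1) * v x"
        using k v_nonneg[of x] by (intro mult_left_mono) auto
      then show ?thesis using powr_mult_base[of "v x" "pc - 1"] v_nonneg[of x] by (simp add: mult.commute)
    qed
    have fF_nn: "(\<integral>\<^sup>+x. ennreal (f x * F (v x)) \<partial>lborel) \<le>
        ennreal (lam + 1) * (\<integral>\<^sup>+x. ennreal (v x powr (pc - 1) * max (v x - k) 0) \<partial>lborel)"
    proof -
      have "(\<integral>\<^sup>+x. ennreal (f x * F (v x)) \<partial>lborel) \<le>
          (\<integral>\<^sup>+x. ennreal (lam + 1) * ennreal (v x powr (pc - 1) * max (v x - k) 0) \<partial>lborel)"
        by (intro nn_integral_mono, subst ennreal_mult'[symmetric]) (use lam pt in \<open>auto intro: ennreal_leI\<close>)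
      also have "\<dots> = ennreal (lam + 1) * (\<integral>\<^sup>+x. ennreal (v x powr (pc - 1) * max (v x - k) 0) \<partial>lborel)"
        by (rule nn_integral_cmult) measurable
      finally show ?thesis .
    qed
    have "(\<integral>\<^sup>+x. ennreal (v x powr (pc - 1) * max (v x - k) 0) \<partial>lborel) \<le> (\<integral>\<^sup>+x. ennreal (v x powr pc) \<partial>lborel)"
      by (intro nn_integral_mono ennreal_leI pt2)
    then have "(\<integral>\<^sup>+x. ennreal (f x * F (v x)) \<partial>lborel) < \<infinity>"
      using fF_nn v_pc by (auto simp: ennreal_mult_less_top intro!: le_less_trans[OF fF_nn])
    then have int: "integrable lborel (\<lambda>x. f x * F (v x))"
      using f_nonneg F_bounds by (intro integrableI_nonneg) auto
    \<comment> \<open>The equation enters only through the one-sided inequality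
      \<open>pform_le_of_inward_shift\<close>; the lower bound of the form by the seminorm is
      pointwise.\<close>
    have "gagliardo p b (\<lambda>x. F (v x)) \<le> ennreal (pform p b v (\<lambda>x. F (v x)))"
      by (rule gagliardo_le_pform[OF p v_meas v_fin F_meas]) (auto simp: F_def)
    also have "\<dots> \<le> ennreal (\<integral>x. f x * F (v x) \<partial>lborel)"
    proof (intro ennreal_leI pform_le_of_inward_shift[OF \<Omega>(2), where T = T])
      fix x0 assume "x0 \<in> closure \<Omega>"
      from smooth_domain_inward_shift[OF dom this]
      show "\<exists>r e. 0 < r \<and> norm e \<le> 1 \<and>
          (\<forall>t x. 0 < t \<longrightarrow> t < r \<longrightarrow> x \<in> closure \<Omega> \<inter> cball x0 r \<longrightarrow> x + t *\<^sub>R e \<in> \<Omega>)"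
        by metis
    next
      show "F (v x) = 0" if "x \<notin> \<Omega>" for x using v_off[OF that] k T by (simp add: F_def)
    qed (use F_bounds Fv_fin int in auto)
    also have "\<dots> = (\<integral>\<^sup>+x. ennreal (f x * F (v x)) \<partial>lborel)"
      using f_nonneg F_bounds by (intro nn_integral_eq_integral[symmetric] int) auto
    finally show ?thesis using fF_nn by (simp add: F_def)
  qed
  have "\<exists>M. AE x in lborel. v x \<le> M"
    using p s sp v_meas v_nonneg v_supp v_pc cacc lam
    by (intro de_giorgi_bounded[of p s v R "lam + 1"]) (auto simp: b_def pc_def)
  then obtain M where M: "AE x in lborel. v x \<le> M" by blast
  have "AE x in lborel. \<bar>u x\<bar> \<le> M"
    using uv M by eventually_elim (simp add: v_nonneg)
  then have "AE x in lebesgue. \<bar>u x\<bar> \<le> M" by (rule AE_completion)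
  then have "AE x in lebesgue_on \<Omega>. \<bar>u x\<bar> \<le> M"
    using \<Omega>_borel by (subst AE_restrict_space_iff) (auto elim: eventually_mono)
  then show ?thesis
    using measurable_restrict_space1[OF u_leb, of \<Omega>] by (auto simp: Linfty_def)
qed

end
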